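(* Let $f:\mathbb R^n\to[0,\infty)$, $n\ge2$, be an $L_p$-nested function and let $\varrho$ be a probability density on $(0,\infty)$. Let $\rho$ be the $L_p$-nested symmetric distribution on $\mathbb R^n$ with respect to $f$ with radial density $\varrho$. Then the output of the following procedure is an exact sample from $\rho$, and the computational complexity of producing one sample is $O(n)$ (counting a draw from a $k$-dimensional Dirichlet distribution as $O(k)$ operations and the draws from the univariate distributions as $O(1)$). All random draws are mutually independent. 1. Sample $v_\emptyset$ from the beta distribution $\beta[n,1]$. 2. For each inner node $I$ of the tree of $f$, sample $\boldsymbol s_I$ from the Dirichlet distribution $\mathrm{Dir}\left[\frac{n_{I,1}}{p_I},\dots,\frac{n_{I,\ell_I}}{p_I}\right]$ and set $\tilde{\boldsymbol u}_I=\boldsymbol s_I^{1/p_I}$ (component-wise). 3. Starting from the root and descending, for each inner node $I$ set $(v_{I,1},\dots,v_{I,\ell_I})=v_I\cdot\tilde{\boldsymbol u}_I$. The values at the leaves form a vector $\boldsymbol x$ with nonnegative entries. 4. Set $\boldsymbol u=\boldsymbol x/f(\boldsymbol x)$. 5. Sample $\tilde v_\emptyset$ from the density $\varrho$ and set $\tilde{\boldsymbol x}=\tilde v_\emptyset\cdot\boldsymbol u$. 6. Multiply each entry of $\tilde{\boldsymbol x}$ by an independent sample from the uniform distribution over $\{-1,1\}$ and output the result.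
   Context: **$L_p$-nested functions.** An $L_p$-nested function $f:\mathbb R^n\to[0,\infty)$ is given by a finite rooted ordered tree whose $n$ leaves, read from left to right, correspond to the coordinates $x_1,\dots,x_n$; every inner node $I$ has $\ell_I\ge 2$ children, denoted $(I,1),\dots,(I,\ell_I)$, and carries an exponent $p_I>0$. Nodes are denoted by multi-indices describing the path from the root; the root is $\emptyset$, and $(\emptyset,k)=k$. For a node $I$, $\boldsymbol x_I$ denotes the coordinates at leaves in the subtree under $I$, and $n_I$ the number of those leaves ($n_I=1$ if $I$ is a leaf). Put $f_I(\boldsymbol x_I)=|x_i|$ if $I$ is the leaf of $x_i$, and $f_I(\boldsymbol x_I)=\left(\sum_{k=1}^{\ell_I} f_{I,k}(\boldsymbol x_{I,k})^{p_I}\right)^{1/p_I}$ if $I$ is an inner node; $f=f_\emptyset$. **$L_p$-nested symmetric distribution.** A distribution on $\mathbb R^n$ is $L_p$-nested symmetric with respect to $f$ if it has a Lebesgue density depending on $\boldsymbol x$ only through $f(\boldsymbol x)$; its radial density is the density of $f(\boldsymbol X)$, where $\boldsymbol X$ has this distribution. *)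

theory Defs
  imports "HOL-Probability.Probability" "HOL-Library.Extended_Nat"
begin

section \<open>Trees and nested functions\<close>

text \<open>A leaf is a coordinate; an inner node carries its exponent and its ordered list of children.
  Points of \<open>\<real>\<^sup>n\<close> are elements of the product space over the index set \<open>{..<n}\<close>, coordinates being
  numbered from 0.\<close>

datatype ltree = Leaf | Node real "ltree list"

primrec lp_tree :: "ltree \<Rightarrow> bool" where
  "lp_tree Leaf \<longleftrightarrow> True"
| "lp_tree (Node p ts) \<longleftrightarrow> p > 0 \<and> length ts \<ge> 2 \<and> list_all lp_tree ts"

primrec leaf_count :: "ltree \<Rightarrow> nat" where
  "leaf_count Leaf = 1"
| "leaf_count (Node p ts) = sum_list (map leaf_count ts)"

primrec exponent :: "ltree \<Rightarrow> real" where
  "exponent (Node p ts) = p"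

primrec children :: "ltree \<Rightarrow> ltree list" where
  "children Leaf = []"
| "children (Node p ts) = ts"

definition is_leaf :: "ltree \<Rightarrow> bool" where
  "is_leaf t \<longleftrightarrow> t = Leaf"

lemma nth_size_less [termination_simp]:
  "k < length ts \<Longrightarrow> size (ts ! k) < Suc (size_list size (ts :: ltree list))"
  by (meson le_imp_less_Suc nth_mem order_refl size_list_estimation')

text \<open>The coordinates below the \<open>k\<close>-th child form the block of \<open>x\<close> that starts after the leaves of
  the children \<open>0, \<dots>, k - 1\<close>.\<close>

fun lp_nested :: "ltree \<Rightarrow> (nat \<Rightarrow> real) \<Rightarrow> real" where
  "lp_nested Leaf x = \<bar>x 0\<bar>"
| "lp_nested (Node p ts) x =
     (\<Sum>k<length ts. lp_nested (ts ! k) (\<lambda>i. x ((\<Sum>j<k. leaf_count (ts ! j)) + i)) powr p) powr (1 / p)"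

text \<open>Nodes are addressed by multi-indices, the path from the root \<open>[]\<close>; the \<open>k\<close>-th child of \<open>I\<close> is
  \<open>I @ [k]\<close>. The nodes are listed in preorder, so the leaves occur from left to right.
  These lists belong to the representation of the tree that a program may traverse.\<close>

type_synonym node = "nat list"

fun subtree :: "ltree \<Rightarrow> node \<Rightarrow> ltree" where
  "subtree t [] = t"
| "subtree t (k # I) = subtree (children t ! k) I"

fun nodes :: "ltree \<Rightarrow> node list" where
  "nodes Leaf = [[]]"
| "nodes (Node p ts) = [] # concat (map (\<lambda>k. map ((#) k) (nodes (ts ! k))) [0..<length ts])"

definition inner_nodes :: "ltree \<Rightarrow> node list" where
  "inner_nodes t = filter (\<lambda>I. \<not> is_leaf (subtree t I)) (nodes t)"

definition leaf_nodes :: "ltree \<Rightarrow> node list" where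
  "leaf_nodes t = filter (\<lambda>I. is_leaf (subtree t I)) (nodes t)"

definition node_exponent :: "ltree \<Rightarrow> node \<Rightarrow> real" where
  "node_exponent t I = exponent (subtree t I)"

definition child_indices :: "ltree \<Rightarrow> node \<Rightarrow> nat list" where
  "child_indices t I = [0..<length (children (subtree t I))]"


section \<open>Distributions\<close>

abbreviation borel_vec :: "nat \<Rightarrow> (nat \<Rightarrow> real) measure" where
  "borel_vec n \<equiv> PiM {..<n} (\<lambda>_. borel)"

abbreviation lborel_vec :: "nat \<Rightarrow> (nat \<Rightarrow> real) measure" where
  "lborel_vec n \<equiv> PiM {..<n} (\<lambda>_. lborel)"

definition lp_nested_symmetric :: "ltree \<Rightarrow> (nat \<Rightarrow> real) measure \<Rightarrow> bool" where
  "lp_nested_symmetric t M \<longleftrightarrow> prob_space M \<and>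
     (\<exists>h \<in> borel_measurable (lborel_vec (leaf_count t)).
        (\<forall>x \<in> space (lborel_vec (leaf_count t)). \<forall>y \<in> space (lborel_vec (leaf_count t)).
           lp_nested t x = lp_nested t y \<longrightarrow> h x = h y) \<and>
        M = density (lborel_vec (leaf_count t)) h)"

definition radial_density :: "ltree \<Rightarrow> (nat \<Rightarrow> real) measure \<Rightarrow> (real \<Rightarrow> real) \<Rightarrow> bool" where
  "radial_density t M r \<longleftrightarrow> distributed M lborel (lp_nested t) (\<lambda>x. ennreal (r x))"

text \<open>A probability density on \<open>(0, \<infinity>)\<close>, extended by 0 to the real line.\<close>

definition positive_density :: "(real \<Rightarrow> real) \<Rightarrow> bool" where
  "positive_density r \<longleftrightarrow> r \<in> borel_measurable borel \<and> (\<forall>x. 0 \<le> r x) \<and> (\<forall>x\<le>0. r x = 0) \<and>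
     (\<integral>\<^sup>+x. ennreal (r x) \<partial>lborel) = 1"

definition density_dist :: "(real \<Rightarrow> real) \<Rightarrow> real measure" where
  "density_dist r = density lborel (\<lambda>x. ennreal (r x))"

definition beta_dist :: "real \<Rightarrow> real \<Rightarrow> real measure" where
  "beta_dist a b = density_dist
     (\<lambda>x. indicator {0<..<1} x * (x powr (a - 1) * (1 - x) powr (b - 1) / Beta a b))"

definition sign_dist :: "real measure" where
  "sign_dist = distr (measure_pmf (pmf_of_set {-1, 1})) borel (\<lambda>x. x)"

text \<open>The Dirichlet distribution with parameters \<open>a 0, \<dots>, a (k - 1)\<close>: the first \<open>k - 1\<close> coordinates
  have the usual density with respect to Lebesgue measure, and the last one is \<open>1\<close> minus their sum.\<close>

definition dirichlet_density :: "nat \<Rightarrow> (nat \<Rightarrow> real) \<Rightarrow> (nat \<Rightarrow> real) \<Rightarrow> real" where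
  "dirichlet_density k a s =
     (if (\<forall>i<k. 0 < s i) then Gamma (\<Sum>i<k. a i) / (\<Prod>i<k. Gamma (a i)) * (\<Prod>i<k. s i powr (a i - 1)) else 0)"

definition complete_simplex :: "nat \<Rightarrow> (nat \<Rightarrow> real) \<Rightarrow> nat \<Rightarrow> real" where
  "complete_simplex k s = s(k - 1 := 1 - (\<Sum>i<k - 1. s i))"

definition dirichlet_dist :: "nat \<Rightarrow> (nat \<Rightarrow> real) \<Rightarrow> (nat \<Rightarrow> real) measure" where
  "dirichlet_dist k a =
     distr (density (lborel_vec (k - 1)) (\<lambda>s. ennreal (dirichlet_density k a (complete_simplex k s))))
       (borel_vec k) (complete_simplex k)"


section \<open>Randomized programs\<close>

text \<open>\<open>Step\<close> accounts for one elementary operation, that is, a bounded number of real arithmetic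
  operations, powers and accesses to arrays. Arrays are functions, indexed by numbers or by nodes;
  their initial values are arbitrary fillers, as every entry that matters is written before it is read.
  Draws are made one after the other from the given laws; if the laws do not depend on the outcomes of
  earlier draws, the draws are mutually independent.\<close>

datatype 'a prog =
    Return 'a
  | Step "'a prog"
  | Draw "real measure" "real \<Rightarrow> 'a prog"
  | Draw_Dirichlet nat "nat \<Rightarrow> real" "(nat \<Rightarrow> real) \<Rightarrow> 'a prog"

primrec bind_prog :: "'a prog \<Rightarrow> ('a \<Rightarrow> 'b prog) \<Rightarrow> 'b prog" where
  "bind_prog (Return a) c = c a"
| "bind_prog (Step q) c = Step (bind_prog q c)"
| "bind_prog (Draw D q) c = Draw D (\<lambda>y. bind_prog (q y) c)"
| "bind_prog (Draw_Dirichlet k a q) c = Draw_Dirichlet k a (\<lambda>s. bind_prog (q s) c)"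

adhoc_overloading Monad_Syntax.bind \<rightleftharpoons> bind_prog

primrec output_dist :: "'a measure \<Rightarrow> 'a prog \<Rightarrow> 'a measure" where
  "output_dist N (Return a) = return N a"
| "output_dist N (Step q) = output_dist N q"
| "output_dist N (Draw D q) = Giry_Monad.bind D (\<lambda>y. output_dist N (q y))"
| "output_dist N (Draw_Dirichlet k a q) =
     Giry_Monad.bind (dirichlet_dist k a) (\<lambda>s. output_dist N (q s))"

text \<open>The worst case over all outcomes of the draws.\<close>

primrec worst_cost :: "'a prog \<Rightarrow> enat" where
  "worst_cost (Return a) = 0"
| "worst_cost (Step q) = 1 + worst_cost q"
| "worst_cost (Draw D q) = 1 + (SUP y. worst_cost (q y))"
| "worst_cost (Draw_Dirichlet k a q) = enat k + (SUP s. worst_cost (q s))"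

definition compute :: "'a \<Rightarrow> 'a prog" where
  "compute a = Step (Return a)"

definition draw :: "real measure \<Rightarrow> real prog" where
  "draw D = Draw D Return"

definition draw_dirichlet :: "nat \<Rightarrow> (nat \<Rightarrow> real) \<Rightarrow> (nat \<Rightarrow> real) prog" where
  "draw_dirichlet k a = Draw_Dirichlet k a Return"

text \<open>Every iteration is charged one operation in addition to the cost of its body.\<close>

fun foreach :: "'i list \<Rightarrow> 's \<Rightarrow> ('i \<Rightarrow> 's \<Rightarrow> 's prog) \<Rightarrow> 's prog" where
  "foreach [] s b = Return s"
| "foreach (i # is) s b = Step (do { s' \<leftarrow> b i s; foreach is s' b })"


section \<open>The sampling procedure\<close>

text \<open>The numbers \<open>n\<^sub>I\<close>, computed from the leaves upwards.\<close>

definition leaf_counts_prog :: "ltree \<Rightarrow> (node \<Rightarrow> nat) prog" where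
  "leaf_counts_prog t =
     foreach (rev (nodes t)) (\<lambda>_. 0) (\<lambda>I m.
       if is_leaf (subtree t I) then compute (m(I := 1))
       else do {
         c \<leftarrow> foreach (child_indices t I) 0 (\<lambda>k c. compute (c + m (I @ [k])));
         compute (m(I := c))
       })"

definition step2 :: "ltree \<Rightarrow> (node \<Rightarrow> nat) \<Rightarrow> (node \<Rightarrow> nat \<Rightarrow> real) prog" where
  "step2 t m =
     foreach (inner_nodes t) (\<lambda>_ _. 0) (\<lambda>I u. do {
       a \<leftarrow> foreach (child_indices t I) (\<lambda>_. 0)
              (\<lambda>k a. compute (a(k := real (m (I @ [k])) / node_exponent t I)));
       s \<leftarrow> draw_dirichlet (length (child_indices t I)) a;
       w \<leftarrow> foreach (child_indices t I) (\<lambda>_. 0)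
              (\<lambda>k w. compute (w(k := s k powr (1 / node_exponent t I))));
       compute (u(I := w))
     })"

definition step3 :: "ltree \<Rightarrow> real \<Rightarrow> (node \<Rightarrow> nat \<Rightarrow> real) \<Rightarrow> (node \<Rightarrow> real) prog" where
  "step3 t v0 u =
     foreach (inner_nodes t) ((\<lambda>_. 0)([] := v0)) (\<lambda>I v.
       foreach (child_indices t I) v (\<lambda>k v. compute (v(I @ [k] := v I * u I k))))"

text \<open>The value \<open>f(x)\<close>, computed from the leaves upwards, where \<open>v\<close> holds the entries of \<open>x\<close> at the
  leaves.\<close>

definition eval_nested :: "ltree \<Rightarrow> (node \<Rightarrow> real) \<Rightarrow> real prog" where
  "eval_nested t v = do {
     F \<leftarrow> foreach (rev (nodes t)) (\<lambda>_. 0) (\<lambda>I F.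
       if is_leaf (subtree t I) then compute (F(I := \<bar>v I\<bar>))
       else do {
         c \<leftarrow> foreach (child_indices t I) 0 (\<lambda>k c. compute (c + F (I @ [k]) powr node_exponent t I));
         compute (F(I := c powr (1 / node_exponent t I)))
       });
     compute (F [])
   }"

text \<open>The output array is \<open>undefined\<close> outside \<open>{..<n}\<close>, as required of the points of the product
  space over \<open>{..<n}\<close>.\<close>

definition step4 :: "ltree \<Rightarrow> (node \<Rightarrow> real) \<Rightarrow> (nat \<Rightarrow> real) prog" where
  "step4 t v = do {
     c \<leftarrow> eval_nested t v;
     foreach (List.enumerate 0 (leaf_nodes t)) (\<lambda>_. undefined) (\<lambda>(i, I) u. compute (u(i := v I / c)))
   }"

definition step5 :: "(real \<Rightarrow> real) \<Rightarrow> nat \<Rightarrow> (nat \<Rightarrow> real) \<Rightarrow> (nat \<Rightarrow> real) prog" where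
  "step5 r n u = do {
     w \<leftarrow> draw (density_dist r);
     foreach [0..<n] u (\<lambda>i x. compute (x(i := w * u i)))
   }"

definition step6 :: "nat \<Rightarrow> (nat \<Rightarrow> real) \<Rightarrow> (nat \<Rightarrow> real) prog" where
  "step6 n x =
     foreach [0..<n] x (\<lambda>i y. do { e \<leftarrow> draw sign_dist; compute (y(i := e * x i)) })"

definition lp_nested_sampler :: "ltree \<Rightarrow> (real \<Rightarrow> real) \<Rightarrow> (nat \<Rightarrow> real) prog" where
  "lp_nested_sampler t r = do {
     m \<leftarrow> leaf_counts_prog t;
     v0 \<leftarrow> draw (beta_dist (real (m [])) 1);
     u \<leftarrow> step2 t m;
     v \<leftarrow> step3 t v0 u;
     y \<leftarrow> step4 t v;
     x \<leftarrow> step5 r (m []) y;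
     step6 (m []) x
   }"

end

(* Polar coordinates adapted to f. For one inner node whose children have n_1, ..., n_l leaves, the measure
   prod_k z_k^(n_k - 1) dz_k on the positive orthant becomes, after y_k = z_k^p, the product of the weights
   y_k^(n_k/p - 1) dy_k; splitting y into its sum and its direction yields the Dirichlet distribution
   Dir[n_1/p, ..., n_l/p] of the direction, independent of the sum, which carries the weight of total
   degree n = n_1 + ... + n_l. By induction on the tree, Lebesgue measure on the positive orthant is the
   image of c r^(n - 1) dr times the law of the products of the u-entries along the paths to the leaves.
   Random signs extend this to the whole space. Hence a density of the form g(f(x)) is determined by the
   radial density, and its law is that of (radius) * (sign) * (path products); the beta variable of the
   first step cancels when the sample is divided by f. *)
theory Submission
  imports Defs
begin

section \<open>Iterated integrals\<close>

text \<open>All measures are handled through integrals along a list of indices, the state being a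
  total function that is updated at one index at a time. Coordinates, tree nodes and signs then
  share one calculus, the list can be cut at a subtree, and a sequence of draws in the program
  unfolds to the same kind of expression as Lebesgue measure. The price is that joint measurability
  must be carried along and that positivity and normalization of the directions are only almost sure
  facts.

  The equivalence in the theorem needs more than the law of the sample: a nested symmetric law with
  a given radial density must be unique. Pushing Lebesgue measure forward along f gives the density
  c z^(n-1), which determines g in g(f(x)) up to null sets. The constant c is never evaluated; only
  its positivity and finiteness matter.

  The cost bound is worst case over all outcomes. It rests on two counts: a tree whose inner nodes
  have at least two children has fewer than 2n nodes, and the numbers of children add up to the
  number of nodes minus one.\<close>

primrec iterated :: "('i \<Rightarrow> 'a measure) \<Rightarrow> 'i list \<Rightarrow> (('i \<Rightarrow> 'a) \<Rightarrow> ennreal) \<Rightarrow> ('i \<Rightarrow> 'a) \<Rightarrow> ennreal" where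
  "iterated D [] G x = G x"
| "iterated D (i # L) G x = (\<integral>\<^sup>+y. iterated D L G (x(i := y)) \<partial>D i)"

lemma iter_append: "iterated D (L @ L') G x = iterated D L (iterated D L' G) x"
  by (induction L arbitrary: x) auto

text \<open>The set \<open>S\<close> records the coordinates already known to satisfy
  \<open>P\<close>. After one integration the new coordinate joins \<open>S\<close>, so the almost
  sure properties of all outer variables are available when the integrands are compared.\<close>

lemma iter_cong_AE:
  assumes "\<And>i. i \<in> set L \<Longrightarrow> AE y in D i. P i y"
    and "\<And>i. i \<in> S \<Longrightarrow> P i (x i)"
    and "\<And>x'. (\<And>i. i \<in> S \<union> set L \<Longrightarrow> P i (x' i)) \<Longrightarrow> (\<And>i. i \<notin> set L \<Longrightarrow> x' i = x i) \<Longrightarrow> G x' = G' x'"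
  shows "iterated D L G x = iterated D L G' x"
  using assms
proof (induction L arbitrary: x S)
  case Nil
  then show ?case by simp
next
  case (Cons i L)
  have "AE y in D i. iterated D L G (x(i := y)) = iterated D L G' (x(i := y))"
    using Cons.prems(1)[of i, simplified]
  proof eventually_elim
    case (elim y)
    show ?case
    proof (rule Cons.IH[where S = "insert i S"])
      fix j assume "j \<in> insert i S" then show "P j ((x(i := y)) j)"
        using elim Cons.prems(2) by auto
    next
      fix x' assume *: "\<And>j. j \<in> insert i S \<union> set L \<Longrightarrow> P j (x' j)"
        "\<And>j. j \<notin> set L \<Longrightarrow> x' j = (x(i := y)) j"
      show "G x' = G' x'"
        by (rule Cons.prems(3)) (use * in auto)
    qed (use Cons.prems(1) in auto)
  qed
  then show ?case by (auto intro: nn_integral_cong_AE)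
qed

lemma iter_cong:
  assumes "\<And>x'. (\<And>i. i \<notin> set L \<Longrightarrow> x' i = x i) \<Longrightarrow> G x' = G' x'"
  shows "iterated D L G x = iterated D L G' x"
  by (rule iter_cong_AE[where P = "\<lambda>_ _. True" and S = "{}"]) (use assms in auto)

lemma iter_const: "(\<And>i. prob_space (D i)) \<Longrightarrow> iterated D L (\<lambda>_. c) x = c"
  by (induction L arbitrary: x) (auto simp: prob_space.emeasure_space_1)

text \<open>\<open>M\<close> fixes the measurable spaces of the coordinates, \<open>D\<close> the
  measures. They are kept apart because one state space is integrated against several families, such
  as Lebesgue measure, its weighted forms and random signs; \<open>PiM UNIV M\<close> contributes
  only its sigma-algebra.\<close>

locale iter_measures =
  fixes D :: "'i \<Rightarrow> 'a measure" and M :: "'i \<Rightarrow> 'a measure"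
  assumes sigma_finite: "sigma_finite_measure (D i)"
    and sets_D [measurable_cong]: "sets (D i) = sets (M i)"
begin

text \<open>The parameter \<open>a\<close> lets the integrand vary together with the start point, as
  Fubini arguments and measurable kernels require.\<close>

lemma iter_measurable_pair:
  assumes [measurable]: "(\<lambda>(a, x). G a x) \<in> borel_measurable (A \<Otimes>\<^sub>M PiM UNIV M)"
  shows "(\<lambda>(a, x). iterated D L (G a) x) \<in> borel_measurable (A \<Otimes>\<^sub>M PiM UNIV M)"
proof (induction L)
  case Nil
  then show ?case using assms by simp
next
  case (Cons i L)
  interpret sigma_finite_measure "D i" by (rule sigma_finite)
  have upd: "(\<lambda>p. (snd (fst p))(i := snd p)) \<in> (A \<Otimes>\<^sub>M PiM UNIV M) \<Otimes>\<^sub>M D i \<rightarrow>\<^sub>M PiM UNIV M"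
    by (rule measurable_fun_upd[where J = UNIV]) auto
  have "(\<lambda>p. iterated D L (G (fst (fst p))) ((snd (fst p))(i := snd p)))
      \<in> borel_measurable ((A \<Otimes>\<^sub>M PiM UNIV M) \<Otimes>\<^sub>M D i)"
    using measurable_compose[OF measurable_Pair[OF _ upd] Cons, of "\<lambda>p. fst (fst p)"]
    by simp
  then have "(\<lambda>q. \<integral>\<^sup>+y. iterated D L (G (fst q)) ((snd q)(i := y)) \<partial>D i)
      \<in> borel_measurable (A \<Otimes>\<^sub>M PiM UNIV M)"
    by (intro borel_measurable_nn_integral) (simp add: split_beta')
  then show ?case by (simp add: split_beta')
qed

lemma iter_measurable [measurable (raw)]:
  assumes "(\<lambda>p. G (fst p) (snd p)) \<in> borel_measurable (A \<Otimes>\<^sub>M PiM UNIV M)" "f \<in> A \<rightarrow>\<^sub>M PiM UNIV M"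
  shows "(\<lambda>a. iterated D L (G a) (f a)) \<in> borel_measurable A"
  using measurable_compose[OF measurable_Pair[OF measurable_ident assms(2)] iter_measurable_pair[of G A L]]
    assms(1) by (simp add: split_beta')

lemma upd_measurable [measurable]:
  "(\<lambda>y. x(i := y)) \<in> D i \<rightarrow>\<^sub>M PiM UNIV M" if "x \<in> space (PiM UNIV M)"
  by (rule measurable_fun_upd[where J = UNIV]) (use that in auto)

lemma upd_space: "y \<in> space (D i) \<Longrightarrow> x \<in> space (PiM UNIV M) \<Longrightarrow> x(i := y) \<in> space (PiM UNIV M)"
  using measurable_space[OF upd_measurable] by blast

text \<open>Tonelli's theorem, applied to one coordinate at a time.\<close>

lemma iter_swap:
  assumes "sigma_finite_measure N"
    and "(\<lambda>p. G (fst p) (snd p)) \<in> borel_measurable (N \<Otimes>\<^sub>M PiM UNIV M)" and "x \<in> space (PiM UNIV M)"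
  shows "iterated D L (\<lambda>x. \<integral>\<^sup>+y. G y x \<partial>N) x = (\<integral>\<^sup>+y. iterated D L (G y) x \<partial>N)"
  using assms(3)
proof (induction L arbitrary: x)
  case (Cons i L)
  note [measurable] = assms(2)
  interpret P: pair_sigma_finite N "D i"
    using assms(1) sigma_finite unfolding pair_sigma_finite_def by auto
  have "iterated D (i # L) (\<lambda>x. \<integral>\<^sup>+y. G y x \<partial>N) x = (\<integral>\<^sup>+a. (\<integral>\<^sup>+y. iterated D L (G y) (x(i := a)) \<partial>N) \<partial>D i)"
    using Cons.prems by (auto intro!: nn_integral_cong Cons.IH upd_space)
  also have "\<dots> = (\<integral>\<^sup>+y. (\<integral>\<^sup>+a. iterated D L (G y) (x(i := a)) \<partial>D i) \<partial>N)"
  proof (rule P.Fubini')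
    have upd: "(\<lambda>p. x(i := snd p)) \<in> N \<Otimes>\<^sub>M D i \<rightarrow>\<^sub>M PiM UNIV M"
      by (rule measurable_compose[OF measurable_snd upd_measurable[OF Cons.prems]])
    show "(\<lambda>(y, a). iterated D L (G y) (x(i := a))) \<in> borel_measurable (N \<Otimes>\<^sub>M D i)"
      using measurable_compose[OF measurable_Pair[OF measurable_fst upd] iter_measurable_pair[of G N L]] assms(2)
      by (simp add: split_beta')
  qed
  finally show ?case by simp
qed simp

lemma iter_cmult:
  assumes "G \<in> borel_measurable (PiM UNIV M)" "x \<in> space (PiM UNIV M)"
  shows "iterated D L (\<lambda>x. c * G x) x = c * iterated D L G x"
  using assms(2)
proof (induction L arbitrary: x)
  case (Cons i L)
  have "(\<lambda>y. iterated D L G (x(i := y))) \<in> borel_measurable (D i)"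
    by (rule iter_measurable[OF measurable_compose[OF measurable_snd assms(1)] upd_measurable[OF Cons.prems]])
  then have "(\<integral>\<^sup>+y. c * iterated D L G (x(i := y)) \<partial>D i) = c * iterated D (i # L) G x"
    by (simp add: nn_integral_cmult)
  moreover have "iterated D (i # L) (\<lambda>x. c * G x) x = (\<integral>\<^sup>+y. c * iterated D L G (x(i := y)) \<partial>D i)"
    unfolding iterated.simps by (intro nn_integral_cong Cons.IH upd_space Cons.prems)
  ultimately show ?case by simp
qed simp

text \<open>The densities can be collected into one weight on the final state because
  \<open>L\<close> is distinct: a repeated index would overwrite the value at which an earlier
  weight has to be evaluated.\<close>

lemma iter_density:
  assumes "distinct L" "G \<in> borel_measurable (PiM UNIV M)" "x \<in> space (PiM UNIV M)"
    and w: "\<And>i. w i \<in> borel_measurable (M i)"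
  shows "iterated (\<lambda>i. density (D i) (w i)) L G x = iterated D L (\<lambda>x. (\<Prod>i\<in>set L. w i (x i)) * G x) x"
  using assms(1,3)
proof (induction L arbitrary: x)
  case (Cons i L)
  note [measurable] = w assms(2)
  have G': "(\<lambda>x. (\<Prod>i\<in>set L. w i (x i)) * G x) \<in> borel_measurable (PiM UNIV M)" by measurable
  have "iterated (\<lambda>i. density (D i) (w i)) (i # L) G x =
    (\<integral>\<^sup>+y. iterated D L (\<lambda>x. (\<Prod>i\<in>set L. w i (x i)) * G x) (x(i := y)) \<partial>density (D i) (w i))"
    using Cons by (auto intro!: nn_integral_cong simp: upd_space)
  also have "\<dots> = (\<integral>\<^sup>+y. w i y * iterated D L (\<lambda>x. (\<Prod>i\<in>set L. w i (x i)) * G x) (x(i := y)) \<partial>D i)"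
  proof (rule nn_integral_density)
    show "(\<lambda>y. iterated D L (\<lambda>x. (\<Prod>i\<in>set L. w i (x i)) * G x) (x(i := y))) \<in> borel_measurable (D i)"
      by (rule iter_measurable[OF measurable_compose[OF measurable_snd G'] upd_measurable]) (use Cons.prems in simp)
  qed measurable
  also have "\<dots> = (\<integral>\<^sup>+y. iterated D L (\<lambda>x. (\<Prod>i\<in>set (i # L). w i (x i)) * G x) (x(i := y)) \<partial>D i)"
  proof (rule nn_integral_cong)
    fix y assume "y \<in> space (D i)"
    then have "w i y * iterated D L (\<lambda>x. (\<Prod>i\<in>set L. w i (x i)) * G x) (x(i := y))
      = iterated D L (\<lambda>x. w i y * ((\<Prod>i\<in>set L. w i (x i)) * G x)) (x(i := y))"
      using Cons.prems by (intro iter_cmult[symmetric] G' upd_space) auto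
    also have "\<dots> = iterated D L (\<lambda>x. (\<Prod>i\<in>set (i # L). w i (x i)) * G x) (x(i := y))"
      by (rule iter_cong) (use Cons.prems in \<open>auto simp: mult.assoc\<close>)
    finally show "w i y * iterated D L (\<lambda>x. (\<Prod>i\<in>set L. w i (x i)) * G x) (x(i := y)) =
      iterated D L (\<lambda>x. (\<Prod>i\<in>set (i # L). w i (x i)) * G x) (x(i := y))" .
  qed
  finally show ?case by simp
qed simp

end

lemma iter_transform:
  assumes D: "iter_measures D M" and D': "iter_measures D' M"
    and subst: "\<And>i h. i \<in> set L \<Longrightarrow> h \<in> borel_measurable (M i) \<Longrightarrow>
      (\<integral>\<^sup>+y. h y \<partial>D i) = c * (\<integral>\<^sup>+y. h (f i y) \<partial>D' i)"
    and f: "\<And>i. f i \<in> M i \<rightarrow>\<^sub>M M i"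
    and G: "G \<in> borel_measurable (PiM UNIV M)" and "x \<in> space (PiM UNIV M)"
  shows "iterated D L G (\<lambda>i. f i (x i)) = c ^ length L * iterated D' L (\<lambda>x. G (\<lambda>i. f i (x i))) x"
  using assms(3,6)
proof (induction L arbitrary: x)
  case (Cons i L)
  interpret D: iter_measures D M by (rule D)
  interpret D': iter_measures D' M by (rule D')
  note [measurable] = f
  have map: "(\<lambda>x i. f i (x i)) \<in> PiM UNIV M \<rightarrow>\<^sub>M PiM UNIV M"
    by (rule measurable_PiM_single') (auto simp: PiE_def space_PiM intro!: measurable_space[OF f])
  have fx: "(\<lambda>i. f i (x i)) \<in> space (PiM UNIV M)"
    using measurable_space[OF map Cons.prems(2)] .
  have "iterated D (i # L) G (\<lambda>i. f i (x i)) = c * (\<integral>\<^sup>+y. iterated D L G ((\<lambda>i. f i (x i))(i := f i y)) \<partial>D' i)"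
    unfolding iterated.simps
  proof (rule Cons.prems(1))
    show "(\<lambda>y. iterated D L G ((\<lambda>i. f i (x i))(i := y))) \<in> borel_measurable (M i)"
      using D.iter_measurable[OF measurable_compose[OF measurable_snd G] D.upd_measurable[OF fx, of i], of L]
      by (simp add: measurable_cong_sets[OF D.sets_D refl])
  qed simp
  also have "(\<integral>\<^sup>+y. iterated D L G ((\<lambda>i. f i (x i))(i := f i y)) \<partial>D' i) =
    (\<integral>\<^sup>+y. iterated D L G (\<lambda>j. f j ((x(i := y)) j)) \<partial>D' i)"
    by (auto intro!: nn_integral_cong arg_cong[where f = "iterated D L G"])
  also have "\<dots> = (\<integral>\<^sup>+y. c ^ length L * iterated D' L (\<lambda>x. G (\<lambda>i. f i (x i))) (x(i := y)) \<partial>D' i)"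
    by (intro nn_integral_cong Cons.IH D'.upd_space Cons.prems(2)) (use Cons.prems(1) in auto)
  also have "\<dots> = c ^ length L * (\<integral>\<^sup>+y. iterated D' L (\<lambda>x. G (\<lambda>i. f i (x i))) (x(i := y)) \<partial>D' i)"
    by (rule nn_integral_cmult)
      (rule D'.iter_measurable[OF measurable_compose[OF measurable_snd measurable_compose[OF map G]]
          D'.upd_measurable[OF Cons.prems(2)]])
  finally show ?case by (simp add: mult.assoc)
qed simp

lemma iter_measures_lborel: "iter_measures (\<lambda>_. lborel) (\<lambda>_. borel)"
  by (rule iter_measures.intro) (simp_all add: lborel.sigma_finite_measure_axioms)

text \<open>Passage from the product space, whose points are \<open>undefined\<close> beyond n, to
  total functions: the tail of the argument is taken from \<open>x\<close>.\<close>

lemma nn_integral_lborel_vec_eq_iter: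
  assumes "G \<in> borel_measurable (PiM UNIV (\<lambda>_. borel))"
  shows "(\<integral>\<^sup>+y. G (\<lambda>i. if i < n then y i else x i) \<partial>lborel_vec n) = iterated (\<lambda>_. lborel) [0..<n] G x"
  using assms
proof (induction n arbitrary: G)
  case 0
  then show ?case by (simp add: nn_integral_count_space_finite PiM_empty)
next
  case (Suc n)
  interpret product_sigma_finite "\<lambda>_::nat. lborel :: real measure" ..
  interpret D: iter_measures "\<lambda>_::nat. lborel :: real measure" "\<lambda>_. borel"
    by (rule iter_measures_lborel)
  note [measurable] = Suc.prems
  have [measurable]: "(\<lambda>y i. if i < m then y i else x i) \<in> PiM {..<m} (\<lambda>_. lborel) \<rightarrow>\<^sub>M PiM UNIV (\<lambda>_. borel)" for m
  proof (rule measurable_PiM_single')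
    fix i show "(\<lambda>y. if i < m then y i else x i) \<in> PiM {..<m} (\<lambda>_. lborel) \<rightarrow>\<^sub>M borel"
      by (cases "i < m") auto
  qed auto
  have "(\<integral>\<^sup>+y. G (\<lambda>i. if i < Suc n then y i else x i) \<partial>lborel_vec (Suc n)) =
    (\<integral>\<^sup>+y. (\<integral>\<^sup>+t. G (\<lambda>i. if i < Suc n then (y(n := t)) i else x i) \<partial>lborel) \<partial>lborel_vec n)"
    unfolding lessThan_Suc by (rule product_nn_integral_insert) (auto simp: lessThan_Suc[symmetric] simp del: lessThan_Suc)
  also have "\<dots> = (\<integral>\<^sup>+y. iterated (\<lambda>_. lborel) [n] G (\<lambda>i. if i < n then y i else x i) \<partial>lborel_vec n)"
    by (auto intro!: nn_integral_cong arg_cong[where f = G])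
  also have "\<dots> = iterated (\<lambda>_. lborel) [0..<n] (iterated (\<lambda>_. lborel) [n] G) x"
    by (rule Suc.IH)
      (use D.iter_measurable[OF measurable_compose[OF measurable_snd Suc.prems] measurable_ident, of "[n]"]
       in \<open>simp\<close>)
  finally show ?case by (simp add: iter_append)
qed

section \<open>Polar coordinates for the Dirichlet distribution\<close>

text \<open>The Gamma density without its exponential factor. For a = 1 this is Lebesgue measure on
  the positive half-line; for a = n it is the radial part r^(n-1) dr.\<close>

definition power_measure :: "real \<Rightarrow> real measure" where
  "power_measure a = density lborel (\<lambda>y. indicator {0<..} y * ennreal (y powr (a - 1)))"

lemma sets_power_measure [simp, measurable_cong]: "sets (power_measure a) = sets borel"
  by (simp add: power_measure_def)

lemma space_power_measure [simp]: "space (power_measure a) = UNIV"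
  by (simp add: power_measure_def)

lemma sigma_finite_power_measure: "sigma_finite_measure (power_measure a)"
  unfolding power_measure_def
  by (subst sigma_finite_measure.sigma_finite_iff_density_finite[OF lborel.sigma_finite_measure_axioms])
    (measurable, simp add: ennreal_mult_eq_top_iff indicator_eq_0_iff split: split_indicator)

lemma nn_integral_power_measure:
  "h \<in> borel_measurable borel \<Longrightarrow>
    (\<integral>\<^sup>+y. h y \<partial>power_measure a) = (\<integral>\<^sup>+y. ennreal (y powr (a - 1)) * h y * indicator {0<..} y \<partial>lborel)"
  unfolding power_measure_def by (subst nn_integral_density) (measurable, auto simp: mult_ac intro!: nn_integral_cong)

lemma AE_power_measure: "AE y in power_measure a. 0 < y"
  unfolding power_measure_def by (subst AE_density) (measurable, simp split: split_indicator)

text \<open>The derivative y^(1/p-1) of the substitution used below can be unbounded near 0. The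
  substitution is therefore made on compact intervals inside the half-line, and monotone convergence
  passes to the limit.\<close>

lemma nn_integral_positive_eq_SUP:
  fixes F :: "real \<Rightarrow> ennreal"
  assumes [measurable]: "F \<in> borel_measurable borel"
    and "decseq u" "incseq v" "\<And>N. 0 < u N" "\<And>x. 0 < x \<Longrightarrow> \<exists>N. u N \<le> x \<and> x \<le> v N"
  shows "(\<integral>\<^sup>+x. F x * indicator {0<..} x \<partial>lborel)
    = (SUP N. \<integral>\<^sup>+x. F x * indicator {u N..v N} x \<partial>lborel)"
proof -
  have "F x * indicator {0<..} x = (SUP N. F x * indicator {u N..v N} x)" for x
  proof (cases "0 < x")
    case True
    then obtain N where "u N \<le> x \<and> x \<le> v N" using assms(5) by blast
    then show ?thesis
      using True by (intro antisym SUP_upper2[of N] SUP_least) (auto split: split_indicator)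
  next
    case False
    have "x \<notin> {u N..v N}" for N
      using assms(4)[of N] False by auto
    then show ?thesis using False by simp
  qed
  then have "(\<integral>\<^sup>+x. F x * indicator {0<..} x \<partial>lborel) = (\<integral>\<^sup>+x. (SUP N. F x * indicator {u N..v N} x) \<partial>lborel)"
    by simp
  also have "\<dots> = (SUP N. \<integral>\<^sup>+x. F x * indicator {u N..v N} x \<partial>lborel)"
  proof (rule nn_integral_monotone_convergence_SUP)
    show "incseq (\<lambda>N x. F x * indicator {u N..v N} x)"
    proof (intro incseq_SucI le_funI mult_left_mono)
      fix N x
      have "{u N..v N} \<subseteq> {u (Suc N)..v (Suc N)}"
        using decseq_SucD[OF assms(2), of N] incseq_SucD[OF assms(3), of N] by auto
      then show "indicator {u N..v N} x \<le> (indicator {u (Suc N)..v (Suc N)} x :: ennreal)"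
        by (auto split: split_indicator)
    qed simp
  qed simp
  finally show ?thesis .
qed

text \<open>Substitution z = y^(1/p), under which z^(a-1) dz becomes (1/p) y^(a/p-1) dy.\<close>

lemma nn_integral_power_measure_powr:
  assumes "0 < p" and [measurable]: "h \<in> borel_measurable borel"
  shows "(\<integral>\<^sup>+z. h z \<partial>power_measure a) = ennreal (1 / p) * (\<integral>\<^sup>+y. h (y powr (1 / p)) \<partial>power_measure (a / p))"
proof -
  \<comment> \<open>The shift by 2 keeps 1 strictly between the endpoints, so no interval is
    degenerate.\<close>
  define u where "u N = 1 / real (N + 2)" for N
  define v where "v N = real (N + 2)" for N
  let ?g = "\<lambda>y :: real. y powr (1 / p)"
  let ?g' = "\<lambda>y :: real. (1 / p) * y powr (1 / p - 1)"
  have u: "0 < u N" "u N < v N" for N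
  proof -
    have v: "1 < v N" and eq: "u N = 1 / v N" by (auto simp: u_def v_def)
    have "u N < 1" unfolding eq using v by simp
    then show "u N < v N" using v by linarith
    show "0 < u N" unfolding eq using v by simp
  qed
  have "decseq u" "incseq v"
    by (simp_all add: u_def v_def decseq_def incseq_def frac_le)
  have ex: "\<exists>N. u N \<le> x \<and> x \<le> v N" if "0 < x" for x
  proof -
    obtain N :: nat where N: "max x (1 / x) < real N" using reals_Archimedean2 by blast
    then have "1 / x < real N + 2" by simp
    then have "1 < (real N + 2) * x" using that by (simp add: field_simps)
    then have "u N \<le> x" by (simp add: u_def field_simps)
    then show ?thesis using N by (intro exI[of _ N]) (auto simp: v_def)
  qed
  \<comment> \<open>The transformed intervals still exhaust the half-line: an index that serves x^p
    before the transformation serves x after it.\<close>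
  have ex': "\<exists>N. ?g (u N) \<le> x \<and> x \<le> ?g (v N)" if "0 < x" for x
  proof -
    have "0 < x powr p" using that by simp
    then obtain N where "u N \<le> x powr p \<and> x powr p \<le> v N" using ex by blast
    then have "?g (u N) \<le> ?g (x powr p) \<and> ?g (x powr p) \<le> ?g (v N)"
      using u(1)[of N] assms(1) by (intro conjI powr_mono2) auto
    moreover have "?g (x powr p) = x" using that assms(1) by (simp add: powr_powr)
    ultimately show ?thesis by (intro exI[of _ N]) simp
  qed
  have mono: "decseq (\<lambda>N. ?g (u N))" "incseq (\<lambda>N. ?g (v N))"
  proof -
    show "decseq (\<lambda>N. ?g (u N))"
      using decseqD[OF \<open>decseq u\<close>] less_imp_le[OF u(1)] assms(1) by (intro decseq_SucI powr_mono2) auto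
    show "incseq (\<lambda>N. ?g (v N))"
      using incseqD[OF \<open>incseq v\<close>] assms(1) by (intro incseq_SucI powr_mono2) (auto simp: v_def)
  qed
  have "(\<integral>\<^sup>+z. h z \<partial>power_measure a) = (\<integral>\<^sup>+z. ennreal (z powr (a - 1)) * h z * indicator {0<..} z \<partial>lborel)"
    by (rule nn_integral_power_measure) simp
  also have "\<dots> = (SUP N. \<integral>\<^sup>+z. ennreal (z powr (a - 1)) * h z * indicator {?g (u N)..?g (v N)} z \<partial>lborel)"
    using u(1) by (intro nn_integral_positive_eq_SUP mono ex') (auto simp: less_le)
  also have "\<dots> = (SUP N. \<integral>\<^sup>+y. ennreal (1 / p) * (ennreal (y powr (a / p - 1)) * h (?g y)) * indicator {u N..v N} y \<partial>lborel)"
  proof (rule SUP_cong[OF refl])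
    fix N
    have "(\<integral>\<^sup>+z. ennreal (z powr (a - 1)) * h z * indicator {?g (u N)..?g (v N)} z \<partial>lborel)
      = (\<integral>\<^sup>+y. ennreal (?g y powr (a - 1)) * h (?g y) * ennreal (?g' y) * indicator {u N..v N} y \<partial>lborel)"
    proof (rule nn_integral_substitution_aux)
      fix y assume "y \<in> {u N..v N}"
      then have "0 < y" using u(1)[of N] by auto
      then show "(?g has_real_derivative ?g' y) (at y)"
        by (auto intro!: derivative_eq_intros simp: powr_diff)
      show "0 \<le> ?g' y" using assms(1) by simp
    next
      show "continuous_on {u N..v N} ?g'"
        using u(1)[of N] by (intro continuous_intros) auto
    qed (use u in auto)
    also have "\<dots> = (\<integral>\<^sup>+y. ennreal (1 / p) * (ennreal (y powr (a / p - 1)) * h (?g y)) * indicator {u N..v N} y \<partial>lborel)"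
    proof (rule nn_integral_cong)
      fix y
      \<comment> \<open>Exponent count: (a-1)/p + 1/p - 1 = a/p - 1.\<close>
      have "?g y powr (a - 1) * ?g' y = (1 / p) * y powr (a / p - 1)"
        by (simp add: powr_powr powr_add[symmetric] diff_divide_distrib add.commute)
      then have eq: "ennreal (?g y powr (a - 1)) * ennreal (?g' y) = ennreal (1 / p) * ennreal (y powr (a / p - 1))"
        using assms(1) by (simp add: ennreal_mult[symmetric])
      have "ennreal (?g y powr (a - 1)) * h (?g y) * ennreal (?g' y) * indicator {u N..v N} y
        = ennreal (?g y powr (a - 1)) * ennreal (?g' y) * h (?g y) * indicator {u N..v N} y"
        by (simp only: mult_ac)
      also have "\<dots> = ennreal (1 / p) * ennreal (y powr (a / p - 1)) * h (?g y) * indicator {u N..v N} y"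
        by (simp only: eq)
      finally show "ennreal (?g y powr (a - 1)) * h (?g y) * ennreal (?g' y) * indicator {u N..v N} y
        = ennreal (1 / p) * (ennreal (y powr (a / p - 1)) * h (?g y)) * indicator {u N..v N} y"
        by (simp only: mult.assoc)
    qed
    finally show "(\<integral>\<^sup>+z. ennreal (z powr (a - 1)) * h z * indicator {?g (u N)..?g (v N)} z \<partial>lborel) = \<dots>" .
  qed
  also have "\<dots> = (\<integral>\<^sup>+y. ennreal (1 / p) * (ennreal (y powr (a / p - 1)) * h (?g y)) * indicator {0<..} y \<partial>lborel)"
    by (intro nn_integral_positive_eq_SUP[symmetric] \<open>decseq u\<close> \<open>incseq v\<close> u(1) ex) measurable
  also have "\<dots> = ennreal (1 / p) * (\<integral>\<^sup>+y. ennreal (y powr (a / p - 1)) * h (?g y) * indicator {0<..} y \<partial>lborel)"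
    by (simp add: nn_integral_cmult mult.assoc)
  also have "\<dots> = ennreal (1 / p) * (\<integral>\<^sup>+y. h (?g y) \<partial>power_measure (a / p))"
    by (subst nn_integral_power_measure) measurable
  finally show ?thesis .
qed

lemma nn_integral_exp_power_measure:
  assumes "0 < a"
  shows "(\<integral>\<^sup>+y. ennreal (exp (- y)) \<partial>power_measure a) = ennreal (Gamma a)"
proof -
  have "(\<integral>\<^sup>+y. ennreal (exp (- y)) \<partial>power_measure a) = (\<integral>\<^sup>+y. ennreal (indicator {0..} y * y powr (a - 1) / exp y) \<partial>lborel)"
  proof (subst nn_integral_power_measure)
    show "(\<integral>\<^sup>+y. ennreal (y powr (a - 1)) * ennreal (exp (- y)) * indicator {0<..} y \<partial>lborel)
      = (\<integral>\<^sup>+y. ennreal (indicator {0..} y * y powr (a - 1) / exp y) \<partial>lborel)"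
    proof (rule nn_integral_cong_AE)
      show "AE y in lborel. ennreal (y powr (a - 1)) * ennreal (exp (- y)) * indicator {0<..} y
          = ennreal (indicator {0..} y * y powr (a - 1) / exp y)"
        using AE_lborel_singleton[of 0]
      proof eventually_elim
        case (elim y)
        then show ?case
          by (cases "0 < y") (simp_all add: ennreal_mult[symmetric] exp_minus divide_inverse)
      qed
    qed
  qed simp
  also have "\<dots> = ennreal (Gamma a)"
    using Gamma_conv_nn_integral_real[OF assms] by simp
  finally show ?thesis .
qed

lemma iter_measures_power_measure: "iter_measures (\<lambda>i. power_measure (a i)) (\<lambda>_. borel)"
  by (rule iter_measures.intro) (simp_all add: sigma_finite_power_measure)

lemma iter_zero: "iterated D L (\<lambda>_. 0) x = 0"
  by (induction L arbitrary: x) auto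

lemma in_space_PiM_UNIV [simp]: "x \<in> space (PiM UNIV (\<lambda>_. borel))"
  by (simp add: space_PiM)

text \<open>The density of \<open>power_measure a\<close> with the positivity constraint built in,
  so that a product of such weights vanishes off the open orthant.\<close>

definition orthant_weight :: "real \<Rightarrow> real \<Rightarrow> ennreal" where
  "orthant_weight a y = indicator {0<..} y * ennreal (y powr (a - 1))"

lemma orthant_weight_measurable [measurable]: "orthant_weight a \<in> borel_measurable borel"
  unfolding orthant_weight_def by measurable

lemma orthant_weight_scale:
  "0 < r \<Longrightarrow> orthant_weight a (r * y) = ennreal (r powr (a - 1)) * orthant_weight a y"
  unfolding orthant_weight_def
  by (cases "0 < y") (simp_all add: powr_mult zero_less_mult_iff ennreal_mult)

text \<open>The unnormalized Dirichlet integral. The simplex is parametrized by its first m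
  coordinates, the last being one minus their sum; the weights confine the integral to positive
  coordinates.\<close>

definition simplex_integral :: "nat \<Rightarrow> (nat \<Rightarrow> real) \<Rightarrow> ((nat \<Rightarrow> real) \<Rightarrow> ennreal) \<Rightarrow> ennreal" where
  "simplex_integral m a H = iterated (\<lambda>_. lborel) [0..<m]
     (\<lambda>s. (\<Prod>i<m. orthant_weight (a i) (s i)) * orthant_weight (a m) (1 - (\<Sum>i<m. s i)) *
       H (s(m := 1 - (\<Sum>i<m. s i)))) (\<lambda>_. 0)"

lemma upd_borel_measurable [measurable (raw)]:
  assumes "f \<in> A \<rightarrow>\<^sub>M PiM UNIV (\<lambda>_. borel)" "g \<in> A \<rightarrow>\<^sub>M borel"
  shows "(\<lambda>a. (f a)(i := g a)) \<in> A \<rightarrow>\<^sub>M PiM UNIV (\<lambda>_. borel)"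
  by (rule measurable_fun_upd[OF _ assms]) simp

lemma scale_measurable [measurable (raw)]:
  assumes "f \<in> A \<rightarrow>\<^sub>M borel" "g \<in> A \<rightarrow>\<^sub>M PiM UNIV (\<lambda>_. borel :: real measure)"
  shows "(\<lambda>a i. f a * g a i :: real) \<in> A \<rightarrow>\<^sub>M PiM UNIV (\<lambda>_. borel)"
proof (rule measurable_PiM_single')
  fix i
  show "(\<lambda>a. f a * g a i) \<in> borel_measurable A"
    by (rule borel_measurable_times[OF assms(1) measurable_compose[OF assms(2) measurable_component_singleton]]) simp
qed auto

text \<open>For fixed first m coordinates the last one is replaced by the total r of all
  coordinates, a translation with Jacobian 1. After the integrals are exchanged, the first m
  coordinates are scaled by r, and homogeneity of the weights leaves r^(A-1), where A is the sum of
  all a_i.\<close>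

lemma iter_power_measure_polar:
  fixes a :: "nat \<Rightarrow> real"
  assumes [measurable]: "H \<in> borel_measurable (PiM UNIV (\<lambda>_. borel))"
  shows "iterated (\<lambda>i. power_measure (a i)) [0..<Suc m] H (\<lambda>_. 0)
    = (\<integral>\<^sup>+r. simplex_integral m a (\<lambda>s. H (\<lambda>i. r * s i)) \<partial>power_measure (\<Sum>i<Suc m. a i))"
proof -
  interpret L: iter_measures "\<lambda>_::nat. lborel" "\<lambda>_. borel" by (rule iter_measures_lborel)
  let ?B = "PiM UNIV (\<lambda>_::nat. borel :: real measure)"
  let ?W = "\<lambda>s. \<Prod>i<m. orthant_weight (a i) (s i)"
  let ?K = "\<lambda>r s. ?W s * (orthant_weight (a m) (r - (\<Sum>i<m. s i)) * H (s(m := r - (\<Sum>i<m. s i))))"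
  let ?A = "\<Sum>i<Suc m. a i"
  have PM: "power_measure b = density lborel (orthant_weight b)" for b
    by (simp add: power_measure_def orthant_weight_def[abs_def])
  have [measurable]: "(\<lambda>p. ?K (fst p) (snd p)) \<in> borel_measurable (borel \<Otimes>\<^sub>M ?B)" by measurable
  have "iterated (\<lambda>i. power_measure (a i)) [0..<Suc m] H (\<lambda>_. 0)
    = iterated (\<lambda>_. lborel) [0..<m] (\<lambda>s. ?W s * (\<integral>\<^sup>+y. H (s(m := y)) \<partial>power_measure (a m))) (\<lambda>_. 0)"
  proof -
    interpret S: sigma_finite_measure "power_measure (a m)" by (rule sigma_finite_power_measure)
    have [measurable]: "(\<lambda>s. \<integral>\<^sup>+y. H (s(m := y)) \<partial>power_measure (a m)) \<in> borel_measurable ?B"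
      by measurable
    have "iterated (\<lambda>i. power_measure (a i)) [m] H = (\<lambda>s. \<integral>\<^sup>+y. H (s(m := y)) \<partial>power_measure (a m))"
      by (rule ext) simp
    then have "iterated (\<lambda>i. power_measure (a i)) [0..<Suc m] H (\<lambda>_. 0)
      = iterated (\<lambda>i. density lborel (orthant_weight (a i))) [0..<m]
          (\<lambda>s. \<integral>\<^sup>+y. H (s(m := y)) \<partial>power_measure (a m)) (\<lambda>_. 0)"
      unfolding upt_Suc_append[OF zero_le] iter_append by (simp only: PM)
    also have "\<dots> = iterated (\<lambda>_. lborel) [0..<m] (\<lambda>s. ?W s * (\<integral>\<^sup>+y. H (s(m := y)) \<partial>power_measure (a m))) (\<lambda>_. 0)"
      by (subst L.iter_density) (simp_all add: atLeast0LessThan)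
    finally show ?thesis .
  qed
  also have "\<dots> = iterated (\<lambda>_. lborel) [0..<m] (\<lambda>s. \<integral>\<^sup>+r. ?K r s \<partial>lborel) (\<lambda>_. 0)"
  proof -
    have "?W s * (\<integral>\<^sup>+y. H (s(m := y)) \<partial>power_measure (a m)) = (\<integral>\<^sup>+r. ?K r s \<partial>lborel)" for s
    proof -
      have [measurable]: "(\<lambda>y. H (s(m := y))) \<in> borel_measurable borel"
        by measurable
      have "(\<integral>\<^sup>+y. H (s(m := y)) \<partial>power_measure (a m)) = (\<integral>\<^sup>+y. orthant_weight (a m) y * H (s(m := y)) \<partial>lborel)"
        unfolding PM by (rule nn_integral_density) measurable
      also have "\<dots> = (\<integral>\<^sup>+r. orthant_weight (a m) (r - (\<Sum>i<m. s i)) * H (s(m := r - (\<Sum>i<m. s i))) \<partial>lborel)"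
        by (subst nn_integral_real_affine[where c = 1 and t = "- (\<Sum>i<m. s i)"]) auto
      finally show ?thesis
        by (simp add: nn_integral_cmult)
    qed
    then show ?thesis by simp
  qed
  also have "\<dots> = (\<integral>\<^sup>+r. iterated (\<lambda>_. lborel) [0..<m] (?K r) (\<lambda>_. 0) \<partial>lborel)"
    by (rule L.iter_swap[OF lborel.sigma_finite_measure_axioms]) auto
  also have "\<dots> = (\<integral>\<^sup>+r. orthant_weight ?A r * simplex_integral m a (\<lambda>s. H (\<lambda>i. r * s i)) \<partial>lborel)"
  proof (rule nn_integral_cong)
    fix r :: real
    show "iterated (\<lambda>_. lborel) [0..<m] (?K r) (\<lambda>_. 0)
      = orthant_weight ?A r * simplex_integral m a (\<lambda>s. H (\<lambda>i. r * s i))"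
    proof (cases "0 < r")
      case False
      \<comment> \<open>Positive coordinates cannot have a total r \<le> 0, so one of the m + 1
        weights vanishes.\<close>
      have K: "?K r s = 0" for s
      proof (cases "\<forall>i<m. 0 < s i")
        case True
        then have "0 \<le> (\<Sum>i<m. s i)" by (intro sum_nonneg) (auto intro: less_imp_le)
        then have "r - (\<Sum>i<m. s i) \<le> 0" using False by linarith
        then show ?thesis by (simp add: orthant_weight_def del: diff_le_0_iff_le)
      next
        case False
        then obtain i where "i < m" "\<not> 0 < s i" by blast
        then have "?W s = 0" by (intro prod_zero bexI[of _ i]) (auto simp: orthant_weight_def)
        then show ?thesis by simp
      qed
      show ?thesis unfolding K using False by (simp add: iter_zero orthant_weight_def)
    next
      case True
      let ?J = "\<lambda>s. ?W s * orthant_weight (a m) (1 - (\<Sum>i<m. s i)) * H (\<lambda>i. r * (s(m := 1 - (\<Sum>i<m. s i))) i)"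
      have "iterated (\<lambda>_. lborel) [0..<m] (?K r) (\<lambda>i. r * 0)
        = ennreal r ^ length [0..<m] * iterated (\<lambda>_. lborel) [0..<m] (\<lambda>s. ?K r (\<lambda>i. r * s i)) (\<lambda>_. 0)"
      proof (rule iter_transform[OF iter_measures_lborel iter_measures_lborel])
        fix h :: "real \<Rightarrow> ennreal" assume "h \<in> borel_measurable borel"
        then show "(\<integral>\<^sup>+y. h y \<partial>lborel) = ennreal r * (\<integral>\<^sup>+y. h (r * y) \<partial>lborel)"
          using nn_integral_real_affine[of h r 0] True by simp
      qed measurable
      \<comment> \<open>The m + 1 weights contribute r^(a_i - 1) each, in total r^(A-(m+1)).
        Together with r^m from the m scalings this makes r^(A-1).\<close>
      also have "(\<lambda>s. ?K r (\<lambda>i. r * s i)) = (\<lambda>s. ennreal (r powr (?A - Suc m)) * ?J s)"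
      proof
        fix s
        have 1: "r - (\<Sum>i<m. r * s i) = r * (1 - (\<Sum>i<m. s i))"
          by (simp add: sum_distrib_left right_diff_distrib)
        have 2: "(\<Prod>i<m. ennreal (r powr (a i - 1))) = ennreal (r powr ((\<Sum>i<m. a i) - m))"
          using True by (simp add: prod_ennreal powr_sum[symmetric] sum_subtractf)
        have 3: "ennreal (r powr ((\<Sum>i<m. a i) - m)) * ennreal (r powr (a m - 1)) = ennreal (r powr (?A - Suc m))"
          by (simp add: ennreal_mult[symmetric] powr_add[symmetric] algebra_simps)
        have 4: "(\<lambda>i. r * s i)(m := r * (1 - (\<Sum>i<m. s i))) = (\<lambda>i. r * (s(m := 1 - (\<Sum>i<m. s i))) i)"
          by auto
        show "?K r (\<lambda>i. r * s i) = ennreal (r powr (?A - Suc m)) * ?J s"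
          unfolding 1 4 3[symmetric] 2[symmetric] using True
          by (simp add: orthant_weight_scale prod.distrib mult_ac)
      qed
      also have "iterated (\<lambda>_. lborel) [0..<m] (\<lambda>s. ennreal (r powr (?A - Suc m)) * ?J s) (\<lambda>_. 0)
        = ennreal (r powr (?A - Suc m)) * iterated (\<lambda>_. lborel) [0..<m] ?J (\<lambda>_. 0)"
      proof (rule L.iter_cmult)
        show "?J \<in> borel_measurable ?B" by measurable
      qed simp
      also have "ennreal r ^ length [0..<m] * (ennreal (r powr (?A - Suc m)) * iterated (\<lambda>_. lborel) [0..<m] ?J (\<lambda>_. 0))
        = orthant_weight ?A r * simplex_integral m a (\<lambda>s. H (\<lambda>i. r * s i))"
      proof -
        have "ennreal r ^ length [0..<m] * ennreal (r powr (?A - Suc m)) = orthant_weight ?A r"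
          using True by (simp add: orthant_weight_def ennreal_power ennreal_mult[symmetric]
              powr_realpow[symmetric] powr_add[symmetric] algebra_simps)
        then show ?thesis by (simp add: simplex_integral_def mult.assoc[symmetric])
      qed
      finally show ?thesis by (simp only: mult_zero_right)
    qed
  qed
  also have "\<dots> = (\<integral>\<^sup>+r. simplex_integral m a (\<lambda>s. H (\<lambda>i. r * s i)) \<partial>power_measure ?A)"
    unfolding PM simplex_integral_def by (rule nn_integral_density[symmetric]) measurable
  finally show ?thesis .
qed

section \<open>The Dirichlet distribution as a normalized simplex integral\<close>

definition zero_extend :: "nat \<Rightarrow> (nat \<Rightarrow> real) \<Rightarrow> nat \<Rightarrow> real" where
  "zero_extend k s i = (if i < k then s i else 0)"

lemma zero_extend_measurable [measurable]: "zero_extend k \<in> borel_vec k \<rightarrow>\<^sub>M PiM UNIV (\<lambda>_. borel)"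
proof (rule measurable_PiM_single')
  fix i show "(\<lambda>s. zero_extend k s i) \<in> borel_vec k \<rightarrow>\<^sub>M borel"
    by (cases "i < k") (auto simp: zero_extend_def)
qed auto

lemma complete_simplex_measurable [measurable]:
  "complete_simplex (Suc m) \<in> lborel_vec m \<rightarrow>\<^sub>M borel_vec (Suc m)"
proof -
  have "(\<lambda>s. s(m := 1 - (\<Sum>i<m. s i))) \<in> lborel_vec m \<rightarrow>\<^sub>M borel_vec (Suc m)"
  proof (rule measurable_fun_upd[where J = "{..<m}"])
    show "(\<lambda>s. s) \<in> lborel_vec m \<rightarrow>\<^sub>M borel_vec m"
      by (rule measurable_ident_sets) (auto intro!: sets_PiM_cong)
  qed auto
  then show ?thesis by (simp add: complete_simplex_def[abs_def])
qed

lemma dirichlet_density_measurable [measurable]: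
  "dirichlet_density k a \<in> borel_measurable (borel_vec k)"
  unfolding dirichlet_density_def[abs_def] by measurable

text \<open>Off the open orthant both sides are 0. Positive parameters make the normalizing factor
  nonnegative, so that \<open>ennreal\<close> distributes over the product.\<close>

lemma dirichlet_weight:
  "ennreal (dirichlet_density (Suc m) a s) =
    ennreal (Gamma (\<Sum>i<Suc m. a i) / (\<Prod>i<Suc m. Gamma (a i))) * (\<Prod>i<Suc m. orthant_weight (a i) (s i))"
  (is "_ = ennreal ?Z * _") if "\<And>i. i < Suc m \<Longrightarrow> 0 < a i"
proof (cases "\<forall>i<Suc m. 0 < s i")
  case True
  have "0 < (\<Sum>i<Suc m. a i)" by (rule sum_pos) (use that in auto)
  moreover have "0 < (\<Prod>i<Suc m. Gamma (a i))"
    by (rule prod_pos) (use that Gamma_real_pos in auto)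
  ultimately have "0 \<le> ?Z"
    by (intro divide_nonneg_pos less_imp_le[OF Gamma_real_pos])
  moreover have "(\<Prod>i<Suc m. orthant_weight (a i) (s i)) = ennreal (\<Prod>i<Suc m. s i powr (a i - 1))"
    using True by (subst prod_ennreal[symmetric]) (auto simp: orthant_weight_def intro!: prod.cong)
  ultimately show ?thesis
    using True unfolding dirichlet_density_def by (simp only: if_True ennreal_mult'')
      (simp add: ennreal_mult[symmetric] prod_nonneg)
next
  case False
  then obtain i where "i < Suc m" "\<not> 0 < s i" by blast
  then have "(\<Prod>i<Suc m. orthant_weight (a i) (s i)) = 0"
    by (intro prod_zero bexI[of _ i]) (auto simp: orthant_weight_def)
  moreover have "dirichlet_density (Suc m) a s = 0"
    using False by (simp only: dirichlet_density_def if_False)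
  ultimately show ?thesis by (simp only: mult_zero_right ennreal_0)
qed

lemma nn_integral_dirichlet:
  assumes a: "\<And>i. i < Suc m \<Longrightarrow> 0 < a i"
    and [measurable]: "H \<in> borel_measurable (PiM UNIV (\<lambda>_. borel))"
  shows "(\<integral>\<^sup>+s. H (zero_extend (Suc m) s) \<partial>dirichlet_dist (Suc m) a)
    = ennreal (Gamma (\<Sum>i<Suc m. a i) / (\<Prod>i<Suc m. Gamma (a i))) * simplex_integral m a H"
proof -
  interpret L: iter_measures "\<lambda>_::nat. lborel" "\<lambda>_. borel" by (rule iter_measures_lborel)
  let ?Z = "ennreal (Gamma (\<Sum>i<Suc m. a i) / (\<Prod>i<Suc m. Gamma (a i)))"
  let ?J = "\<lambda>s. (\<Prod>i<m. orthant_weight (a i) (s i)) * orthant_weight (a m) (1 - (\<Sum>i<m. s i)) *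
    H (s(m := 1 - (\<Sum>i<m. s i)))"
  have "(\<integral>\<^sup>+s. H (zero_extend (Suc m) s) \<partial>dirichlet_dist (Suc m) a)
    = (\<integral>\<^sup>+s. ennreal (dirichlet_density (Suc m) a (complete_simplex (Suc m) s)) *
        H (zero_extend (Suc m) (complete_simplex (Suc m) s)) \<partial>lborel_vec m)"
    unfolding dirichlet_dist_def by (simp add: nn_integral_distr nn_integral_density)
  also have "\<dots> = (\<integral>\<^sup>+s. ?Z * ?J (\<lambda>i. if i < m then s i else 0) \<partial>lborel_vec m)"
  proof (rule nn_integral_cong)
    fix s
    have "zero_extend (Suc m) (complete_simplex (Suc m) s)
      = (\<lambda>i. if i < m then s i else 0)(m := 1 - (\<Sum>i<m. s i))"
      by (auto simp: zero_extend_def complete_simplex_def)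
    moreover have "(\<Prod>i<Suc m. orthant_weight (a i) (complete_simplex (Suc m) s i))
      = (\<Prod>i<m. orthant_weight (a i) (s i)) * orthant_weight (a m) (1 - (\<Sum>i<m. s i))"
      by (simp add: complete_simplex_def)
    ultimately show "ennreal (dirichlet_density (Suc m) a (complete_simplex (Suc m) s)) *
        H (zero_extend (Suc m) (complete_simplex (Suc m) s)) = ?Z * ?J (\<lambda>i. if i < m then s i else 0)"
      by (simp only: dirichlet_weight[OF a]) (simp add: mult.assoc)
  qed
  also have "\<dots> = iterated (\<lambda>_. lborel) [0..<m] (\<lambda>s. ?Z * ?J s) (\<lambda>_. 0)"
    by (rule nn_integral_lborel_vec_eq_iter) measurable
  also have "\<dots> = ?Z * iterated (\<lambda>_. lborel) [0..<m] ?J (\<lambda>_. 0)"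
    by (rule L.iter_cmult) auto
  finally show ?thesis by (simp add: simplex_integral_def)
qed

lemma iter_one_eq_prod: "distinct L \<Longrightarrow> iterated D L (\<lambda>_. 1) x = (\<Prod>i\<in>set L. emeasure (D i) (space (D i)))"
  by (induction L arbitrary: x) (auto simp: mult.commute)

text \<open>The mass is found by integrating exp(-(x_0 + ... + x_m)) against the product of the
  power measures in two ways. Coordinatewise the result is the product of the Gamma(a_i); in polar
  form it is Gamma(A) times the simplex integral of 1.\<close>

lemma prob_space_dirichlet:
  assumes a: "\<And>i. i < Suc m \<Longrightarrow> 0 < a i"
  shows "prob_space (dirichlet_dist (Suc m) a)"
proof
  interpret P: iter_measures "\<lambda>i::nat. power_measure (a i)" "\<lambda>_. borel" by (rule iter_measures_power_measure)
  let ?A = "\<Sum>i<Suc m. a i"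
  let ?Z = "Gamma ?A / (\<Prod>i<Suc m. Gamma (a i))"
  let ?E = "emeasure (dirichlet_dist (Suc m) a) (space (dirichlet_dist (Suc m) a))"
  have A: "0 < ?A" by (rule sum_pos) (use a in auto)
  have P: "0 < (\<Prod>i<Suc m. Gamma (a i))" by (rule prod_pos) (use a Gamma_real_pos in auto)
  have Z: "0 < ?Z" using A P by (intro divide_pos_pos Gamma_real_pos)
  have E: "?E = ennreal ?Z * simplex_integral m a (\<lambda>_. 1)"
    using nn_integral_dirichlet[of m a "\<lambda>_. 1", OF a] by simp
  have "ennreal (\<Prod>i<Suc m. Gamma (a i)) = (\<Prod>i<Suc m. ennreal (Gamma (a i)))"
    by (rule prod_ennreal[symmetric]) (use a in \<open>auto intro: less_imp_le[OF Gamma_real_pos]\<close>)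
  also have "\<dots> = iterated (\<lambda>i. density (power_measure (a i)) (\<lambda>y. ennreal (exp (- y)))) [0..<Suc m] (\<lambda>_. 1) (\<lambda>_. 0)"
    by (subst iter_one_eq_prod)
      (auto simp del: upt_Suc prod.lessThan_Suc
        simp: emeasure_density nn_integral_exp_power_measure[OF a] atLeast0LessThan intro!: prod.cong)
  also have "\<dots> = iterated (\<lambda>i. power_measure (a i)) [0..<Suc m] (\<lambda>x. (\<Prod>i<Suc m. ennreal (exp (- x i)))) (\<lambda>_. 0)"
    by (subst P.iter_density) (auto simp del: upt_Suc simp: atLeast0LessThan)
  also have "\<dots> = (\<integral>\<^sup>+r. simplex_integral m a (\<lambda>s. (\<Prod>i<Suc m. ennreal (exp (- (r * s i))))) \<partial>power_measure ?A)"
    by (rule iter_power_measure_polar) measurable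
  also have "\<dots> = (\<integral>\<^sup>+r. simplex_integral m a (\<lambda>_. 1) * ennreal (exp (- r)) \<partial>power_measure ?A)"
  proof (rule nn_integral_cong)
    fix r :: real
    interpret L: iter_measures "\<lambda>_::nat. lborel" "\<lambda>_. borel" by (rule iter_measures_lborel)
    \<comment> \<open>The coordinates of the simplex add up to 1, so the exponential depends on r
      alone.\<close>
    have *: "(\<Prod>i<Suc m. ennreal (exp (- (r * (s(m := 1 - (\<Sum>i<m. s i))) i)))) = ennreal (exp (- r))" for s
    proof -
      have "(\<Sum>i<Suc m. - (r * (s(m := 1 - (\<Sum>i<m. s i))) i)) = - r"
        by (simp add: sum_negf sum_distrib_left[symmetric] algebra_simps)
      then show ?thesis by (subst prod_ennreal) (auto simp del: prod.lessThan_Suc sum.lessThan_Suc simp: exp_sum[symmetric])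
    qed
    show "simplex_integral m a (\<lambda>s. (\<Prod>i<Suc m. ennreal (exp (- (r * s i)))))
      = simplex_integral m a (\<lambda>_. 1) * ennreal (exp (- r))"
      unfolding simplex_integral_def * by (subst mult.commute[of _ "ennreal (exp (- r))"]; subst L.iter_cmult)
        (auto simp: mult.commute)
  qed
  also have "\<dots> = simplex_integral m a (\<lambda>_. 1) * ennreal (Gamma ?A)"
    by (subst nn_integral_cmult) (auto simp del: sum.lessThan_Suc simp: nn_integral_exp_power_measure[OF A])
  finally have *: "ennreal (\<Prod>i<Suc m. Gamma (a i)) = simplex_integral m a (\<lambda>_. 1) * ennreal (Gamma ?A)" .
  have "ennreal ?Z = ennreal (Gamma ?A) * ennreal (1 / (\<Prod>i<Suc m. Gamma (a i)))"
    using P less_imp_le[OF Gamma_real_pos[OF A]] by (subst ennreal_mult[symmetric]) auto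
  then have "?E = (simplex_integral m a (\<lambda>_. 1) * ennreal (Gamma ?A)) * ennreal (1 / (\<Prod>i<Suc m. Gamma (a i)))"
    unfolding E by (simp add: mult_ac)
  also have "\<dots> = 1"
  proof -
    have "ennreal q * ennreal (1 / q) = 1" if "0 < q" for q :: real
      using that by (simp add: ennreal_mult[symmetric])
    then show ?thesis unfolding *[symmetric] using P by blast
  qed
  finally show "?E = 1" .
qed

text \<open>The sum is 1 by construction of the last coordinate; positivity holds wherever the
  density is nonzero.\<close>

lemma AE_dirichlet:
  assumes "\<And>i. i < Suc m \<Longrightarrow> 0 < a i"
  shows "AE s in dirichlet_dist (Suc m) a. (\<forall>i<Suc m. 0 < s i) \<and> (\<Sum>i<Suc m. s i) = 1"
  unfolding dirichlet_dist_def
proof (subst AE_distr_iff)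
  show "AE s in density (lborel_vec (Suc m - 1)) (\<lambda>s. ennreal (dirichlet_density (Suc m) a (complete_simplex (Suc m) s))).
    (\<forall>i<Suc m. 0 < complete_simplex (Suc m) s i) \<and> (\<Sum>i<Suc m. complete_simplex (Suc m) s i) = 1"
  proof (subst AE_density)
    show "AE s in lborel_vec (Suc m - 1). 0 < ennreal (dirichlet_density (Suc m) a (complete_simplex (Suc m) s)) \<longrightarrow>
      (\<forall>i<Suc m. 0 < complete_simplex (Suc m) s i) \<and> (\<Sum>i<Suc m. complete_simplex (Suc m) s i) = 1"
    proof (intro AE_I2 impI conjI)
      fix s
      assume "0 < ennreal (dirichlet_density (Suc m) a (complete_simplex (Suc m) s))"
      then show "\<forall>i<Suc m. 0 < complete_simplex (Suc m) s i"
        unfolding dirichlet_density_def by (simp only: ennreal_less_zero_iff split: if_splits)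
      show "(\<Sum>i<Suc m. complete_simplex (Suc m) s i) = 1"
        by (simp add: complete_simplex_def)
    qed
  qed simp
qed auto

text \<open>Padding with \<open>0\<close> lets the nodes of a tree share one state space, whatever their numbers of children.\<close>

definition radial_law :: "nat \<Rightarrow> (nat \<Rightarrow> real) \<Rightarrow> real \<Rightarrow> (nat \<Rightarrow> real) measure" where
  "radial_law k a p = distr (dirichlet_dist k a) (PiM UNIV (\<lambda>_. borel))
     (\<lambda>s i. if i < k then s i powr (1 / p) else 0)"

lemma sets_radial_law [simp, measurable_cong]: "sets (radial_law k a p) = sets (PiM UNIV (\<lambda>_. borel))"
  by (simp add: radial_law_def)

lemma sets_dirichlet_dist [simp, measurable_cong]: "sets (dirichlet_dist k a) = sets (borel_vec k)"
  by (simp add: dirichlet_dist_def)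

lemma powr_vec_measurable [measurable]:
  "(\<lambda>s i. if i < k then s i powr (1 / p) else 0) \<in> borel_vec k \<rightarrow>\<^sub>M PiM UNIV (\<lambda>_. borel :: real measure)"
proof (rule measurable_PiM_single')
  fix i show "(\<lambda>s. if i < k then s i powr (1 / p) else 0) \<in> borel_vec k \<rightarrow>\<^sub>M borel"
    by (cases "i < k") auto
qed auto

lemma prob_space_radial_law:
  "(\<And>i. i < Suc m \<Longrightarrow> 0 < a i) \<Longrightarrow> prob_space (radial_law (Suc m) a p)"
  unfolding radial_law_def
  by (rule prob_space.prob_space_distr[OF prob_space_dirichlet]) simp_all

lemma AE_radial_law:
  assumes "\<And>i. i < Suc m \<Longrightarrow> 0 < a i" "0 < p"
  shows "AE w in radial_law (Suc m) a p. (\<forall>i<Suc m. 0 < w i) \<and> (\<Sum>i<Suc m. w i powr p) = 1"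
  unfolding radial_law_def
proof (subst AE_distr_iff)
  have "AE s in dirichlet_dist (Suc m) a. (\<forall>i<Suc m. 0 < s i) \<and> (\<Sum>i<Suc m. s i) = 1"
    by (rule AE_dirichlet) (rule assms(1))
  then show "AE s in dirichlet_dist (Suc m) a. (\<forall>i<Suc m. 0 < (if i < Suc m then s i powr (1 / p) else 0)) \<and>
    (\<Sum>i<Suc m. (if i < Suc m then s i powr (1 / p) else 0) powr p) = 1"
  proof eventually_elim
    case (elim s)
    have "(\<Sum>i<Suc m. (if i < Suc m then s i powr (1 / p) else 0) powr p) = (\<Sum>i<Suc m. s i)"
      using elim assms(2) by (intro sum.cong) (auto simp: powr_powr)
    moreover have "\<forall>i<Suc m. 0 < (if i < Suc m then s i powr (1 / p) else 0)"
      using elim by (metis less_irrefl powr_gt_zero)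
    ultimately show ?case using elim by (simp only: simp_thms)
  qed
qed measurable

text \<open>Polar coordinates for a single inner node: pass to y = z^p, split y into total and
  direction, then take p-th roots of both. The rooted direction has law \<open>radial_law\<close>,
  and rooting the total turns the exponent from the sum of the a_i / p back into the sum of the
  a_i.\<close>

lemma iter_power_measure_radial_law:
  fixes a :: "nat \<Rightarrow> real"
  assumes a: "\<And>i. i < Suc m \<Longrightarrow> 0 < a i" and p: "0 < p"
  obtains c :: real where "0 < c"
    and "\<And>H. H \<in> borel_measurable (PiM UNIV (\<lambda>_. borel)) \<Longrightarrow>
      iterated (\<lambda>i. power_measure (a i)) [0..<Suc m] H (\<lambda>_. 0) =
      ennreal c * (\<integral>\<^sup>+r. (\<integral>\<^sup>+w. H (\<lambda>i. r * w i) \<partial>radial_law (Suc m) (\<lambda>i. a i / p) p)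
        \<partial>power_measure (\<Sum>i<Suc m. a i))"
proof -
  let ?a = "\<lambda>i. a i / p" and ?A = "\<Sum>i<Suc m. a i"
  let ?f = "\<lambda>y :: real. y powr (1 / p)"
  let ?Z = "Gamma (\<Sum>i<Suc m. ?a i) / (\<Prod>i<Suc m. Gamma (?a i))"
  let ?D = "dirichlet_dist (Suc m) ?a"
  have a': "\<And>i. i < Suc m \<Longrightarrow> 0 < ?a i" using a p by simp
  have "0 < (\<Sum>i<Suc m. ?a i)" by (rule sum_pos) (use a' in auto)
  moreover have "0 < (\<Prod>i<Suc m. Gamma (?a i))"
    by (rule prod_pos) (use a' Gamma_real_pos in auto)
  ultimately have Z: "0 < ?Z" by (intro divide_pos_pos Gamma_real_pos)
  \<comment> \<open>The factor 1/p arises from each of the m + 1 substitutions, 1/?Z undoes the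
    Dirichlet normalization, and p comes from rooting the total.\<close>
  let ?c = "(1 / p) ^ Suc m * (1 / ?Z) * p"
  show thesis
  proof (rule that[of ?c])
    have "0 < 1 / ?Z" using Z by (rule divide_pos_pos[OF zero_less_one])
    moreover have "0 < (1 / p) ^ Suc m" using p by simp
    ultimately show "0 < ?c" using p by (intro mult_pos_pos)
    fix H :: "(nat \<Rightarrow> real) \<Rightarrow> ennreal"
    assume H [measurable]: "H \<in> borel_measurable (PiM UNIV (\<lambda>_. borel))"
    have [measurable]: "(\<lambda>x i. ?f (x i)) \<in> PiM UNIV (\<lambda>_. borel) \<rightarrow>\<^sub>M PiM UNIV (\<lambda>_::nat. borel)"
      by (rule measurable_PiM_single') auto
    interpret R: prob_space "radial_law (Suc m) ?a p" by (rule prob_space_radial_law) (rule a')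
    let ?K = "\<lambda>r. \<integral>\<^sup>+w. H (\<lambda>i. r * w i) \<partial>radial_law (Suc m) ?a p"
    have K [measurable]: "?K \<in> borel_measurable borel" by measurable
    have "iterated (\<lambda>i. power_measure (a i)) [0..<Suc m] H (\<lambda>_. ?f 0)
      = ennreal (1 / p) ^ length [0..<Suc m] *
        iterated (\<lambda>i. power_measure (?a i)) [0..<Suc m] (\<lambda>x. H (\<lambda>i. ?f (x i))) (\<lambda>_. 0)"
      by (rule iter_transform[OF iter_measures_power_measure iter_measures_power_measure])
        (auto intro: nn_integral_power_measure_powr[OF p])
    also have "iterated (\<lambda>i. power_measure (?a i)) [0..<Suc m] (\<lambda>x. H (\<lambda>i. ?f (x i))) (\<lambda>_. 0)
      = (\<integral>\<^sup>+r. simplex_integral m ?a (\<lambda>s. H (\<lambda>i. ?f (r * s i))) \<partial>power_measure (\<Sum>i<Suc m. ?a i))"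
      by (rule iter_power_measure_polar) measurable
    also have "\<dots> = (\<integral>\<^sup>+r. ennreal (1 / ?Z) * ?K (?f r) \<partial>power_measure (\<Sum>i<Suc m. ?a i))"
    proof (rule nn_integral_cong_AE)
      show "AE r in power_measure (\<Sum>i<Suc m. ?a i).
        simplex_integral m ?a (\<lambda>s. H (\<lambda>i. ?f (r * s i))) = ennreal (1 / ?Z) * ?K (?f r)"
        using AE_power_measure
      proof eventually_elim
        case (elim r)
        have "?K (?f r) = (\<integral>\<^sup>+s. H (\<lambda>i. ?f r * (if i < Suc m then ?f (s i) else 0)) \<partial>?D)"
          unfolding radial_law_def by (rule nn_integral_distr) measurable
        also have "\<dots> = (\<integral>\<^sup>+s. H (\<lambda>i. ?f (r * zero_extend (Suc m) s i)) \<partial>?D)"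
        \<comment> \<open>The root of a product is split for positive entries, hence almost
          everywhere.\<close>
        proof (rule nn_integral_cong_AE)
          have "AE s in ?D. (\<forall>i<Suc m. 0 < s i) \<and> (\<Sum>i<Suc m. s i) = 1"
            by (rule AE_dirichlet) (rule a')
          then show "AE s in ?D. H (\<lambda>i. ?f r * (if i < Suc m then ?f (s i) else 0)) = H (\<lambda>i. ?f (r * zero_extend (Suc m) s i))"
          proof eventually_elim
            case (elim s)
            have "(\<lambda>i. ?f r * (if i < Suc m then ?f (s i) else 0)) = (\<lambda>i. ?f (r * zero_extend (Suc m) s i))"
              using elim \<open>0 < r\<close> by (intro ext) (simp add: zero_extend_def powr_mult)
            then show ?case by simp
          qed
        qed
        also have "\<dots> = ennreal ?Z * simplex_integral m ?a (\<lambda>s. H (\<lambda>i. ?f (r * s i)))"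
          by (rule nn_integral_dirichlet[of m ?a "\<lambda>s. H (\<lambda>i. ?f (r * s i))", OF a']) measurable
        finally have "ennreal (1 / ?Z) * ?K (?f r) = ennreal (1 / ?Z) * ennreal ?Z * simplex_integral m ?a (\<lambda>s. H (\<lambda>i. ?f (r * s i)))"
          by (simp only: mult.assoc)
        moreover have "ennreal (1 / q) * ennreal q = 1" if "0 < q" for q :: real
          using that by (simp add: ennreal_mult[symmetric])
        note this[OF Z]
        ultimately show ?case by (simp only: mult_1_left)
      qed
    qed
    also have "\<dots> = ennreal (1 / ?Z) * (\<integral>\<^sup>+r. ?K (?f r) \<partial>power_measure (\<Sum>i<Suc m. ?a i))"
      by (rule nn_integral_cmult) measurable
    also have "(\<integral>\<^sup>+r. ?K (?f r) \<partial>power_measure (\<Sum>i<Suc m. ?a i)) = ennreal p * (\<integral>\<^sup>+r. ?K r \<partial>power_measure ?A)"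
    proof -
      have "ennreal p * ennreal (1 / p) = 1" using p by (simp add: ennreal_mult[symmetric])
      then show ?thesis
        unfolding nn_integral_power_measure_powr[OF p K, of ?A] sum_divide_distrib[symmetric] by (simp add: mult.assoc[symmetric])
    qed
    finally have "iterated (\<lambda>i. power_measure (a i)) [0..<Suc m] H (\<lambda>_. 0) =
      ennreal (1 / p) ^ Suc m * (ennreal (1 / ?Z) * (ennreal p * (\<integral>\<^sup>+r. ?K r \<partial>power_measure ?A)))"
      by (simp del: upt_Suc sum.lessThan_Suc prod.lessThan_Suc power_Suc)
    also have "\<dots> = ennreal ?c * (\<integral>\<^sup>+r. ?K r \<partial>power_measure ?A)"
    proof -
      have eq: "ennreal a ^ N * (ennreal b * (ennreal p * X)) = ennreal (a ^ N * b * p) * X"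
        if "0 \<le> a" "0 \<le> b" for a b X N
        using that p by (simp add: ennreal_mult ennreal_power[symmetric] mult.assoc)
      show ?thesis
        by (rule eq[OF _ less_imp_le[OF divide_pos_pos[OF zero_less_one Z]]]) (use p in simp)
    qed
    finally show "iterated (\<lambda>i. power_measure (a i)) [0..<Suc m] H (\<lambda>_. 0) = ennreal ?c * (\<integral>\<^sup>+r. ?K r \<partial>power_measure ?A)" .
  qed
qed

section \<open>Polar coordinates for nested functions\<close>

text \<open>Integrated coordinates are overwritten, so the start point matters only at the others
  that the integrand reads. This later allows a value to be planted at the root of a tree.\<close>

lemma iter_independent_of_start:
  assumes "\<And>i. i \<in> S \<Longrightarrow> x i = y i"
    and "\<And>a b. (\<And>i. i \<in> S \<union> set L \<Longrightarrow> a i = b i) \<Longrightarrow> G a = G' b"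
  shows "iterated D L G x = iterated D L G' y"
  using assms
proof (induction L arbitrary: x y S)
  case (Cons i L)
  have "iterated D L G (x(i := a)) = iterated D L G' (y(i := a))" for a
    by (rule Cons.IH[where S = "insert i S"]) (use Cons.prems in auto)
  then show ?case by simp
qed simp

text \<open>Used to separate radii from directions, and directions from signs.\<close>

lemma iter_iter_swap:
  assumes D: "iter_measures D M" and D': "iter_measures D' M'"
    and F [measurable]: "(\<lambda>p. F (fst p) (snd p)) \<in> borel_measurable (PiM UNIV M' \<Otimes>\<^sub>M PiM UNIV M)"
    and x: "x \<in> space (PiM UNIV M)" and y: "y \<in> space (PiM UNIV M')"
  shows "iterated D L (\<lambda>x. iterated D' L' (\<lambda>y. F y x) y) x = iterated D' L' (\<lambda>y. iterated D L (F y) x) y"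
  using y
proof (induction L' arbitrary: y)
  case (Cons i L')
  interpret D: iter_measures D M by (rule D)
  interpret D': iter_measures D' M' by (rule D')
  have "iterated D L (\<lambda>x. iterated D' (i # L') (\<lambda>y. F y x) y) x
    = (\<integral>\<^sup>+b. iterated D L (\<lambda>x. iterated D' L' (\<lambda>y. F y x) (y(i := b))) x \<partial>D' i)"
    unfolding iterated.simps
  proof (rule D.iter_swap[OF D'.sigma_finite _ x])
    have "(\<lambda>p. y(i := fst p)) \<in> D' i \<Otimes>\<^sub>M PiM UNIV M \<rightarrow>\<^sub>M PiM UNIV M'"
      by (rule measurable_compose[OF measurable_fst D'.upd_measurable[OF Cons.prems]])
    moreover have "(\<lambda>q. (snd q, snd (fst q))) \<in> (D' i \<Otimes>\<^sub>M PiM UNIV M) \<Otimes>\<^sub>M PiM UNIV M' \<rightarrow>\<^sub>M PiM UNIV M' \<Otimes>\<^sub>M PiM UNIV M"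
      by measurable
    note measurable_compose[OF this F]
    ultimately show "(\<lambda>p. iterated D' L' (\<lambda>y. F y (snd p)) (y(i := fst p))) \<in> borel_measurable (D' i \<Otimes>\<^sub>M PiM UNIV M)"
      by (intro D'.iter_measurable) simp_all
  qed
  also have "\<dots> = (\<integral>\<^sup>+b. iterated D' L' (\<lambda>y. iterated D L (F y) x) (y(i := b)) \<partial>D' i)"
    by (intro nn_integral_cong Cons.IH D'.upd_space Cons.prems)
  finally show ?case by simp
qed simp

abbreviation seq_space :: "(nat \<Rightarrow> real) measure" where
  "seq_space \<equiv> PiM UNIV (\<lambda>_. borel)"

abbreviation node_space :: "(node \<Rightarrow> nat \<Rightarrow> real) measure" where
  "node_space \<equiv> PiM UNIV (\<lambda>_. seq_space)"

section \<open>Node lists of a tree and products along paths\<close>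

lemma leaf_count_pos: "lp_tree t \<Longrightarrow> 0 < leaf_count t"
proof (induction t)
  case (Node p ts)
  then obtain s ss where "ts = s # ss" by (cases ts) auto
  with Node show ?case by auto
qed simp

lemma leaf_count_Node: "leaf_count (Node p ts) = (\<Sum>k<length ts. leaf_count (ts ! k))"
  by (simp add: sum_list_sum_nth atLeast0LessThan)

lemma lp_tree_nth: "lp_tree (Node p ts) \<Longrightarrow> k < length ts \<Longrightarrow> lp_tree (ts ! k)"
  by (simp add: list_all_length)

lemma inner_nodes_Leaf [simp]: "inner_nodes Leaf = []"
  by (simp add: inner_nodes_def is_leaf_def)

lemma leaf_nodes_Leaf [simp]: "leaf_nodes Leaf = [[]]"
  by (simp add: leaf_nodes_def is_leaf_def)

text \<open>The list \<open>ks\<close> of child indices is left arbitrary, so that statements about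
  all children can be proved by induction on it.\<close>

definition subtree_nodes :: "(ltree \<Rightarrow> node list) \<Rightarrow> ltree list \<Rightarrow> nat list \<Rightarrow> node list" where
  "subtree_nodes f ts ks = concat (map (\<lambda>k. map ((#) k) (f (ts ! k))) ks)"

lemma subtree_nodes_Nil [simp]: "subtree_nodes f ts [] = []"
  and subtree_nodes_Cons [simp]:
    "subtree_nodes f ts (k # ks) = map ((#) k) (f (ts ! k)) @ subtree_nodes f ts ks"
  and subtree_nodes_append [simp]:
    "subtree_nodes f ts (ks @ ks') = subtree_nodes f ts ks @ subtree_nodes f ts ks'"
  by (simp_all add: subtree_nodes_def)

lemma set_subtree_nodes:
  "I \<in> set (subtree_nodes f ts ks) \<longleftrightarrow> (\<exists>k J. I = k # J \<and> k \<in> set ks \<and> J \<in> set (f (ts ! k)))"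
  by (auto simp: subtree_nodes_def)

lemma nodes_Node: "nodes (Node p ts) = [] # subtree_nodes nodes ts [0..<length ts]"
  by (simp add: subtree_nodes_def)

lemma inner_nodes_Node [simp]:
  "inner_nodes (Node p ts) = [] # subtree_nodes inner_nodes ts [0..<length ts]"
  by (simp add: inner_nodes_def is_leaf_def subtree_nodes_def filter_concat filter_map o_def)

lemma leaf_nodes_Node [simp]:
  "leaf_nodes (Node p ts) = subtree_nodes leaf_nodes ts [0..<length ts]"
  by (simp add: leaf_nodes_def is_leaf_def subtree_nodes_def filter_concat filter_map o_def)

lemma length_leaf_nodes [simp]: "length (leaf_nodes t) = leaf_count t"
proof (induction t rule: nodes.induct)
  case (2 p ts)
  have "length (subtree_nodes leaf_nodes ts ks) = (\<Sum>k\<leftarrow>ks. leaf_count (ts ! k))"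
    if "set ks \<subseteq> {..<length ts}" for ks
    using that 2 by (induction ks) auto
  from this[of "[0..<length ts]"] show ?case
    by (auto simp: leaf_count_Node interv_sum_list_conv_sum_set_nat atLeast0LessThan simp del: leaf_count.simps)
qed simp

text \<open>The recursion starts at the root and thus follows the recursion of trees; the program
  extends paths at their end, which is covered by \<open>path_prod_snoc\<close>.\<close>

fun path_prod :: "(node \<Rightarrow> nat \<Rightarrow> real) \<Rightarrow> node \<Rightarrow> real" where
  "path_prod u [] = 1"
| "path_prod u (k # I) = u [] k * path_prod (\<lambda>J. u (k # J)) I"

lemma shift_measurable:
  "f \<in> A \<rightarrow>\<^sub>M node_space \<Longrightarrow> (\<lambda>a J. f a (k # J)) \<in> A \<rightarrow>\<^sub>M node_space"
proof (rule measurable_PiM_single')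
  fix J assume "f \<in> A \<rightarrow>\<^sub>M node_space"
  then show "(\<lambda>a. f a (k # J)) \<in> A \<rightarrow>\<^sub>M seq_space"
    by (rule measurable_compose) simp
qed (simp add: space_PiM)

lemma node_entry_measurable:
  "f \<in> A \<rightarrow>\<^sub>M node_space \<Longrightarrow> (\<lambda>a. f a I k) \<in> A \<rightarrow>\<^sub>M borel"
  by (rule measurable_compose[where g = "\<lambda>w. w k" and N = seq_space],
      rule measurable_compose[where g = "\<lambda>u. u I" and N = node_space]) simp_all

lemma path_prod_measurable [measurable (raw)]:
  "f \<in> A \<rightarrow>\<^sub>M node_space \<Longrightarrow> (\<lambda>a. path_prod (f a) I) \<in> A \<rightarrow>\<^sub>M borel"
proof (induction I arbitrary: f)
  case (Cons k I)
  note [measurable] = node_entry_measurable[OF Cons.prems] Cons.IH[OF shift_measurable[OF Cons.prems]]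
  show ?case unfolding path_prod.simps by measurable
qed simp

text \<open>Overwrites a block of consecutive coordinates. The leaves below a node form such a
  block, and concatenating the lists of siblings concatenates their blocks.\<close>

definition put :: "nat \<Rightarrow> real list \<Rightarrow> (nat \<Rightarrow> real) \<Rightarrow> nat \<Rightarrow> real" where
  "put b ys x j = (if b \<le> j \<and> j < b + length ys then ys ! (j - b) else x j)"

lemma put_append: "put b (ys @ zs) x = put (b + length ys) zs (put b ys x)"
  by (rule ext) (auto simp: put_def nth_append)

lemma put_measurable [measurable (raw)]:
  assumes "\<And>I. (\<lambda>a. f a I) \<in> A \<rightarrow>\<^sub>M borel" and "g \<in> A \<rightarrow>\<^sub>M seq_space"
  shows "(\<lambda>a. put b (map (f a) Is) (g a)) \<in> A \<rightarrow>\<^sub>M seq_space"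
proof (rule measurable_PiM_single')
  fix j
  have "(\<lambda>a. g a j) \<in> A \<rightarrow>\<^sub>M borel"
    by (rule measurable_compose[OF assms(2) measurable_component_singleton]) simp
  then show "(\<lambda>a. put b (map (f a) Is) (g a) j) \<in> A \<rightarrow>\<^sub>M borel"
    unfolding put_def using assms(1) by (cases "b \<le> j \<and> j < b + length Is") auto
qed auto

text \<open>The default value makes \<open>node_law\<close> a probability measure for every tree.\<close>

definition node_law :: "ltree \<Rightarrow> (nat \<Rightarrow> real) measure" where
  "node_law t = (if lp_tree t \<and> \<not> is_leaf t
     then radial_law (length (children t)) (\<lambda>k. leaf_count (children t ! k) / exponent t) (exponent t)
     else return seq_space (\<lambda>_. 0))"

lemma sets_node_law [simp, measurable_cong]: "sets (node_law t) = sets seq_space"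
  by (simp add: node_law_def)

lemma lp_tree_cases:
  assumes "lp_tree t" "\<not> is_leaf t"
  obtains p ts m where "t = Node p ts" "0 < p" "length ts = Suc m" "\<And>k. k < Suc m \<Longrightarrow> 0 < leaf_count (ts ! k)"
proof (cases t)
  case (Node p ts)
  with assms obtain m where m: "length ts = Suc m" by (cases ts) auto
  show ?thesis
    by (rule that[OF Node _ m]) (use assms Node m in \<open>auto simp: list_all_length leaf_count_pos\<close>)
qed (use assms in \<open>simp add: is_leaf_def\<close>)

lemma prob_space_node_law: "prob_space (node_law t)"
proof (cases "lp_tree t \<and> \<not> is_leaf t")
  case True
  then obtain p ts m where "t = Node p ts" "0 < p" "length ts = Suc m" "\<And>k. k < Suc m \<Longrightarrow> 0 < leaf_count (ts ! k)"
    by (blast elim: lp_tree_cases)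
  with True show ?thesis by (auto simp: node_law_def intro!: prob_space_radial_law divide_pos_pos)
qed (auto simp: node_law_def prob_space_return)

section \<open>Laws on subtrees and polar coordinates by induction on the tree\<close>

definition tree_laws :: "ltree \<Rightarrow> node \<Rightarrow> (nat \<Rightarrow> real) measure" where
  "tree_laws t I = node_law (subtree t I)"

lemma iter_measures_tree_laws: "iter_measures (tree_laws t) (\<lambda>_. seq_space)"
  by (rule iter_measures.intro)
    (simp_all add: tree_laws_def prob_space_node_law prob_space_imp_sigma_finite)

definition graft :: "nat \<Rightarrow> (node \<Rightarrow> nat \<Rightarrow> real) \<Rightarrow> (node \<Rightarrow> nat \<Rightarrow> real) \<Rightarrow> node \<Rightarrow> nat \<Rightarrow> real" where
  "graft k u v I = (if I \<noteq> [] \<and> hd I = k then v (tl I) else u I)"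

lemma graft_child [simp]: "graft k u v (k # J) = v J"
  by (simp add: graft_def)

text \<open>Prefixing \<open>k\<close> identifies the nodes of a child with nodes of the whole tree.
  The laws agree because each depends only on the subtree at its node, and \<open>graft\<close>
  translates between the two states.\<close>

lemma iter_tree_laws_child:
  "iterated (tree_laws t) (map ((#) k) L) G u =
    iterated (tree_laws (children t ! k)) L (\<lambda>v. G (graft k u v)) (\<lambda>J. u (k # J))"
proof (induction L arbitrary: u)
  case Nil
  have "graft k u (\<lambda>J. u (k # J)) = u"
    by (rule ext) (auto simp: graft_def)
  then show ?case by simp
next
  case (Cons I L)
  have 1: "graft k (u(k # I := y)) v = graft k u v" for y v
    by (rule ext) (auto simp: graft_def)
  have 2: "(\<lambda>J. (u(k # I := y)) (k # J)) = (\<lambda>J. u (k # J))(I := y)" for y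
    by auto
  have 3: "tree_laws t (k # I) = tree_laws (children t ! k) I"
    by (simp add: tree_laws_def)
  show ?case
    by (simp add: Cons.IH 1 2 3 del: fun_upd_apply)
qed

lemma path_prod_cong:
  "(\<And>I. I \<in> set (inner_nodes t) \<Longrightarrow> u I = v I) \<Longrightarrow> J \<in> set (leaf_nodes t) \<Longrightarrow> path_prod u J = path_prod v J"
proof (induction t arbitrary: u v J rule: nodes.induct)
  case (2 p ts)
  from "2.prems"(2) obtain k J' where J: "J = k # J'" "k < length ts" "J' \<in> set (leaf_nodes (ts ! k))"
    by (auto simp: set_subtree_nodes)
  have "path_prod (\<lambda>I. u (k # I)) J' = path_prod (\<lambda>I. v (k # I)) J'"
    using J by (intro "2.IH"[of k]) (auto intro!: "2.prems"(1) simp: set_subtree_nodes)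
  moreover have "u [] = v []" by (rule "2.prems"(1)) simp
  ultimately show ?case using J by simp
qed simp

text \<open>The radii \<open>z\<close> of the blocks replace the entries of \<open>u\<close> at the root.\<close>

definition block_prod :: "(nat \<Rightarrow> real) \<Rightarrow> (node \<Rightarrow> nat \<Rightarrow> real) \<Rightarrow> node \<Rightarrow> real" where
  "block_prod z u I = z (hd I) * path_prod (\<lambda>J. u (hd I # J)) (tl I)"

lemma block_prod_measurable [measurable (raw)]:
  assumes "g \<in> A \<rightarrow>\<^sub>M seq_space" "f \<in> A \<rightarrow>\<^sub>M node_space"
  shows "(\<lambda>a. block_prod (g a) (f a) I) \<in> A \<rightarrow>\<^sub>M borel"
proof -
  have [measurable]: "(\<lambda>a. g a (hd I)) \<in> A \<rightarrow>\<^sub>M borel"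
    by (rule measurable_compose[OF assms(1) measurable_component_singleton]) simp
  note [measurable] = shift_measurable[OF assms(2)]
  show ?thesis unfolding block_prod_def by measurable
qed

text \<open>The induction hypothesis of the polar decomposition on the positive orthant. Arbitrary
  \<open>b\<close> and \<open>x\<close> make it applicable to the block of a child inside a longer
  vector; arbitrary \<open>u\<close> lets the integration over a subtree begin in any state.\<close>

definition polar_formula :: "ltree \<Rightarrow> real \<Rightarrow> bool" where
  "polar_formula t c \<longleftrightarrow> 0 < c \<and> (\<forall>G b x u. G \<in> borel_measurable seq_space \<longrightarrow>
     iterated (\<lambda>_. power_measure 1) [b..<b + leaf_count t] G x =
     ennreal c * (\<integral>\<^sup>+r. iterated (tree_laws t) (inner_nodes t)
       (\<lambda>u. G (put b (map (\<lambda>I. r * path_prod u I) (leaf_nodes t)) x)) u \<partial>power_measure (leaf_count t)))"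

text \<open>The blocks of the children are put into polar form one after the other. Fubini then
  moves all radii \<open>z\<close> outside the directions, so that the radii can be treated as the
  coordinates of a single node.\<close>

lemma polar_formula_blocks:
  assumes ts: "\<And>k. k \<in> set ks \<Longrightarrow> polar_formula (ts ! k) (c k)"
    and "distinct ks" and "G \<in> borel_measurable seq_space"
  shows "iterated (\<lambda>_. power_measure 1) [b..<b + (\<Sum>k\<leftarrow>ks. leaf_count (ts ! k))] G x =
    ennreal (\<Prod>k\<leftarrow>ks. c k) * iterated (\<lambda>k. power_measure (leaf_count (ts ! k))) ks
      (\<lambda>z. iterated (tree_laws (Node p ts)) (subtree_nodes inner_nodes ts ks)
        (\<lambda>u. G (put b (map (block_prod z u) (subtree_nodes leaf_nodes ts ks)) x)) u) z"
  using assms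
proof (induction ks arbitrary: b x u z)
  case Nil
  have "put b [] x = x" by (rule ext) (simp add: put_def)
  then show ?case by simp
next
  case (Cons k ks)
  let ?T = "tree_laws (Node p ts)" and ?P = "\<lambda>k. power_measure (leaf_count (ts ! k))"
  let ?n = "leaf_count (ts ! k)" and ?N = "\<Sum>k\<leftarrow>ks. leaf_count (ts ! k)"
  let ?rest = "subtree_nodes inner_nodes ts ks"
  let ?first = "map ((#) k) (inner_nodes (ts ! k))"
  let ?C = "\<Prod>k\<leftarrow>ks. c k"
  let ?V = "\<lambda>z u. put b (map (block_prod z u) (subtree_nodes leaf_nodes ts (k # ks))) x"
  note G [measurable] = Cons.prems(3)
  interpret T: iter_measures "tree_laws t" "\<lambda>_. seq_space" for t by (rule iter_measures_tree_laws)
  interpret P: iter_measures "\<lambda>i::nat. power_measure (a i)" "\<lambda>_. borel" for a by (rule iter_measures_power_measure)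
  have ck: "polar_formula (ts ! k) (c k)" using Cons.prems(1) by simp
  have C: "0 \<le> ?C" using Cons.prems(1) by (intro prod_list_nonneg) (auto simp: polar_formula_def less_imp_le)
  \<comment> \<open>The integral over the remaining blocks, seen as a function of the vector whose
    first block is already fixed.\<close>
  let ?G1 = "iterated (\<lambda>_. power_measure 1) [b + ?n..<b + ?n + ?N] G"
  have G1 [measurable]: "?G1 \<in> borel_measurable seq_space"
    using P.iter_measurable[OF measurable_compose[OF measurable_snd G] measurable_ident, of "\<lambda>_. 1"] by simp
  have "b + (\<Sum>k\<leftarrow>k # ks. leaf_count (ts ! k)) = b + ?n + ?N" by simp
  then have "[b..<b + (\<Sum>k\<leftarrow>k # ks. leaf_count (ts ! k))] = [b..<b + ?n] @ [b + ?n..<b + ?n + ?N]"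
    by (simp only: upt_add_eq_append[OF le_add1])
  then have "iterated (\<lambda>_. power_measure 1) [b..<b + (\<Sum>k\<leftarrow>k # ks. leaf_count (ts ! k))] G x
    = iterated (\<lambda>_. power_measure 1) [b..<b + ?n] ?G1 x"
    by (simp only: iter_append)
  also have "\<dots> = ennreal (c k) * (\<integral>\<^sup>+r. iterated (tree_laws (ts ! k)) (inner_nodes (ts ! k))
      (\<lambda>v. ?G1 (put b (map (\<lambda>I. r * path_prod v I) (leaf_nodes (ts ! k))) x)) (\<lambda>J. u (k # J)) \<partial>?P k)"
    using ck G1 unfolding polar_formula_def by blast
  also have "(\<integral>\<^sup>+r. iterated (tree_laws (ts ! k)) (inner_nodes (ts ! k))
      (\<lambda>v. ?G1 (put b (map (\<lambda>I. r * path_prod v I) (leaf_nodes (ts ! k))) x)) (\<lambda>J. u (k # J)) \<partial>?P k)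
    = (\<integral>\<^sup>+r. ennreal ?C * iterated ?P ks (\<lambda>z. iterated ?T (?first @ ?rest) (\<lambda>u. G (?V z u)) u) (z(k := r)) \<partial>?P k)"
  proof (rule nn_integral_cong)
    fix r
    let ?x = "\<lambda>v. put b (map (\<lambda>I. r * path_prod v I) (leaf_nodes (ts ! k))) x"
    let ?F = "\<lambda>z v. iterated ?T ?rest (\<lambda>u. G (?V z u)) v"
    have F: "(\<lambda>p. ?F (fst p) (snd p)) \<in> borel_measurable (seq_space \<Otimes>\<^sub>M node_space)"
      by (rule T.iter_measurable) measurable
    \<comment> \<open>The induction hypothesis is started from a state that already contains the
      directions \<open>v\<close> below child \<open>k\<close>; the integrand can then be written
      with the block products of both parts.\<close>
    have "?G1 (?x v) = ennreal ?C * iterated ?P ks (\<lambda>z. ?F z (graft k u v)) (z(k := r))" for v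
    proof -
      have "?G1 (?x v) = ennreal ?C * iterated ?P ks (\<lambda>z. iterated ?T ?rest
        (\<lambda>u. G (put (b + ?n) (map (block_prod z u) (subtree_nodes leaf_nodes ts ks)) (?x v))) (graft k u v)) (z(k := r))"
        using Cons.prems by (intro Cons.IH) auto
      also have "iterated ?P ks (\<lambda>z. iterated ?T ?rest
        (\<lambda>u. G (put (b + ?n) (map (block_prod z u) (subtree_nodes leaf_nodes ts ks)) (?x v))) (graft k u v)) (z(k := r))
        = iterated ?P ks (\<lambda>z. ?F z (graft k u v)) (z(k := r))"
      proof (rule iter_cong, rule iter_cong)
        fix z' u'
        assume z': "\<And>i. i \<notin> set ks \<Longrightarrow> z' i = (z(k := r)) i"
          and u': "\<And>I. I \<notin> set ?rest \<Longrightarrow> u' I = graft k u v I"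
        \<comment> \<open>As \<open>ks\<close> is distinct, the later integrations touch neither the
          entries below child \<open>k\<close> nor its radius.\<close>
        have "u' (k # J) = v J" for J
          using u'[of "k # J"] Cons.prems(2) by (auto simp: set_subtree_nodes)
        moreover have "z' k = r" using z'[of k] Cons.prems(2) by simp
        ultimately have eq: "map (block_prod z' u') (map ((#) k) (leaf_nodes (ts ! k))) = map (\<lambda>I. r * path_prod v I) (leaf_nodes (ts ! k))"
          by (simp add: block_prod_def)
        show "G (put (b + ?n) (map (block_prod z' u') (subtree_nodes leaf_nodes ts ks)) (?x v)) = G (?V z' u')"
          by (simp only: subtree_nodes_Cons map_append put_append eq length_map length_leaf_nodes)
      qed
      finally show ?thesis .
    qed
    then have "iterated (tree_laws (ts ! k)) (inner_nodes (ts ! k)) (\<lambda>v. ?G1 (?x v)) (\<lambda>J. u (k # J))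
      = iterated (tree_laws (ts ! k)) (inner_nodes (ts ! k))
          (\<lambda>v. ennreal ?C * iterated ?P ks (\<lambda>z. ?F z (graft k u v)) (z(k := r))) (\<lambda>J. u (k # J))"
      by simp
    also have "\<dots> = iterated ?T ?first (\<lambda>v. ennreal ?C * iterated ?P ks (\<lambda>z. ?F z v) (z(k := r))) u"
      unfolding iter_tree_laws_child by simp
    also have "\<dots> = ennreal ?C * iterated ?T ?first (\<lambda>v. iterated ?P ks (\<lambda>z. ?F z v) (z(k := r))) u"
    proof (rule T.iter_cmult)
      show "(\<lambda>v. iterated ?P ks (\<lambda>z. ?F z v) (z(k := r))) \<in> borel_measurable node_space"
      proof (rule P.iter_measurable)
        show "(\<lambda>p. ?F (snd p) (fst p)) \<in> borel_measurable (node_space \<Otimes>\<^sub>M seq_space)"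
          by (rule T.iter_measurable) measurable
      qed simp
    qed (simp add: space_PiM)
    \<comment> \<open>The directions of the first block move inside the integrals over the remaining
      radii, next to the directions of the other blocks.\<close>
    also have "iterated ?T ?first (\<lambda>v. iterated ?P ks (\<lambda>z. ?F z v) (z(k := r))) u
      = iterated ?P ks (\<lambda>z. iterated ?T ?first (?F z) u) (z(k := r))"
      by (rule iter_iter_swap[OF iter_measures_tree_laws iter_measures_power_measure F])
        (simp_all add: space_PiM)
    finally show "iterated (tree_laws (ts ! k)) (inner_nodes (ts ! k)) (\<lambda>v. ?G1 (?x v)) (\<lambda>J. u (k # J))
      = ennreal ?C * iterated ?P ks (\<lambda>z. iterated ?T (?first @ ?rest) (\<lambda>u. G (?V z u)) u) (z(k := r))"
      by (simp add: iter_append)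
  qed
  also have "\<dots> = ennreal ?C * (\<integral>\<^sup>+r. iterated ?P ks (\<lambda>z. iterated ?T (?first @ ?rest) (\<lambda>u. G (?V z u)) u) (z(k := r)) \<partial>?P k)"
  proof (rule nn_integral_cmult)
    show "(\<lambda>r. iterated ?P ks (\<lambda>z. iterated ?T (?first @ ?rest) (\<lambda>u. G (?V z u)) u) (z(k := r))) \<in> borel_measurable (?P k)"
    proof (rule P.iter_measurable)
      show "(\<lambda>p. iterated ?T (?first @ ?rest) (\<lambda>u. G (?V (snd p) u)) u) \<in> borel_measurable (?P k \<Otimes>\<^sub>M seq_space)"
        by (rule T.iter_measurable) (measurable, simp add: space_PiM)
    qed measurable
  qed
  finally show ?case
    using C ck by (simp add: ennreal_mult mult.assoc polar_formula_def less_imp_le)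
qed

text \<open>The radii of the children carry the weights z_k^(n_k-1), to which polar coordinates for
  one inner node apply; the resulting direction is exactly the law of the entry at the root.\<close>

lemma polar_formula_exists: "lp_tree t \<Longrightarrow> \<exists>c. polar_formula t c"
proof (induction t rule: nodes.induct)
  case 1
  \<comment> \<open>A leaf is its own radius, with empty path product 1, so the constant is
    1.\<close>
  have "put b [r] x = x(b := r)" for b x and r :: real
    by (rule ext) (auto simp: put_def)
  then show ?case by (intro exI[of _ 1]) (simp add: polar_formula_def)
next
  case (2 p ts)
  from "2.prems" obtain m where p: "0 < p" and m: "length ts = Suc m"
    and pos: "\<And>k. k < Suc m \<Longrightarrow> 0 < real (leaf_count (ts ! k))"
    by (rule lp_tree_cases) (auto simp: is_leaf_def)
  let ?t = "Node p ts" and ?L = "[0..<Suc m]"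
  let ?T = "tree_laws ?t" and ?rest = "subtree_nodes inner_nodes ts ?L"
  interpret T: iter_measures "tree_laws t" "\<lambda>_. seq_space" for t by (rule iter_measures_tree_laws)
  have "\<exists>c. polar_formula (ts ! k) c" if "k < Suc m" for k
    using "2.IH"[of k] lp_tree_nth[OF "2.prems", of k] that m by (auto simp: less_Suc_eq simp del: lp_tree.simps)
  then obtain c where c: "\<And>k. k < Suc m \<Longrightarrow> polar_formula (ts ! k) (c k)"
    by metis
  obtain c0 where c0: "0 < c0" and radial: "\<And>H. H \<in> borel_measurable seq_space \<Longrightarrow>
      iterated (\<lambda>k. power_measure (leaf_count (ts ! k))) ?L H (\<lambda>_. 0) =
      ennreal c0 * (\<integral>\<^sup>+r. (\<integral>\<^sup>+w. H (\<lambda>k. r * w k) \<partial>radial_law (Suc m) (\<lambda>k. leaf_count (ts ! k) / p) p)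
        \<partial>power_measure (\<Sum>k<Suc m. real (leaf_count (ts ! k))))"
    by (rule iter_power_measure_radial_law[of m "\<lambda>k. real (leaf_count (ts ! k))" p, OF pos p]) auto
  let ?C = "\<Prod>k\<leftarrow>?L. c k"
  have C: "0 < ?C"
  proof -
    have *: "0 < (\<Prod>k\<leftarrow>ks. c k)" if "\<And>k. k \<in> set ks \<Longrightarrow> 0 < c k" for ks
      using that by (induction ks) auto
    show ?thesis by (rule *) (use c in \<open>auto simp: polar_formula_def\<close>)
  qed
  have n: "(\<Sum>k\<leftarrow>?L. leaf_count (ts ! k)) = leaf_count ?t" "real (leaf_count ?t) = (\<Sum>k<Suc m. real (leaf_count (ts ! k)))"
    unfolding leaf_count_Node m
    by (simp_all only: interv_sum_list_conv_sum_set_nat set_upt atLeast0LessThan of_nat_sum)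
  have law: "tree_laws ?t [] = radial_law (Suc m) (\<lambda>k. leaf_count (ts ! k) / p) p"
    using "2.prems" m by (simp add: tree_laws_def node_law_def is_leaf_def)
  show ?case
  proof (intro exI[of _ "?C * c0"], unfold polar_formula_def, intro conjI allI impI)
    show "0 < ?C * c0" using C c0 by simp
    fix G :: "(nat \<Rightarrow> real) \<Rightarrow> ennreal" and b x u
    assume G [measurable]: "G \<in> borel_measurable seq_space"
    let ?H = "\<lambda>z. iterated ?T ?rest (\<lambda>u. G (put b (map (block_prod z u) (subtree_nodes leaf_nodes ts ?L)) x)) u"
    have "iterated (\<lambda>_. power_measure 1) [b..<b + leaf_count ?t] G x
      = ennreal ?C * iterated (\<lambda>k. power_measure (leaf_count (ts ! k))) ?L ?H (\<lambda>_. 0)"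
      unfolding n(1)[symmetric] using c by (intro polar_formula_blocks) auto
    also have "iterated (\<lambda>k. power_measure (leaf_count (ts ! k))) ?L ?H (\<lambda>_. 0)
      = ennreal c0 * (\<integral>\<^sup>+r. (\<integral>\<^sup>+w. ?H (\<lambda>k. r * w k) \<partial>tree_laws ?t []) \<partial>power_measure (leaf_count ?t))"
      unfolding law n(2)
    proof (rule radial)
      show "?H \<in> borel_measurable seq_space"
        by (rule T.iter_measurable) (measurable, simp add: space_PiM)
    qed
    also have "(\<integral>\<^sup>+r. (\<integral>\<^sup>+w. ?H (\<lambda>k. r * w k) \<partial>tree_laws ?t []) \<partial>power_measure (leaf_count ?t))
      = (\<integral>\<^sup>+r. iterated ?T (inner_nodes ?t) (\<lambda>u. G (put b (map (\<lambda>I. r * path_prod u I) (leaf_nodes ?t)) x)) u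
        \<partial>power_measure (leaf_count ?t))"
    proof (rule nn_integral_cong)
      fix r
      have "?H (\<lambda>k. r * w k) = iterated ?T ?rest (\<lambda>u. G (put b (map (\<lambda>I. r * path_prod u I) (leaf_nodes ?t)) x)) (u([] := w))" for w
      proof -
        have "?H (\<lambda>k. r * w k) = iterated ?T ?rest (\<lambda>u. G (put b (map (block_prod (\<lambda>k. r * w k) u) (subtree_nodes leaf_nodes ts ?L)) x)) (u([] := w))"
        \<comment> \<open>While the radii are still explicit, only entries strictly below the root
          are read, and all of these are integrated; the start state may therefore receive
          \<open>w\<close> at the root.\<close>
        proof (rule iter_independent_of_start[where S = "{}"])
          fix u v :: "node \<Rightarrow> nat \<Rightarrow> real"
          assume eq: "\<And>I. I \<in> {} \<union> set ?rest \<Longrightarrow> u I = v I"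
          have "map (block_prod (\<lambda>k. r * w k) u) (subtree_nodes leaf_nodes ts ?L) = map (block_prod (\<lambda>k. r * w k) v) (subtree_nodes leaf_nodes ts ?L)"
          proof (rule map_cong[OF refl])
            fix I assume "I \<in> set (subtree_nodes leaf_nodes ts ?L)"
            then obtain k J where I: "I = k # J" "k \<in> set ?L" "J \<in> set (leaf_nodes (ts ! k))"
              by (auto simp: set_subtree_nodes simp del: upt_Suc)
            then have "path_prod (\<lambda>J. u (k # J)) J = path_prod (\<lambda>J. v (k # J)) J"
              by (intro path_prod_cong[of "ts ! k"] eq) (auto simp: set_subtree_nodes simp del: upt_Suc)
            then show "block_prod (\<lambda>k. r * w k) u I = block_prod (\<lambda>k. r * w k) v I"
              by (simp add: block_prod_def I)
          qed
          then show "G (put b (map (block_prod (\<lambda>k. r * w k) u) (subtree_nodes leaf_nodes ts ?L)) x)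
            = G (put b (map (block_prod (\<lambda>k. r * w k) v) (subtree_nodes leaf_nodes ts ?L)) x)"
            by (rule arg_cong[where f = "\<lambda>ys. G (put b ys x)"])
        qed simp
        also have "\<dots> = iterated ?T ?rest (\<lambda>u. G (put b (map (\<lambda>I. r * path_prod u I) (leaf_nodes ?t)) x)) (u([] := w))"
        \<comment> \<open>The root does not occur in the remaining list, so its entry stays
          \<open>w\<close>, and a block product with radii r * w_k is r times a full path
          product.\<close>
        proof (rule iter_cong)
          fix u' assume "\<And>I. I \<notin> set ?rest \<Longrightarrow> u' I = (u([] := w)) I"
          then have "u' [] = w" by (auto simp: set_subtree_nodes simp del: upt_Suc)
          then have "map (block_prod (\<lambda>k. r * w k) u') (subtree_nodes leaf_nodes ts ?L) = map (\<lambda>I. r * path_prod u' I) (leaf_nodes ?t)"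
            by (auto simp: m block_prod_def set_subtree_nodes simp del: upt_Suc)
          then show "G (put b (map (block_prod (\<lambda>k. r * w k) u') (subtree_nodes leaf_nodes ts ?L)) x)
            = G (put b (map (\<lambda>I. r * path_prod u' I) (leaf_nodes ?t)) x)"
            by (rule arg_cong[where f = "\<lambda>ys. G (put b ys x)"])
        qed
        finally show ?thesis .
      qed
      then show "(\<integral>\<^sup>+w. ?H (\<lambda>k. r * w k) \<partial>tree_laws ?t [])
        = iterated ?T (inner_nodes ?t) (\<lambda>u. G (put b (map (\<lambda>I. r * path_prod u I) (leaf_nodes ?t)) x)) u"
        by (simp add: m del: upt_Suc)
    qed
    finally show "iterated (\<lambda>_. power_measure 1) [b..<b + leaf_count ?t] G x = ennreal (?C * c0) *
      (\<integral>\<^sup>+r. iterated ?T (inner_nodes ?t) (\<lambda>u. G (put b (map (\<lambda>I. r * path_prod u I) (leaf_nodes ?t)) x)) u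
        \<partial>power_measure (leaf_count ?t))"
      using C c0 by (simp add: ennreal_mult mult.assoc del: upt_Suc)
  qed
qed

section \<open>Nested functions and reflections\<close>

lemma offset_less:
  fixes k l :: nat
  assumes "k < l" "i < n k" shows "(\<Sum>j<k. n j) + i < (\<Sum>j<l. n j :: nat)"
proof -
  have "(\<Sum>j<k. n j) + i < (\<Sum>j<Suc k. n j)" using assms by simp
  also have "\<dots> \<le> (\<Sum>j<l. n j)" using assms(1) by (intro sum_mono2) auto
  finally show ?thesis .
qed

text \<open>Serves both for changes of sign and for changes of the values beyond the last
  leaf.\<close>

lemma lp_nested_cong_abs:
  "(\<And>i. i < leaf_count t \<Longrightarrow> \<bar>x i\<bar> = \<bar>y i\<bar>) \<Longrightarrow> lp_nested t x = lp_nested t y"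
proof (induction t x arbitrary: y rule: lp_nested.induct)
  case (2 p ts x)
  let ?o = "\<lambda>k. \<Sum>j<k. leaf_count (ts ! j)"
  have "lp_nested (ts ! k) (\<lambda>i. x (?o k + i)) = lp_nested (ts ! k) (\<lambda>i. y (?o k + i))" if "k < length ts" for k
    using that by (intro "2.IH") (auto intro!: "2.prems" offset_less simp del: leaf_count.simps simp: leaf_count_Node)
  then show ?case by simp
qed simp

lemma lp_nested_nonneg: "0 \<le> lp_nested t x"
  by (cases t) auto

lemma lp_nested_scale:
  "lp_tree t \<Longrightarrow> lp_nested t (\<lambda>i. c * x i) = \<bar>c\<bar> * lp_nested t x"
proof (induction t x rule: lp_nested.induct)
  case (2 p ts x)
  let ?x = "\<lambda>k i. x ((\<Sum>j<k. leaf_count (ts ! j)) + i)"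
  have p: "0 < p" using "2.prems" by simp
  have "lp_nested (Node p ts) (\<lambda>i. c * x i) = (\<Sum>k<length ts. (\<bar>c\<bar> * lp_nested (ts ! k) (?x k)) powr p) powr (1 / p)"
    using "2.IH" lp_tree_nth[OF "2.prems"] by simp
  also have "\<dots> = (\<bar>c\<bar> powr p * (\<Sum>k<length ts. lp_nested (ts ! k) (?x k) powr p)) powr (1 / p)"
    by (simp add: powr_mult lp_nested_nonneg sum_distrib_left)
  also have "\<dots> = \<bar>c\<bar> * lp_nested (Node p ts) x"
    using p by (simp add: powr_mult sum_nonneg powr_powr)
  finally show ?case .
qed (simp add: abs_mult)

text \<open>Applied to the vector of ones, this allows a diagonal point to be scaled to any
  prescribed value of f.\<close>

lemma lp_nested_pos:
  "lp_tree t \<Longrightarrow> (\<And>i. 0 < x i) \<Longrightarrow> 0 < lp_nested t x"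
proof (induction t x rule: lp_nested.induct)
  case (2 p ts x)
  have "0 < (\<Sum>k<length ts. lp_nested (ts ! k) (\<lambda>i. x ((\<Sum>j<k. leaf_count (ts ! j)) + i)) powr p)"
  proof (rule sum_pos)
    fix k assume "k \<in> {..<length ts}"
    then have "0 < lp_nested (ts ! k) (\<lambda>i. x ((\<Sum>j<k. leaf_count (ts ! j)) + i))"
      using lp_tree_nth[OF "2.prems"(1)] by (intro "2.IH") (auto intro: "2.prems")
    then show "0 < lp_nested (ts ! k) (\<lambda>i. x ((\<Sum>j<k. leaf_count (ts ! j)) + i)) powr p" by simp
  qed (use "2.prems" in \<open>auto simp: lessThan_empty_iff\<close>)
  then show ?case by simp
next
  case (1 x)
  have "0 < x 0" by (rule "1.prems"(2))
  then show ?case by simp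
qed

lemma lp_nested_measurable_seq: "lp_nested t \<in> borel_measurable seq_space"
proof -
  \<comment> \<open>Composition with an arbitrary measurable \<open>f\<close> makes the induction go
    through, since the children see shifted arguments.\<close>
  have "(\<lambda>a. lp_nested t (f a)) \<in> borel_measurable A" if "f \<in> A \<rightarrow>\<^sub>M seq_space" for f :: "'a \<Rightarrow> nat \<Rightarrow> real" and A
    using that
  proof (induction t arbitrary: f rule: nodes.induct)
    case 1
    note [measurable] = measurable_compose[OF 1 measurable_component_singleton[of 0]]
    show ?case by simp
  next
    case (2 p ts)
    have [measurable]: "(\<lambda>a. lp_nested (ts ! k) (\<lambda>i. f a (c + i))) \<in> borel_measurable A" if "k < length ts" for k c
    proof (rule "2.IH")
      show "(\<lambda>a i. f a (c + i)) \<in> A \<rightarrow>\<^sub>M seq_space"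
        by (rule measurable_PiM_single') (auto intro: measurable_compose[OF 2(2)])
    qed (use that in simp)
    show ?case by simp
  qed
  from this[of "\<lambda>x. x" seq_space] show ?thesis by simp
qed

lemma extend_measurable: "(\<lambda>x. x) \<in> borel_vec n \<rightarrow>\<^sub>M seq_space"
proof (rule measurable_PiM_single')
  fix i
  show "(\<lambda>x. x i) \<in> borel_measurable (borel_vec n)"
  proof (cases "i < n")
    case False
    \<comment> \<open>Beyond n every point of the product space has the constant value
      \<open>undefined\<close>.\<close>
    then have "(\<lambda>x. x i) \<in> borel_measurable (borel_vec n) \<longleftrightarrow> (\<lambda>x :: nat \<Rightarrow> real. undefined :: real) \<in> borel_measurable (borel_vec n)"
      by (intro measurable_cong) (auto simp: space_PiM PiE_def extensional_def)
    then show ?thesis by simp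
  qed simp
qed auto

lemma lp_nested_measurable [measurable]: "lp_nested t \<in> borel_measurable (borel_vec n)"
  using measurable_compose[OF extend_measurable lp_nested_measurable_seq] .

section \<open>The order of the leaves and the constraints on the directions\<close>

lemma sum_list_upt: "(\<Sum>k\<leftarrow>[0..<l]. g k) = (\<Sum>k<l. g k)"
  by (simp add: interv_sum_list_conv_sum_set_nat atLeast0LessThan)

text \<open>Matches the enumeration of the leaves with the block offsets in the recursion of
  \<open>lp_nested\<close>.\<close>

lemma nth_subtree_nodes:
  assumes "\<And>k. length (f (ts ! k)) = n k" "k < l" "i < n k"
  shows "subtree_nodes f ts [0..<l] ! ((\<Sum>j<k. n j) + i) = k # (f (ts ! k) ! i)"
proof -
  have "length (subtree_nodes f ts [0..<k]) = (\<Sum>j<k. n j)"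
    by (simp add: subtree_nodes_def length_concat o_def assms(1) sum_list_upt)
  moreover have "[0..<l] = [0..<k] @ k # [Suc k..<l]"
    using assms(2) by (metis le_add_same_cancel1 less_imp_add_positive upt_add_eq_append upt_conv_Cons zero_le add_0)
  ultimately show ?thesis
    using assms(1,3) by (simp add: nth_append)
qed

text \<open>The almost sure event for the draw at \<open>I\<close>: positive entries whose powers
  with the exponent of the node add up to 1.\<close>

definition unit_entry :: "ltree \<Rightarrow> node \<Rightarrow> (nat \<Rightarrow> real) \<Rightarrow> bool" where
  "unit_entry t I w \<longleftrightarrow> (\<forall>k<length (children (subtree t I)). 0 < w k) \<and>
     (\<Sum>k<length (children (subtree t I)). w k powr node_exponent t I) = 1"

lemma unit_entry_child: "unit_entry (Node p ts) (k # I) = unit_entry (ts ! k) I"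
  by (simp add: unit_entry_def node_exponent_def fun_eq_iff)

lemma inner_nodes_subtree:
  "lp_tree t \<Longrightarrow> I \<in> set (inner_nodes t) \<Longrightarrow> lp_tree (subtree t I) \<and> \<not> is_leaf (subtree t I)"
proof (induction t arbitrary: I rule: nodes.induct)
  case (2 p ts)
  show ?case
  proof (cases I)
    case Nil
    then show ?thesis using "2.prems" by (simp add: is_leaf_def)
  next
    case (Cons k J)
    then show ?thesis using 2 lp_tree_nth[OF "2.prems"(1)] by (auto simp: set_subtree_nodes)
  qed
qed simp

lemma AE_tree_laws:
  assumes "lp_tree t" "I \<in> set (inner_nodes t)"
  shows "AE w in tree_laws t I. unit_entry t I w"
proof -
  have sub: "lp_tree (subtree t I)" "\<not> is_leaf (subtree t I)" using inner_nodes_subtree[OF assms] by auto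
  then show ?thesis
  proof (rule lp_tree_cases)
    fix p ts m
    assume t: "subtree t I = Node p ts" and p: "0 < p" and m: "length ts = Suc m"
      and pos: "\<And>k. k < Suc m \<Longrightarrow> 0 < leaf_count (ts ! k)"
    have "AE w in radial_law (Suc m) (\<lambda>k. leaf_count (ts ! k) / p) p. (\<forall>i<Suc m. 0 < w i) \<and> (\<Sum>i<Suc m. w i powr p) = 1"
      by (rule AE_radial_law[OF _ p]) (use pos p in simp)
    moreover have "tree_laws t I = radial_law (Suc m) (\<lambda>k. leaf_count (ts ! k) / p) p"
      using sub m by (simp add: tree_laws_def node_law_def t)
    ultimately show ?thesis
      by (simp only: unit_entry_def node_exponent_def t m children.simps exponent.simps)
  qed
qed

text \<open>By homogeneity and induction the block of child k has value \<open>u [] k\<close>, and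
  the powers of these values add up to 1 at the root.\<close>

lemma lp_nested_path_prod:
  "lp_tree t \<Longrightarrow> (\<And>I. I \<in> set (inner_nodes t) \<Longrightarrow> unit_entry t I (u I)) \<Longrightarrow>
    lp_nested t (\<lambda>i. path_prod u (leaf_nodes t ! i)) = 1"
proof (induction t arbitrary: u rule: nodes.induct)
  case (2 p ts)
  let ?o = "\<lambda>k. \<Sum>j<k. leaf_count (ts ! j)"
  have root: "unit_entry (Node p ts) [] (u [])" by (rule "2.prems"(2)) simp
  have "lp_nested (ts ! k) (\<lambda>i. path_prod u (leaf_nodes (Node p ts) ! (?o k + i))) = u [] k" if k: "k < length ts" for k
  proof -
    have "lp_nested (ts ! k) (\<lambda>i. path_prod u (leaf_nodes (Node p ts) ! (?o k + i)))
      = lp_nested (ts ! k) (\<lambda>i. u [] k * path_prod (\<lambda>I. u (k # I)) (leaf_nodes (ts ! k) ! i))"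
      using k by (intro lp_nested_cong_abs) (simp add: nth_subtree_nodes del: sum.lessThan_Suc)
    also have "\<dots> = \<bar>u [] k\<bar> * 1"
    proof (subst lp_nested_scale)
      have "lp_nested (ts ! k) (\<lambda>i. path_prod (\<lambda>I. u (k # I)) (leaf_nodes (ts ! k) ! i)) = 1"
      proof (rule "2.IH")
        fix I assume "I \<in> set (inner_nodes (ts ! k))"
        then show "unit_entry (ts ! k) I (u (k # I))"
          using "2.prems"(2)[of "k # I"] k by (simp add: unit_entry_child set_subtree_nodes)
      qed (use k lp_tree_nth[OF "2.prems"(1) k] in auto)
      then show "\<bar>u [] k\<bar> * lp_nested (ts ! k) (\<lambda>i. path_prod (\<lambda>I. u (k # I)) (leaf_nodes (ts ! k) ! i)) = \<bar>u [] k\<bar> * 1"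
        by simp
    qed (rule lp_tree_nth[OF "2.prems"(1) k])
    also have "\<dots> = u [] k" using root k by (auto simp: unit_entry_def intro: abs_of_pos)
    finally show ?thesis .
  qed
  then show ?case using root by (simp add: unit_entry_def node_exponent_def del: leaf_nodes_Node)
qed simp

section \<open>Signs and reflections of Lebesgue measure\<close>

lemma nn_integral_sign_dist:
  "g \<in> borel_measurable borel \<Longrightarrow> (\<integral>\<^sup>+e. g e \<partial>sign_dist) = (g (-1) + g 1) / 2"
  unfolding sign_dist_def
  by (simp add: nn_integral_distr nn_integral_pmf_of_set)

lemma sets_sign_dist [simp, measurable_cong]: "sets sign_dist = sets borel"
  by (simp add: sign_dist_def)

lemma prob_space_sign_dist: "prob_space sign_dist"
  unfolding sign_dist_def by (rule measure_pmf.prob_space_distr) simp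

lemma AE_sign_dist: "AE e in sign_dist. \<bar>e\<bar> = 1"
  unfolding sign_dist_def by (subst AE_distr_iff) (auto simp: AE_measure_pmf_iff)

lemma iter_measures_sign_dist: "iter_measures (\<lambda>_. sign_dist) (\<lambda>_. borel)"
  by (rule iter_measures.intro) (simp_all add: prob_space_sign_dist prob_space_imp_sigma_finite)

text \<open>The line is split at 0 and the negative half reflected. The factor 2 compensates the
  averaging over the sign.\<close>

lemma nn_integral_lborel_sign:
  assumes [measurable]: "h \<in> borel_measurable borel"
  shows "(\<integral>\<^sup>+y. h y \<partial>lborel) = 2 * (\<integral>\<^sup>+e. (\<integral>\<^sup>+y. h (e * y) \<partial>power_measure 1) \<partial>sign_dist)"
proof -
  interpret sigma_finite_measure "power_measure 1" by (rule sigma_finite_power_measure)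
  have half: "2 * (x / 2) = x" for x :: ennreal
    using mult_divide_eq_ennreal[of 2 x] by (simp add: ennreal_times_divide mult.commute)
  have P: "(\<integral>\<^sup>+y. g y \<partial>power_measure 1) = (\<integral>\<^sup>+y. g y * indicator {0<..} y \<partial>lborel)"
    if [measurable]: "g \<in> borel_measurable borel" for g
    by (subst nn_integral_power_measure) (auto intro!: nn_integral_cong split: split_indicator)
  have "(\<integral>\<^sup>+y. h y \<partial>lborel) = (\<integral>\<^sup>+y. h y * indicator {..<0} y + h y * indicator {0<..} y \<partial>lborel)"
  proof (rule nn_integral_cong_AE)
    show "AE y in lborel. h y = h y * indicator {..<0} y + h y * indicator {0<..} y"
      using AE_lborel_singleton[of 0] by eventually_elim (auto split: split_indicator)
  qed
  also have "\<dots> = (\<integral>\<^sup>+y. h y * indicator {..<0} y \<partial>lborel) + (\<integral>\<^sup>+y. h y * indicator {0<..} y \<partial>lborel)"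
    by (rule nn_integral_add) measurable
  also have "(\<integral>\<^sup>+y. h y * indicator {..<0} y \<partial>lborel) = (\<integral>\<^sup>+y. h (-1 * y) * indicator {0<..} y \<partial>lborel)"
    by (subst nn_integral_real_affine[where c = "-1" and t = 0])
      (auto intro!: nn_integral_cong split: split_indicator)
  finally have "(\<integral>\<^sup>+y. h y \<partial>lborel) = (\<integral>\<^sup>+y. h (-1 * y) \<partial>power_measure 1) + (\<integral>\<^sup>+y. h (1 * y) \<partial>power_measure 1)"
    by (subst (1 2) P) simp_all
  also have "\<dots> = 2 * (((\<integral>\<^sup>+y. h (-1 * y) \<partial>power_measure 1) + (\<integral>\<^sup>+y. h (1 * y) \<partial>power_measure 1)) / 2)"
    by (simp only: half)
  also have "((\<integral>\<^sup>+y. h (-1 * y) \<partial>power_measure 1) + (\<integral>\<^sup>+y. h (1 * y) \<partial>power_measure 1)) / 2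
    = (\<integral>\<^sup>+e. (\<integral>\<^sup>+y. h (e * y) \<partial>power_measure 1) \<partial>sign_dist)"
    by (rule nn_integral_sign_dist[symmetric]) measurable
  finally show ?thesis .
qed

lemma pointwise_mult_measurable [measurable (raw)]:
  assumes "f \<in> A \<rightarrow>\<^sub>M seq_space" "g \<in> A \<rightarrow>\<^sub>M seq_space"
  shows "(\<lambda>a i. f a i * g a i) \<in> A \<rightarrow>\<^sub>M seq_space"
proof (rule measurable_PiM_single')
  fix i
  show "(\<lambda>a. f a i * g a i) \<in> borel_measurable A"
    by (intro borel_measurable_times measurable_compose[OF assms(1)] measurable_compose[OF assms(2)]) simp_all
qed auto

lemma iter_reflected_measurable [measurable (raw)]:
  assumes [measurable]: "G \<in> borel_measurable seq_space" "f \<in> A \<rightarrow>\<^sub>M seq_space" "g \<in> A \<rightarrow>\<^sub>M seq_space"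
  shows "(\<lambda>a. iterated (\<lambda>_. power_measure 1) L (\<lambda>x. G (\<lambda>i. f a i * x i)) (g a)) \<in> borel_measurable A"
proof -
  interpret P: iter_measures "\<lambda>_::nat. power_measure 1" "\<lambda>_. borel" by (rule iter_measures_power_measure)
  show ?thesis by (rule P.iter_measurable) measurable
qed

text \<open>All signs are collected outside, so that for fixed signs the polar formula on the
  positive orthant applies. Start points of the form e_i * x_i keep both iterations in step during
  the induction.\<close>

lemma iter_lborel_sign:
  assumes G [measurable]: "G \<in> borel_measurable seq_space"
  shows "iterated (\<lambda>_. lborel) L G (\<lambda>i. e i * x i) = 2 ^ length L *
    iterated (\<lambda>_. sign_dist) L (\<lambda>e. iterated (\<lambda>_. power_measure 1) L (\<lambda>x. G (\<lambda>i. e i * x i)) x) e"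
proof (induction L arbitrary: e x)
  case (Cons i L)
  interpret L: iter_measures "\<lambda>_::nat. lborel" "\<lambda>_. borel" by (rule iter_measures_lborel)
  interpret S: iter_measures "\<lambda>_::nat. sign_dist" "\<lambda>_. borel" by (rule iter_measures_sign_dist)
  interpret pm: sigma_finite_measure "power_measure 1" by (rule sigma_finite_power_measure)
  let ?F = "\<lambda>e x. iterated (\<lambda>_. power_measure 1) L (\<lambda>x. G (\<lambda>i. e i * x i)) x"
  have "iterated (\<lambda>_. lborel) (i # L) G (\<lambda>i. e i * x i) = (\<integral>\<^sup>+y. iterated (\<lambda>_. lborel) L G ((\<lambda>i. e i * x i)(i := y)) \<partial>lborel)"
    by simp
  also have "\<dots> = 2 * (\<integral>\<^sup>+d. (\<integral>\<^sup>+y. iterated (\<lambda>_. lborel) L G ((\<lambda>i. e i * x i)(i := d * y)) \<partial>power_measure 1) \<partial>sign_dist)"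
  proof (rule nn_integral_lborel_sign)
    show "(\<lambda>y. iterated (\<lambda>_. lborel) L G ((\<lambda>i. e i * x i)(i := y))) \<in> borel_measurable borel"
      by (rule L.iter_measurable[OF measurable_compose[OF measurable_snd G]]) measurable
  qed
  also have "\<dots> = 2 * (\<integral>\<^sup>+d. 2 ^ length L * iterated (\<lambda>_. sign_dist) L (\<lambda>e. \<integral>\<^sup>+y. ?F e (x(i := y)) \<partial>power_measure 1) (e(i := d)) \<partial>sign_dist)"
  proof (intro arg_cong[where f = "\<lambda>z. 2 * z"] nn_integral_cong)
    fix d
    have "(\<integral>\<^sup>+y. iterated (\<lambda>_. lborel) L G ((\<lambda>i. e i * x i)(i := d * y)) \<partial>power_measure 1)
      = (\<integral>\<^sup>+y. iterated (\<lambda>_. lborel) L G (\<lambda>j. (e(i := d)) j * (x(i := y)) j) \<partial>power_measure 1)"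
      by (auto intro!: nn_integral_cong arg_cong[where f = "iterated (\<lambda>_. lborel) L G"])
    also have "\<dots> = (\<integral>\<^sup>+y. 2 ^ length L * iterated (\<lambda>_. sign_dist) L (\<lambda>e. ?F e (x(i := y))) (e(i := d)) \<partial>power_measure 1)"
      by (simp only: Cons.IH)
    also have "\<dots> = 2 ^ length L * (\<integral>\<^sup>+y. iterated (\<lambda>_. sign_dist) L (\<lambda>e. ?F e (x(i := y))) (e(i := d)) \<partial>power_measure 1)"
    proof (rule nn_integral_cmult)
      show "(\<lambda>y. iterated (\<lambda>_. sign_dist) L (\<lambda>e. ?F e (x(i := y))) (e(i := d))) \<in> borel_measurable (power_measure 1)"
        by (rule S.iter_measurable) measurable
    qed
    also have "(\<integral>\<^sup>+y. iterated (\<lambda>_. sign_dist) L (\<lambda>e. ?F e (x(i := y))) (e(i := d)) \<partial>power_measure 1)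
      = iterated (\<lambda>_. sign_dist) L (\<lambda>e. \<integral>\<^sup>+y. ?F e (x(i := y)) \<partial>power_measure 1) (e(i := d))"
    proof (rule S.iter_swap[OF sigma_finite_power_measure, symmetric])
      have "(\<lambda>p. x(i := fst p)) \<in> power_measure 1 \<Otimes>\<^sub>M seq_space \<rightarrow>\<^sub>M seq_space"
        by (rule upd_borel_measurable) (auto intro!: measurable_const simp: space_PiM)
      then show "(\<lambda>p. ?F (snd p) (x(i := fst p))) \<in> borel_measurable (power_measure 1 \<Otimes>\<^sub>M seq_space)"
        by (intro iter_reflected_measurable G measurable_snd)
    qed (simp add: space_PiM)
    finally show "(\<integral>\<^sup>+y. iterated (\<lambda>_. lborel) L G ((\<lambda>i. e i * x i)(i := d * y)) \<partial>power_measure 1)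
      = 2 ^ length L * iterated (\<lambda>_. sign_dist) L (\<lambda>e. \<integral>\<^sup>+y. ?F e (x(i := y)) \<partial>power_measure 1) (e(i := d))" .
  qed
  also have "\<dots> = 2 * (2 ^ length L * (\<integral>\<^sup>+d. iterated (\<lambda>_. sign_dist) L (\<lambda>e. \<integral>\<^sup>+y. ?F e (x(i := y)) \<partial>power_measure 1) (e(i := d)) \<partial>sign_dist))"
  proof (intro arg_cong[where f = "\<lambda>z. 2 * z"] nn_integral_cmult)
    show "(\<lambda>d. iterated (\<lambda>_. sign_dist) L (\<lambda>e. \<integral>\<^sup>+y. ?F e (x(i := y)) \<partial>power_measure 1) (e(i := d))) \<in> borel_measurable sign_dist"
      by (rule S.iter_measurable) measurable
  qed
  finally show ?case by (simp add: mult.assoc)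
qed simp

section \<open>The nested symmetric distribution with a given radial density\<close>

definition leaf_vec :: "ltree \<Rightarrow> (nat \<Rightarrow> real) \<Rightarrow> real \<Rightarrow> (node \<Rightarrow> nat \<Rightarrow> real) \<Rightarrow> nat \<Rightarrow> real" where
  "leaf_vec t e r u i = (if i < leaf_count t then e i * (r * path_prod u (leaf_nodes t ! i)) else 0)"

lemma leaf_vec_measurable [measurable (raw)]:
  assumes "f \<in> A \<rightarrow>\<^sub>M seq_space" and [measurable]: "g \<in> A \<rightarrow>\<^sub>M borel" "h \<in> A \<rightarrow>\<^sub>M node_space"
  shows "(\<lambda>a. leaf_vec t (f a) (g a) (h a)) \<in> A \<rightarrow>\<^sub>M seq_space"
proof (rule measurable_PiM_single')
  fix i
  have [measurable]: "(\<lambda>a. f a i) \<in> A \<rightarrow>\<^sub>M borel"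
    by (rule measurable_compose[OF assms(1)]) simp
  show "(\<lambda>a. leaf_vec t (f a) (g a) (h a) i) \<in> A \<rightarrow>\<^sub>M borel"
    unfolding leaf_vec_def by (cases "i < leaf_count t") simp_all
qed auto

lemma lp_nested_leaf_vec:
  assumes "lp_tree t" "\<And>i. i < leaf_count t \<Longrightarrow> \<bar>e i\<bar> = 1" "\<And>I. I \<in> set (inner_nodes t) \<Longrightarrow> unit_entry t I (u I)"
  shows "lp_nested t (leaf_vec t e r u) = \<bar>r\<bar>"
proof -
  have "lp_nested t (leaf_vec t e r u) = lp_nested t (\<lambda>i. r * path_prod u (leaf_nodes t ! i))"
    using assms(2) by (intro lp_nested_cong_abs) (simp add: leaf_vec_def abs_mult)
  then show ?thesis
    using assms by (simp add: lp_nested_scale lp_nested_path_prod)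
qed

text \<open>The average of G over the level set of f at radius |r|, with respect to independent
  signs and the path products of independent directions.\<close>

definition sphere_mean :: "ltree \<Rightarrow> ((nat \<Rightarrow> real) \<Rightarrow> ennreal) \<Rightarrow> real \<Rightarrow> ennreal" where
  "sphere_mean t G r = iterated (\<lambda>_. sign_dist) [0..<leaf_count t] (\<lambda>e. iterated (tree_laws t) (inner_nodes t)
     (\<lambda>u. G (leaf_vec t e r u)) (\<lambda>_ _. 0)) (\<lambda>_. 0)"

lemma sphere_mean_measurable [measurable]:
  assumes [measurable]: "G \<in> borel_measurable seq_space"
  shows "sphere_mean t G \<in> borel_measurable borel"
proof -
  interpret S: iter_measures "\<lambda>_::nat. sign_dist" "\<lambda>_. borel" by (rule iter_measures_sign_dist)
  interpret T: iter_measures "tree_laws t" "\<lambda>_. seq_space" by (rule iter_measures_tree_laws)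
  show ?thesis
    unfolding sphere_mean_def[abs_def]
  proof (rule S.iter_measurable)
    show "(\<lambda>p. iterated (tree_laws t) (inner_nodes t) (\<lambda>u. G (leaf_vec t (snd p) (fst p) u)) (\<lambda>_ _. 0))
      \<in> borel_measurable (borel \<Otimes>\<^sub>M seq_space)"
      by (rule T.iter_measurable) (measurable, simp add: space_PiM)
  qed simp
qed

text \<open>For almost all signs and directions the averaged points satisfy f(x) = r, so the values
  of the integrand elsewhere do not matter. Functions of f can thus be replaced by
  constants.\<close>

lemma sphere_mean_cong:
  assumes t: "lp_tree t" and "0 < r" and G: "\<And>x. lp_nested t x = r \<Longrightarrow> G x = G' x"
  shows "sphere_mean t G r = sphere_mean t G' r"
  unfolding sphere_mean_def
proof (rule iter_cong_AE[where P = "\<lambda>_ e. \<bar>e\<bar> = 1" and S = "{}", OF AE_sign_dist])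
  fix e :: "nat \<Rightarrow> real"
  assume e: "\<And>i. i \<in> {} \<union> set [0..<leaf_count t] \<Longrightarrow> \<bar>e i\<bar> = 1"
  show "iterated (tree_laws t) (inner_nodes t) (\<lambda>u. G (leaf_vec t e r u)) (\<lambda>_ _. 0) =
    iterated (tree_laws t) (inner_nodes t) (\<lambda>u. G' (leaf_vec t e r u)) (\<lambda>_ _. 0)"
  proof (rule iter_cong_AE[where P = "unit_entry t" and S = "{}", OF AE_tree_laws[OF t]])
    fix u :: "node \<Rightarrow> nat \<Rightarrow> real"
    assume "\<And>I. I \<in> {} \<union> set (inner_nodes t) \<Longrightarrow> unit_entry t I (u I)"
    then have "lp_nested t (leaf_vec t e r u) = \<bar>r\<bar>"
      using e by (intro lp_nested_leaf_vec[OF t]) auto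
    then show "G (leaf_vec t e r u) = G' (leaf_vec t e r u)"
      using \<open>0 < r\<close> by (intro G) simp
  qed auto
qed auto

lemma sphere_mean_const: "sphere_mean t (\<lambda>_. c) r = c"
  unfolding sphere_mean_def
  by (simp add: iter_const prob_space_sign_dist tree_laws_def prob_space_node_law)

lemma sphere_mean_cmult:
  assumes [measurable]: "G \<in> borel_measurable seq_space"
  shows "sphere_mean t (\<lambda>x. c * G x) r = c * sphere_mean t G r"
proof -
  interpret S: iter_measures "\<lambda>_::nat. sign_dist" "\<lambda>_. borel" by (rule iter_measures_sign_dist)
  interpret T: iter_measures "tree_laws t" "\<lambda>_. seq_space" by (rule iter_measures_tree_laws)
  have "iterated (tree_laws t) (inner_nodes t) (\<lambda>u. c * G (leaf_vec t e r u)) (\<lambda>_ _. 0)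
    = c * iterated (tree_laws t) (inner_nodes t) (\<lambda>u. G (leaf_vec t e r u)) (\<lambda>_ _. 0)" for e
    by (rule T.iter_cmult) (measurable, simp_all add: space_PiM)
  moreover have "(\<lambda>e. iterated (tree_laws t) (inner_nodes t) (\<lambda>u. G (leaf_vec t e r u)) (\<lambda>_ _. 0)) \<in> borel_measurable seq_space"
    by (rule T.iter_measurable) (measurable, simp add: space_PiM)
  ultimately show ?thesis
    unfolding sphere_mean_def by (simp add: S.iter_cmult)
qed

lemma restrict_measurable [measurable]: "(\<lambda>x. restrict x {..<n}) \<in> seq_space \<rightarrow>\<^sub>M borel_vec n"
  by (rule measurable_restrict) auto

lemma lp_nested_restrict: "lp_nested t (restrict x {..<leaf_count t}) = lp_nested t x"
  by (rule lp_nested_cong_abs) simp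

lemma sets_lborel_vec [simp, measurable_cong]: "sets (lborel_vec n) = sets (borel_vec n)"
  by (rule sets_PiM_cong) auto

text \<open>Polar coordinates on the whole space. The argument is restricted because G lives on the
  product space while \<open>sphere_mean\<close> works with total functions.\<close>

definition polar_const :: "ltree \<Rightarrow> real \<Rightarrow> bool" where
  "polar_const t c \<longleftrightarrow> 0 < c \<and> (\<forall>G \<in> borel_measurable (borel_vec (leaf_count t)).
     (\<integral>\<^sup>+x. G x \<partial>lborel_vec (leaf_count t)) =
     ennreal c * (\<integral>\<^sup>+r. sphere_mean t (\<lambda>x. G (restrict x {..<leaf_count t})) r \<partial>power_measure (leaf_count t)))"

lemma polar_const_exists:
  assumes "lp_tree t"
  obtains c where "polar_const t c"
proof -
  interpret S: iter_measures "\<lambda>_::nat. sign_dist" "\<lambda>_. borel" by (rule iter_measures_sign_dist)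
  interpret T: iter_measures "tree_laws t" "\<lambda>_. seq_space" by (rule iter_measures_tree_laws)
  let ?n = "leaf_count t"
  obtain c where c: "polar_formula t c" using polar_formula_exists[OF assms] by blast
  \<comment> \<open>The constant of the positive orthant times the number of orthants.\<close>
  have "polar_const t (2 ^ ?n * c)"
    unfolding polar_const_def
  proof (intro conjI ballI)
    show "0 < 2 ^ ?n * c" using c by (simp add: polar_formula_def)
    fix G :: "(nat \<Rightarrow> real) \<Rightarrow> ennreal" assume [measurable]: "G \<in> borel_measurable (borel_vec ?n)"
    let ?G = "\<lambda>x. G (restrict x {..<?n})"
    let ?F = "\<lambda>r e. iterated (tree_laws t) (inner_nodes t) (\<lambda>u. ?G (leaf_vec t e r u)) (\<lambda>_ _. 0)"
    have F [measurable]: "(\<lambda>p. ?F (fst p) (snd p)) \<in> borel_measurable (power_measure ?n \<Otimes>\<^sub>M seq_space)"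
      by (rule T.iter_measurable) (measurable, simp add: space_PiM)
    have [measurable]: "?G \<in> borel_measurable seq_space" by measurable
    have "(\<integral>\<^sup>+x. G x \<partial>lborel_vec ?n) = (\<integral>\<^sup>+x. ?G (\<lambda>i. if i < ?n then x i else 0) \<partial>lborel_vec ?n)"
    proof (rule nn_integral_cong)
      fix x assume "x \<in> space (lborel_vec ?n)"
      then have "restrict (\<lambda>i. if i < ?n then x i else 0) {..<?n} = x"
        by (intro ext) (auto simp: space_PiM PiE_def extensional_def)
      then show "G x = ?G (\<lambda>i. if i < ?n then x i else 0)" by simp
    qed
    also have "\<dots> = iterated (\<lambda>_. lborel) [0..<?n] ?G (\<lambda>_. 0)"
      by (rule nn_integral_lborel_vec_eq_iter) measurable
    also have "\<dots> = 2 ^ ?n * iterated (\<lambda>_. sign_dist) [0..<?n]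
        (\<lambda>e. iterated (\<lambda>_. power_measure 1) [0..<?n] (\<lambda>x. ?G (\<lambda>i. e i * x i)) (\<lambda>_. 0)) (\<lambda>_. 0)"
      using iter_lborel_sign[of ?G "[0..<?n]" "\<lambda>_. 0" "\<lambda>_. 0"] by simp
    also have "(\<lambda>e. iterated (\<lambda>_. power_measure 1) [0..<?n] (\<lambda>x. ?G (\<lambda>i. e i * x i)) (\<lambda>_. 0))
      = (\<lambda>e. ennreal c * (\<integral>\<^sup>+r. ?F r e \<partial>power_measure ?n))"
    proof
      fix e :: "nat \<Rightarrow> real"
      have "(\<lambda>x i. e i * x i) \<in> seq_space \<rightarrow>\<^sub>M seq_space"
      proof (rule measurable_PiM_single')
        fix i show "(\<lambda>x. e i * x i) \<in> borel_measurable seq_space" by measurable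
      qed auto
      from measurable_compose[OF this \<open>?G \<in> borel_measurable seq_space\<close>]
      have "(\<lambda>x. ?G (\<lambda>i. e i * x i)) \<in> borel_measurable seq_space" .
      have "(\<lambda>i. e i * put 0 (map (\<lambda>I. r * path_prod u I) (leaf_nodes t)) (\<lambda>_. 0) i) = leaf_vec t e r u" for r u
        by (rule ext) (simp add: put_def leaf_vec_def)
      moreover have "iterated (\<lambda>_. power_measure 1) [b..<b + ?n] H x = ennreal c * (\<integral>\<^sup>+r. iterated (tree_laws t) (inner_nodes t)
          (\<lambda>u. H (put b (map (\<lambda>I. r * path_prod u I) (leaf_nodes t)) x)) u \<partial>power_measure ?n)"
        if "H \<in> borel_measurable seq_space" for H b x u
        using c that unfolding polar_formula_def by blast
      note this[OF \<open>(\<lambda>x. ?G (\<lambda>i. e i * x i)) \<in> borel_measurable seq_space\<close>, of 0 "\<lambda>_. 0" "\<lambda>_ _. 0"]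
      ultimately show "iterated (\<lambda>_. power_measure 1) [0..<?n] (\<lambda>x. ?G (\<lambda>i. e i * x i)) (\<lambda>_. 0)
        = ennreal c * (\<integral>\<^sup>+r. ?F r e \<partial>power_measure ?n)"
        by (simp only: add_0)
    qed
    also have "iterated (\<lambda>_. sign_dist) [0..<?n] (\<lambda>e. ennreal c * (\<integral>\<^sup>+r. ?F r e \<partial>power_measure ?n)) (\<lambda>_. 0)
      = ennreal c * iterated (\<lambda>_. sign_dist) [0..<?n] (\<lambda>e. \<integral>\<^sup>+r. ?F r e \<partial>power_measure ?n) (\<lambda>_. 0)"
    proof (rule S.iter_cmult)
      interpret sigma_finite_measure "power_measure ?n" by (rule sigma_finite_power_measure)
      show "(\<lambda>e. \<integral>\<^sup>+r. ?F r e \<partial>power_measure ?n) \<in> borel_measurable seq_space"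
      proof (rule borel_measurable_nn_integral)
        have "(\<lambda>q. (snd q, fst q)) \<in> seq_space \<Otimes>\<^sub>M power_measure ?n \<rightarrow>\<^sub>M power_measure ?n \<Otimes>\<^sub>M seq_space"
          by measurable
        from measurable_compose[OF this F]
        show "(\<lambda>(e, r). ?F r e) \<in> borel_measurable (seq_space \<Otimes>\<^sub>M power_measure ?n)"
          by (simp add: split_beta')
      qed
    qed simp
    also have "iterated (\<lambda>_. sign_dist) [0..<?n] (\<lambda>e. \<integral>\<^sup>+r. ?F r e \<partial>power_measure ?n) (\<lambda>_. 0)
      = (\<integral>\<^sup>+r. sphere_mean t ?G r \<partial>power_measure ?n)"
      unfolding sphere_mean_def by (rule S.iter_swap[OF sigma_finite_power_measure F]) simp
    finally show "(\<integral>\<^sup>+x. G x \<partial>lborel_vec ?n) = ennreal (2 ^ ?n * c) * (\<integral>\<^sup>+r. sphere_mean t ?G r \<partial>power_measure ?n)"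
      using c by (simp add: ennreal_mult polar_formula_def ennreal_power[symmetric] mult.assoc)
  qed
  then show ?thesis by (rule that)
qed

section \<open>The law of f under Lebesgue measure and the symmetric law with given radial
  density\<close>

definition radial_weight :: "ltree \<Rightarrow> real \<Rightarrow> real \<Rightarrow> ennreal" where
  "radial_weight t c z = ennreal c * orthant_weight (leaf_count t) z"

lemma radial_weight_measurable [measurable]: "radial_weight t c \<in> borel_measurable borel"
  unfolding radial_weight_def[abs_def] by measurable

lemma radial_weight_pos:
  assumes "0 < c" "0 < z"
  shows "radial_weight t c z \<noteq> 0" "radial_weight t c z \<noteq> top"
  using assms by (simp_all add: radial_weight_def orthant_weight_def ennreal_mult[symmetric] ennreal_eq_0_iff not_le)

lemma nn_integral_radial_weight:
  assumes [measurable]: "g \<in> borel_measurable borel"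
  shows "ennreal c * (\<integral>\<^sup>+z. g z \<partial>power_measure (leaf_count t)) = (\<integral>\<^sup>+z. radial_weight t c z * g z \<partial>lborel)"
proof -
  have "(\<integral>\<^sup>+z. g z \<partial>power_measure (leaf_count t)) = (\<integral>\<^sup>+z. orthant_weight (leaf_count t) z * g z \<partial>lborel)"
    unfolding power_measure_def orthant_weight_def by (rule nn_integral_density) measurable
  then show ?thesis
    by (simp add: radial_weight_def nn_integral_cmult[symmetric] mult.assoc)
qed

text \<open>The indicator of an event about f is constant on level sets, so its sphere mean is
  trivial and only the radial integral c z^(n-1) dz remains.\<close>

lemma distr_lp_nested_lborel:
  assumes t: "lp_tree t" and c: "polar_const t c"
  shows "distr (lborel_vec (leaf_count t)) lborel (lp_nested t) = density lborel (radial_weight t c)"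
proof (rule measure_eqI)
  let ?n = "leaf_count t"
  fix A assume "A \<in> sets (distr (lborel_vec ?n) lborel (lp_nested t))"
  then have [measurable]: "A \<in> sets borel" by simp
  have "emeasure (distr (lborel_vec ?n) lborel (lp_nested t)) A = (\<integral>\<^sup>+x. indicator A x \<partial>distr (lborel_vec ?n) lborel (lp_nested t))"
    by simp
  also have "\<dots> = (\<integral>\<^sup>+x. indicator A (lp_nested t x) \<partial>lborel_vec ?n)"
    by (rule nn_integral_distr) measurable
  also have "\<dots> = ennreal c * (\<integral>\<^sup>+z. sphere_mean t (\<lambda>x. indicator A (lp_nested t (restrict x {..<?n}))) z \<partial>power_measure ?n)"
    using c unfolding polar_const_def by simp
  also have "(\<integral>\<^sup>+z. sphere_mean t (\<lambda>x. indicator A (lp_nested t (restrict x {..<?n}))) z \<partial>power_measure ?n)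
    = (\<integral>\<^sup>+z. indicator A z \<partial>power_measure ?n)"
  proof (rule nn_integral_cong_AE)
    show "AE z in power_measure ?n. sphere_mean t (\<lambda>x. indicator A (lp_nested t (restrict x {..<?n}))) z = indicator A z"
      using AE_power_measure
    proof eventually_elim
      case (elim z)
      have "sphere_mean t (\<lambda>x. indicator A (lp_nested t (restrict x {..<?n}))) z = sphere_mean t (\<lambda>_. indicator A z) z"
        by (rule sphere_mean_cong[OF t elim]) (simp add: lp_nested_restrict)
      then show ?case by (simp add: sphere_mean_const)
    qed
  qed
  also have "ennreal c * (\<integral>\<^sup>+z. indicator A z \<partial>power_measure ?n) = (\<integral>\<^sup>+z. radial_weight t c z * indicator A z \<partial>lborel)"
    by (rule nn_integral_radial_weight) measurable
  also have "\<dots> = emeasure (density lborel (radial_weight t c)) A"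
    by (rule emeasure_density[symmetric]) auto
  finally show "emeasure (distr (lborel_vec ?n) lborel (lp_nested t)) A = emeasure (density lborel (radial_weight t c)) A" .
qed simp

text \<open>The forced choice: a density g(f(x)) gives f the density \<open>radial_weight\<close>
  times g, so g must be r divided by \<open>radial_weight\<close>.\<close>

definition nested_dist :: "ltree \<Rightarrow> real \<Rightarrow> (real \<Rightarrow> real) \<Rightarrow> (nat \<Rightarrow> real) measure" where
  "nested_dist t c r = density (lborel_vec (leaf_count t))
     (\<lambda>x. ennreal (r (lp_nested t x)) / radial_weight t c (lp_nested t x))"

text \<open>The factor depending on f leaves the sphere mean as a constant and then cancels against
  the radial weight.\<close>

lemma nn_integral_nested_dist:
  assumes t: "lp_tree t" and c: "polar_const t c" and r: "positive_density r"
    and [measurable]: "G \<in> borel_measurable (borel_vec (leaf_count t))"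
  shows "(\<integral>\<^sup>+x. G x \<partial>nested_dist t c r) =
    (\<integral>\<^sup>+z. sphere_mean t (\<lambda>x. G (restrict x {..<leaf_count t})) z \<partial>density_dist r)"
proof -
  let ?n = "leaf_count t"
  let ?G = "\<lambda>x. G (restrict x {..<?n})"
  let ?H = "\<lambda>z. ennreal (r z) / radial_weight t c z"
  have [measurable]: "r \<in> borel_measurable borel" using r by (simp add: positive_density_def)
  have [measurable]: "?G \<in> borel_measurable seq_space" by measurable
  have "(\<integral>\<^sup>+x. G x \<partial>nested_dist t c r) = (\<integral>\<^sup>+x. ?H (lp_nested t x) * G x \<partial>lborel_vec ?n)"
    unfolding nested_dist_def by (rule nn_integral_density) measurable
  also have "\<dots> = ennreal c * (\<integral>\<^sup>+z. sphere_mean t (\<lambda>x. ?H (lp_nested t (restrict x {..<?n})) * ?G x) z \<partial>power_measure ?n)"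
    using c unfolding polar_const_def by simp
  also have "(\<integral>\<^sup>+z. sphere_mean t (\<lambda>x. ?H (lp_nested t (restrict x {..<?n})) * ?G x) z \<partial>power_measure ?n)
    = (\<integral>\<^sup>+z. ?H z * sphere_mean t ?G z \<partial>power_measure ?n)"
  proof (rule nn_integral_cong_AE)
    show "AE z in power_measure ?n. sphere_mean t (\<lambda>x. ?H (lp_nested t (restrict x {..<?n})) * ?G x) z = ?H z * sphere_mean t ?G z"
      using AE_power_measure
    proof eventually_elim
      case (elim z)
      have "sphere_mean t (\<lambda>x. ?H (lp_nested t (restrict x {..<?n})) * ?G x) z = sphere_mean t (\<lambda>x. ?H z * ?G x) z"
        by (rule sphere_mean_cong[OF t elim]) (simp add: lp_nested_restrict)
      then show ?case by (simp add: sphere_mean_cmult)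
    qed
  qed
  also have "ennreal c * (\<integral>\<^sup>+z. ?H z * sphere_mean t ?G z \<partial>power_measure ?n)
    = (\<integral>\<^sup>+z. radial_weight t c z * (?H z * sphere_mean t ?G z) \<partial>lborel)"
    by (rule nn_integral_radial_weight) measurable
  also have "\<dots> = (\<integral>\<^sup>+z. ennreal (r z) * sphere_mean t ?G z \<partial>lborel)"
  proof (rule nn_integral_cong)
    fix z
    show "radial_weight t c z * (?H z * sphere_mean t ?G z) = ennreal (r z) * sphere_mean t ?G z"
    proof (cases "0 < z")
      case True
      have "radial_weight t c z * ?H z = ennreal (r z)"
        using radial_weight_pos[of c z t] True c mult_divide_eq_ennreal[of "radial_weight t c z" "ennreal (r z)"]
        by (simp add: polar_const_def ennreal_times_divide mult.commute)
      then show ?thesis by (simp add: mult.assoc[symmetric])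
    next
      \<comment> \<open>Here there is nothing to divide by: the radial weight vanishes, and so does
        r.\<close>
      case False
      then show ?thesis using r by (simp add: radial_weight_def orthant_weight_def positive_density_def)
    qed
  qed
  also have "\<dots> = (\<integral>\<^sup>+z. sphere_mean t ?G z \<partial>density_dist r)"
    unfolding density_dist_def by (rule nn_integral_density[symmetric]) measurable
  finally show ?thesis .
qed

lemma prob_space_density_dist: "positive_density r \<Longrightarrow> prob_space (density_dist r)"
  unfolding density_dist_def positive_density_def
  by (intro prob_spaceI) (simp add: emeasure_density)

lemma AE_density_dist:
  assumes "positive_density r" shows "AE z in density_dist r. 0 < z"
proof -
  have [measurable]: "r \<in> borel_measurable borel" using assms by (simp add: positive_density_def)
  show ?thesis
    unfolding density_dist_def
  proof (subst AE_density)
    show "AE z in lborel. 0 < ennreal (r z) \<longrightarrow> 0 < z"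
      using assms by (intro AE_I2) (auto simp: positive_density_def not_le[symmetric])
  qed measurable
qed

lemma lp_nested_symmetric_nested_dist:
  assumes t: "lp_tree t" and c: "polar_const t c" and r: "positive_density r"
  shows "lp_nested_symmetric t (nested_dist t c r)" "radial_density t (nested_dist t c r) r"
proof -
  let ?n = "leaf_count t" and ?P = "nested_dist t c r"
  interpret R: prob_space "density_dist r" by (rule prob_space_density_dist[OF r])
  have [measurable]: "r \<in> borel_measurable borel" using r by (simp add: positive_density_def)
  have sets [simp, measurable_cong]: "sets ?P = sets (borel_vec ?n)" by (simp add: nested_dist_def)
  have "emeasure ?P (space ?P) = (\<integral>\<^sup>+x. 1 \<partial>?P)" by simp
  also have "\<dots> = 1"
    using nn_integral_nested_dist[OF t c r, of "\<lambda>_. 1"] R.emeasure_space_1 by (simp add: sphere_mean_const)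
  finally have "prob_space ?P" by (rule prob_spaceI)
  then show "lp_nested_symmetric t ?P"
    unfolding lp_nested_symmetric_def
    by (intro conjI bexI[of _ "\<lambda>x. ennreal (r (lp_nested t x)) / radial_weight t c (lp_nested t x)"])
      (auto simp: nested_dist_def)
  have "distr ?P lborel (lp_nested t) = density_dist r"
  proof (rule measure_eqI)
    fix A assume "A \<in> sets (distr ?P lborel (lp_nested t))"
    then have [measurable]: "A \<in> sets borel" by simp
    have "emeasure (distr ?P lborel (lp_nested t)) A = (\<integral>\<^sup>+x. indicator A x \<partial>distr ?P lborel (lp_nested t))"
      by simp
    also have "\<dots> = (\<integral>\<^sup>+x. indicator A (lp_nested t x) \<partial>?P)"
      by (rule nn_integral_distr) measurable
    also have "\<dots> = (\<integral>\<^sup>+z. sphere_mean t (\<lambda>x. indicator A (lp_nested t (restrict x {..<?n}))) z \<partial>density_dist r)"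
      by (rule nn_integral_nested_dist[OF t c r]) measurable
    also have "\<dots> = (\<integral>\<^sup>+z. indicator A z \<partial>density_dist r)"
    proof (rule nn_integral_cong_AE)
      show "AE z in density_dist r. sphere_mean t (\<lambda>x. indicator A (lp_nested t (restrict x {..<?n}))) z = indicator A z"
        using AE_density_dist[OF r]
      proof eventually_elim
        case (elim z)
        have "sphere_mean t (\<lambda>x. indicator A (lp_nested t (restrict x {..<?n}))) z = sphere_mean t (\<lambda>_. indicator A z) z"
          by (rule sphere_mean_cong[OF t elim]) (simp add: lp_nested_restrict)
        then show ?case by (simp add: sphere_mean_const)
      qed
    qed
    also have "\<dots> = emeasure (density_dist r) A"
      by (simp add: density_dist_def)
    finally show "emeasure (distr ?P lborel (lp_nested t)) A = emeasure (density_dist r) A" .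
  qed (simp add: density_dist_def)
  then show "radial_density t ?P r"
    unfolding radial_density_def distributed_def by (simp add: density_dist_def)
qed

text \<open>The density of M factors through f, and both the symmetric form and the radial density
  give a Lebesgue density of f under M. Uniqueness of densities on the line determines the profile
  almost everywhere, and the law of f under Lebesgue measure carries this back to the vector
  space.\<close>

lemma nested_dist_unique:
  assumes t: "lp_tree t" and c: "polar_const t c" and r: "positive_density r"
    and M: "lp_nested_symmetric t M" "radial_density t M r"
  shows "M = nested_dist t c r"
proof -
  let ?n = "leaf_count t" and ?f = "lp_nested t" and ?q = "radial_weight t c"
  have [measurable]: "r \<in> borel_measurable borel" using r by (simp add: positive_density_def)
  from M(1) obtain h where h [measurable]: "h \<in> borel_measurable (lborel_vec ?n)"
    and sym: "\<And>x y. x \<in> space (lborel_vec ?n) \<Longrightarrow> y \<in> space (lborel_vec ?n) \<Longrightarrow> ?f x = ?f y \<Longrightarrow> h x = h y"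
    and M_eq: "M = density (lborel_vec ?n) h"
    unfolding lp_nested_symmetric_def by blast
  \<comment> \<open>A measurable curve with f(ray z) = |z|. Composing the density with it yields a
    measurable profile, which constancy on level sets alone does not provide.\<close>
  define ray where "ray z = restrict (\<lambda>_. z * (1 / ?f (\<lambda>_. 1))) {..<?n}" for z
  have ray_space: "ray z \<in> space (lborel_vec ?n)" for z by (simp add: ray_def space_PiM)
  have ray_f: "?f (ray z) = \<bar>z\<bar>" for z
  proof -
    have "0 < ?f (\<lambda>_. 1)" by (rule lp_nested_pos[OF t]) simp
    then show ?thesis
      unfolding ray_def lp_nested_restrict
      using lp_nested_scale[OF t, of "z * (1 / ?f (\<lambda>_. 1))" "\<lambda>_. 1"] by (simp add: abs_mult)
  qed
  have [measurable]: "ray \<in> borel \<rightarrow>\<^sub>M lborel_vec ?n"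
    unfolding ray_def[abs_def] by (rule measurable_restrict) simp
  define g where "g z = h (ray z)" for z
  have [measurable]: "g \<in> borel_measurable borel" unfolding g_def[abs_def] by measurable
  have h_eq: "h x = g (?f x)" if "x \<in> space (lborel_vec ?n)" for x
    unfolding g_def using that ray_space by (rule sym) (simp add: ray_f lp_nested_nonneg)
  have M_eq': "M = density (lborel_vec ?n) (\<lambda>x. g (?f x))"
    unfolding M_eq by (rule density_cong) (auto simp: h_eq)
  have f [measurable]: "?f \<in> lborel_vec ?n \<rightarrow>\<^sub>M lborel" by measurable
  have "density lborel (\<lambda>z. ?q z * g z) = density (distr (lborel_vec ?n) lborel ?f) g"
    unfolding distr_lp_nested_lborel[OF t c] by (rule density_density_eq[symmetric]) auto
  also have "\<dots> = distr M lborel ?f"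
    unfolding M_eq' by (rule density_distr) auto
  also have "\<dots> = density lborel (\<lambda>z. ennreal (r z))"
    using M(2) unfolding radial_density_def distributed_def by simp
  finally have "AE z in lborel. ?q z * g z = ennreal (r z)"
    by (subst (asm) sigma_finite_measure.density_unique_iff[OF lborel.sigma_finite_measure_axioms]) auto
  \<comment> \<open>Only points of positive radial weight count here, and there the weight is finite
    and can be divided out.\<close>
  then have "AE z in density lborel ?q. g z = ennreal (r z) / ?q z"
  proof (subst AE_density, measurable, eventually_elim, intro impI)
    fix z assume eq: "?q z * g z = ennreal (r z)" and q: "0 < ?q z"
    then have "0 < z" by (auto simp: radial_weight_def orthant_weight_def split: split_indicator_asm)
    with c show "g z = ennreal (r z) / ?q z"
      using mult_divide_eq_ennreal[of "?q z" "g z"] radial_weight_pos[of c z t]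
      by (simp add: eq[symmetric] mult.commute polar_const_def)
  qed
  \<comment> \<open>The measure with density \<open>?q\<close> is the image of Lebesgue measure
    under f, so null sets of radii pull back to null sets of vectors.\<close>
  then have "AE x in lborel_vec ?n. g (?f x) = ennreal (r (?f x)) / ?q (?f x)"
    unfolding distr_lp_nested_lborel[OF t c, symmetric] by (subst (asm) AE_distr_iff) auto
  then show ?thesis
    unfolding M_eq' nested_dist_def by (intro density_cong) auto
qed

section \<open>Semantics of the sampling program\<close>

text \<open>The program makes no draw: it returns one value after finitely many steps. Such stages
  vanish from the output law, and their cost simply adds to that of the continuation at this
  value.\<close>

definition runs_to :: "'a prog \<Rightarrow> 'a \<Rightarrow> bool" where
  "runs_to p a \<longleftrightarrow> (\<exists>k. p = (Step ^^ k) (Return a))"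

lemma bind_prog_assoc: "bind_prog (bind_prog p f) g = bind_prog p (\<lambda>a. bind_prog (f a) g)"
  by (induction p) auto

lemma bind_prog_steps: "bind_prog ((Step ^^ k) (Return a)) c = (Step ^^ k) (c a)"
  by (induction k) auto

lemma output_dist_steps: "output_dist N ((Step ^^ k) p) = output_dist N p"
  by (induction k) auto

lemma worst_cost_steps: "worst_cost ((Step ^^ k) p) = enat k + worst_cost p"
proof (induction k)
  case (Suc k)
  have "enat (Suc k) = 1 + enat k" by (simp add: one_enat_def)
  then show ?case using Suc by (simp add: add.assoc)
qed (simp add: zero_enat_def[symmetric])

lemma runs_to_return: "runs_to (Return a) a"
  unfolding runs_to_def by (rule exI[of _ 0]) simp

lemma runs_to_compute: "runs_to (compute a) a"
  unfolding runs_to_def compute_def by (rule exI[of _ 1]) simp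

lemma runs_to_bind:
  assumes "runs_to p a" "runs_to (c a) b" shows "runs_to (bind_prog p c) b"
proof -
  obtain k l where "p = (Step ^^ k) (Return a)" "c a = (Step ^^ l) (Return b)"
    using assms by (auto simp: runs_to_def)
  then have "bind_prog p c = (Step ^^ (k + l)) (Return b)"
    by (simp add: bind_prog_steps funpow_add)
  then show ?thesis by (auto simp: runs_to_def)
qed

lemma output_dist_runs_to: "runs_to p a \<Longrightarrow> output_dist N (bind_prog p c) = output_dist N (c a)"
  by (auto simp: runs_to_def bind_prog_steps output_dist_steps)

lemma worst_cost_runs_to: "runs_to p a \<Longrightarrow> worst_cost (bind_prog p c) = worst_cost p + worst_cost (c a)"
  by (auto simp: runs_to_def bind_prog_steps worst_cost_steps zero_enat_def[symmetric])

lemma runs_to_foreach: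
  "(\<And>i s. i \<in> set xs \<Longrightarrow> runs_to (b i s) (f i s)) \<Longrightarrow> runs_to (foreach xs s b) (fold f xs s)"
proof (induction xs arbitrary: s)
  case (Cons i xs)
  have "runs_to (bind_prog (b i s) (\<lambda>s. foreach xs s b)) (fold f xs (f i s))"
    by (rule runs_to_bind) (use Cons in auto)
  then obtain k where "bind_prog (b i s) (\<lambda>s. foreach xs s b) = (Step ^^ k) (Return (fold f xs (f i s)))"
    by (auto simp: runs_to_def)
  then show ?case unfolding runs_to_def by (intro exI[of _ "Suc k"]) simp
qed (simp add: runs_to_return)

lemma fold_tabulate: "fold (\<lambda>k a. a(k := g k)) [0..<l] a = (\<lambda>k. if k < l then g k else a k)"
  by (induction l) (auto simp: fun_eq_iff less_Suc_eq)

lemma fold_sum: "fold (\<lambda>k c. c + g k) [0..<l] c = c + (\<Sum>k<l. g k :: 'a :: comm_monoid_add)"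
  by (induction l) (auto simp: add.assoc)

lemma runs_to_tabulate:
  "runs_to (foreach [0..<l] a (\<lambda>k a. compute (a(k := g k)))) (\<lambda>k. if k < l then g k else a k)"
  using runs_to_foreach[of "[0..<l]" "\<lambda>k a. compute (a(k := g k))" "\<lambda>k a. a(k := g k)" a]
  by (simp add: runs_to_compute fold_tabulate)

lemma runs_to_accumulate:
  "runs_to (foreach [0..<l] c (\<lambda>k c. compute (c + g k))) (c + (\<Sum>k<l. g k :: 'a :: comm_monoid_add))"
  using runs_to_foreach[of "[0..<l]" "\<lambda>k c. compute (c + g k)" "\<lambda>k c. c + g k" c]
  by (simp add: runs_to_compute fold_sum)

subsection \<open>Traversals\<close>

text \<open>The property of preorder that bottom-up evaluation needs: in the reversed list every
  child is processed before its parent. Unlike preorder itself it is inherited by suffixes, which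
  suits induction.\<close>

primrec children_later :: "ltree \<Rightarrow> node list \<Rightarrow> bool" where
  "children_later t [] \<longleftrightarrow> True"
| "children_later t (I # L) \<longleftrightarrow>
    (\<forall>k<length (children (subtree t I)). I @ [k] \<in> set L) \<and> children_later t L"

lemma children_later_append:
  "children_later (children t ! k) L \<Longrightarrow> children_later t L' \<Longrightarrow> children_later t (map ((#) k) L @ L')"
  by (induction L) auto

lemma root_in_nodes: "[] \<in> set (nodes t)"
  by (cases t) auto

lemma children_later_nodes: "children_later t (nodes t)"
proof (induction t rule: nodes.induct)
  case (2 p ts)
  have "children_later (Node p ts) (subtree_nodes nodes ts ks)" if "set ks \<subseteq> {..<length ts}" for ks
    using that 2 by (induction ks) (auto simp del: nodes.simps intro!: children_later_append)
  from this[of "[0..<length ts]"] show ?case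
    by (auto simp: nodes_Node set_subtree_nodes root_in_nodes atLeast0LessThan simp del: nodes.simps)
qed simp

text \<open>Folding over the reversed list is a right fold over the list, so the suffix after a node
  has already been evaluated when the node is reached. Its children lie in that suffix.\<close>

lemma fold_bottom_up:
  assumes g: "\<And>I F. I \<in> set (nodes t) \<Longrightarrow>
      (\<And>k. k < length (children (subtree t I)) \<Longrightarrow> F (I @ [k]) = val (I @ [k])) \<Longrightarrow> g I F = val I"
    and "I \<in> set (nodes t)"
  shows "fold (\<lambda>I F. F(I := g I F)) (rev (nodes t)) F0 I = val I"
proof -
  have "\<forall>I\<in>set L. foldr (\<lambda>I F. F(I := g I F)) L F0 I = val I"
    if "children_later t L" "set L \<subseteq> set (nodes t)" for L
    using that
  proof (induction L)
    case (Cons J L)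
    define F where "F = foldr (\<lambda>I F. F(I := g I F)) L F0"
    have F: "\<forall>I\<in>set L. F I = val I" unfolding F_def by (rule Cons.IH) (use Cons.prems in auto)
    have "g J F = val J" by (rule g) (use Cons.prems F in auto)
    moreover have "foldr (\<lambda>I F. F(I := g I F)) (J # L) F0 = F(J := g J F)"
      by (simp add: F_def del: fun_upd_apply)
    ultimately have eq: "foldr (\<lambda>I F. F(I := g I F)) (J # L) F0 = F(J := val J)"
      by (simp only:)
    show ?case unfolding eq using F by simp
  qed simp
  from this[OF children_later_nodes] assms(2) show ?thesis
    by (simp add: foldr_conv_fold)
qed

lemma subtree_append: "subtree t (I @ J) = subtree (subtree t I) J"
  by (induction t I rule: subtree.induct) auto

lemma leaf_counts_prog_runs_to:
  "\<exists>m. runs_to (leaf_counts_prog t) m \<and> (\<forall>I\<in>set (nodes t). m I = leaf_count (subtree t I))"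
proof (intro exI conjI ballI)
  let ?g = "\<lambda>I m. if is_leaf (subtree t I) then 1 else \<Sum>k<length (children (subtree t I)). m (I @ [k]) :: nat"
  show "runs_to (leaf_counts_prog t) (fold (\<lambda>I m. m(I := ?g I m)) (rev (nodes t)) (\<lambda>_. 0))"
    unfolding leaf_counts_prog_def
  proof (rule runs_to_foreach)
    fix I and m :: "node \<Rightarrow> nat"
    have "runs_to (foreach (child_indices t I) 0 (\<lambda>k c. compute (c + m (I @ [k])))) (\<Sum>k<length (children (subtree t I)). m (I @ [k]))"
      using runs_to_accumulate[of "length (children (subtree t I))" 0 "\<lambda>k. m (I @ [k])"] by (simp add: child_indices_def)
    then have "runs_to (do {
         c \<leftarrow> foreach (child_indices t I) 0 (\<lambda>k c. compute (c + m (I @ [k])));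
         compute (m(I := c))
       }) (m(I := \<Sum>k<length (children (subtree t I)). m (I @ [k])))"
      by (rule runs_to_bind) (rule runs_to_compute)
    then show "runs_to (if is_leaf (subtree t I) then compute (m(I := 1))
       else do {
         c \<leftarrow> foreach (child_indices t I) 0 (\<lambda>k c. compute (c + m (I @ [k])));
         compute (m(I := c))
       }) (m(I := ?g I m))"
      by (simp add: runs_to_compute)
  qed
  fix I assume I: "I \<in> set (nodes t)"
  show "fold (\<lambda>I m. m(I := ?g I m)) (rev (nodes t)) (\<lambda>_. 0) I = leaf_count (subtree t I)"
  proof (rule fold_bottom_up[OF _ I, where val = "\<lambda>I. leaf_count (subtree t I)"])
    fix I and m :: "node \<Rightarrow> nat"
    assume "\<And>k. k < length (children (subtree t I)) \<Longrightarrow> m (I @ [k]) = leaf_count (subtree t (I @ [k]))"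
    then show "?g I m = leaf_count (subtree t I)"
      by (cases "subtree t I") (simp_all add: is_leaf_def subtree_append leaf_count_Node del: leaf_count.simps(2))
  qed
qed

lemma eval_nested_runs_to: "runs_to (eval_nested t v) (lp_nested t (\<lambda>i. v (leaf_nodes t ! i)))"
proof -
  let ?g = "\<lambda>I F. if is_leaf (subtree t I) then \<bar>v I\<bar>
    else (\<Sum>k<length (children (subtree t I)). F (I @ [k]) powr node_exponent t I) powr (1 / node_exponent t I)"
  let ?F = "fold (\<lambda>I F. F(I := ?g I F)) (rev (nodes t)) (\<lambda>_. 0)"
  let ?loop = "foreach (rev (nodes t)) (\<lambda>_. 0) (\<lambda>I F.
       if is_leaf (subtree t I) then compute (F(I := \<bar>v I\<bar>))
       else do {
         c \<leftarrow> foreach (child_indices t I) 0 (\<lambda>k c. compute (c + F (I @ [k]) powr node_exponent t I));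
         compute (F(I := c powr (1 / node_exponent t I)))
       })"
  have "runs_to ?loop ?F"
  proof (rule runs_to_foreach)
    fix I and F :: "node \<Rightarrow> real"
    have "runs_to (foreach (child_indices t I) 0 (\<lambda>k c. compute (c + F (I @ [k]) powr node_exponent t I)))
      (\<Sum>k<length (children (subtree t I)). F (I @ [k]) powr node_exponent t I)"
      using runs_to_accumulate[of "length (children (subtree t I))" 0 "\<lambda>k. F (I @ [k]) powr node_exponent t I"]
      by (simp add: child_indices_def)
    then have "runs_to (do {
         c \<leftarrow> foreach (child_indices t I) 0 (\<lambda>k c. compute (c + F (I @ [k]) powr node_exponent t I));
         compute (F(I := c powr (1 / node_exponent t I)))
       }) (F(I := (\<Sum>k<length (children (subtree t I)). F (I @ [k]) powr node_exponent t I) powr (1 / node_exponent t I)))"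
      by (rule runs_to_bind) (rule runs_to_compute)
    then show "runs_to (if is_leaf (subtree t I) then compute (F(I := \<bar>v I\<bar>))
       else do {
         c \<leftarrow> foreach (child_indices t I) 0 (\<lambda>k c. compute (c + F (I @ [k]) powr node_exponent t I));
         compute (F(I := c powr (1 / node_exponent t I)))
       }) (F(I := ?g I F))"
      by (simp add: runs_to_compute)
  qed
  moreover have "?F [] = lp_nested t (\<lambda>i. v (leaf_nodes t ! i))"
  proof -
    \<comment> \<open>The intended content of the array: f_I at the entries of the leaves below I,
      whose addresses are those of the subtree prefixed by I.\<close>
    let ?val = "\<lambda>I. lp_nested (subtree t I) (\<lambda>i. v (I @ leaf_nodes (subtree t I) ! i))"
    have "?F [] = ?val []"
    proof (rule fold_bottom_up[OF _ root_in_nodes, where val = ?val])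
      fix I and F :: "node \<Rightarrow> real"
      assume F: "\<And>k. k < length (children (subtree t I)) \<Longrightarrow> F (I @ [k]) = ?val (I @ [k])"
      show "?g I F = ?val I"
      proof (cases "subtree t I")
        case Leaf
        then show ?thesis by (simp add: is_leaf_def)
      next
        case (Node p ts)
        let ?o = "\<lambda>k. \<Sum>j<k. leaf_count (ts ! j)"
        have "F (I @ [k]) = lp_nested (ts ! k) (\<lambda>i. v (I @ leaf_nodes (Node p ts) ! (?o k + i)))" if "k < length ts" for k
        proof -
          have "F (I @ [k]) = lp_nested (ts ! k) (\<lambda>i. v (I @ k # leaf_nodes (ts ! k) ! i))"
            using F[of k] that by (simp add: subtree_append Node)
          also have "\<dots> = lp_nested (ts ! k) (\<lambda>i. v (I @ leaf_nodes (Node p ts) ! (?o k + i)))"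
            using that by (intro lp_nested_cong_abs) (simp add: nth_subtree_nodes)
          finally show ?thesis .
        qed
        then show ?thesis by (simp add: Node is_leaf_def node_exponent_def del: leaf_nodes_Node)
      qed
    qed
    then show ?thesis by simp
  qed
  ultimately show ?thesis
    unfolding eval_nested_def using runs_to_compute[of "?F []"] by (auto intro: runs_to_bind)
qed

lemma fold_enumerate:
  "fold (\<lambda>(i, I) y. y(i := g I)) (List.enumerate n L) y =
    (\<lambda>i. if n \<le> i \<and> i < n + length L then g (L ! (i - n)) else y i)"
proof (induction L arbitrary: n y)
  case (Cons I L)
  have "fold (\<lambda>(i, I) y. y(i := g I)) (List.enumerate n (I # L)) y
    = fold (\<lambda>(i, I) y. y(i := g I)) (List.enumerate (Suc n) L) (y(n := g I))"
    by (simp del: fun_upd_apply)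
  also have "\<dots> = (\<lambda>i. if Suc n \<le> i \<and> i < Suc n + length L then g (L ! (i - Suc n)) else (y(n := g I)) i)"
    by (rule Cons.IH)
  also have "\<dots> = (\<lambda>i. if n \<le> i \<and> i < n + length (I # L) then g ((I # L) ! (i - n)) else y i)"
    by (auto simp: fun_eq_iff nth_Cons')
  finally show ?case .
qed (auto simp: fun_eq_iff)

lemma step4_runs_to:
  "runs_to (step4 t v) (\<lambda>i. if i < leaf_count t
    then v (leaf_nodes t ! i) / lp_nested t (\<lambda>i. v (leaf_nodes t ! i)) else undefined)"
  unfolding step4_def
proof (rule runs_to_bind[OF eval_nested_runs_to])
  let ?c = "lp_nested t (\<lambda>i. v (leaf_nodes t ! i))"
  have "runs_to (foreach (List.enumerate 0 (leaf_nodes t)) (\<lambda>_. undefined) (\<lambda>(i, I) u. compute (u(i := v I / ?c))))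
    (fold (\<lambda>(i, I) u. u(i := v I / ?c)) (List.enumerate 0 (leaf_nodes t)) (\<lambda>_. undefined))"
    by (rule runs_to_foreach) (auto simp: runs_to_compute)
  then show "runs_to (foreach (List.enumerate 0 (leaf_nodes t)) (\<lambda>_. undefined) (\<lambda>(i, I) u. compute (u(i := v I / ?c))))
    (\<lambda>i. if i < leaf_count t then v (leaf_nodes t ! i) / ?c else undefined)"
    by (simp add: fold_enumerate cong: if_cong)
qed

text \<open>The counterpart for top-down passes: \<open>S\<close> contains the nodes whose values
  have been written, and each processed node adds its children.\<close>

primrec parents_ready :: "ltree \<Rightarrow> node set \<Rightarrow> node list \<Rightarrow> bool" where
  "parents_ready t S [] \<longleftrightarrow> True"
| "parents_ready t S (I # L) \<longleftrightarrow> I \<in> S \<and>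
    parents_ready t (S \<union> {I @ [k] |k. k < length (children (subtree t I))}) L"

lemma parents_ready_mono: "parents_ready t S L \<Longrightarrow> S \<subseteq> S' \<Longrightarrow> parents_ready t S' L"
proof (induction L arbitrary: S S')
  case (Cons I L)
  show ?case
    using Cons.prems by (auto intro!: Cons.IH[of "S \<union> {I @ [k] |k. k < length (children (subtree t I))}"])
qed simp

lemma parents_ready_child:
  "parents_ready (children t ! k) S L \<Longrightarrow> (#) k ` S \<subseteq> S' \<Longrightarrow> parents_ready t S' L' \<Longrightarrow>
    parents_ready t S' (map ((#) k) L @ L')"
proof (induction L arbitrary: S S')
  case (Cons I L)
  let ?C = "{I @ [j] |j. j < length (children (subtree (children t ! k) I))}"
  have "parents_ready t (S' \<union> (#) k ` ?C) (map ((#) k) L @ L')"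
    by (rule Cons.IH[of "S \<union> ?C"]) (use Cons.prems in \<open>auto intro: parents_ready_mono\<close>)
  moreover have "(#) k ` ?C = {(k # I) @ [j] |j. j < length (children (subtree t (k # I)))}" by auto
  ultimately show ?case using Cons.prems by auto
qed simp

lemma parents_ready_inner_nodes: "parents_ready t {[]} (inner_nodes t)"
proof (induction t rule: nodes.induct)
  case (2 p ts)
  have "parents_ready (Node p ts) ({[]} \<union> {[] @ [k] |k. k < length ts}) (subtree_nodes inner_nodes ts ks)"
    if "set ks \<subseteq> {..<length ts}" for ks
    using that
  proof (induction ks)
    case (Cons k ks)
    show ?case unfolding subtree_nodes_Cons
      by (rule parents_ready_child[of _ _ "{[]}"]) (use Cons 2 in auto)
  qed simp
  from this[of "[0..<length ts]"] show ?case by (auto simp: atLeast0LessThan)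
qed simp

lemma path_prod_snoc: "path_prod u (I @ [k]) = path_prod u I * u I k"
  by (induction I arbitrary: u) auto

text \<open>The factor \<open>v I\<close> is the same in all iterations, since the loop writes only
  at proper extensions of I.\<close>

lemma fold_children:
  "fold (\<lambda>k v. v(I @ [k] := v I * w k)) [0..<l] v J =
    (if \<exists>k<l. J = I @ [k] then v I * w (last J) else v J)"
  by (induction l arbitrary: J) (auto simp: less_Suc_eq)

text \<open>Invariant: every written entry is \<open>c\<close> times the path product of its
  address. A node in \<open>S\<close> has its final value when its children are computed from
  it.\<close>

lemma fold_top_down:
  assumes "parents_ready t S L" "\<And>J. J \<in> S \<Longrightarrow> v J = c * path_prod u J"
    and "J \<in> S \<union> {I @ [k] |I k. I \<in> set L \<and> k < length (children (subtree t I))}"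
  shows "fold (\<lambda>I v. fold (\<lambda>k v. v(I @ [k] := v I * u I k)) [0..<length (children (subtree t I))] v) L v J
    = c * path_prod u J"
  using assms
proof (induction L arbitrary: S v)
  case (Cons I L)
  let ?v = "fold (\<lambda>k v. v(I @ [k] := v I * u I k)) [0..<length (children (subtree t I))] v"
  let ?S = "S \<union> {I @ [k] |k. k < length (children (subtree t I))}"
  have "?v J = c * path_prod u J" if "J \<in> ?S" for J
    using that Cons.prems(1,2) by (auto simp: fold_children path_prod_snoc mult.assoc)
  then have "fold (\<lambda>I v. fold (\<lambda>k v. v(I @ [k] := v I * u I k)) [0..<length (children (subtree t I))] v) L ?v J
    = c * path_prod u J"
    using Cons.prems by (intro Cons.IH[of ?S]) auto
  then show ?case by (simp del: fun_upd_apply)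
qed simp

lemma leaf_node_parent:
  "J \<in> set (leaf_nodes t) \<Longrightarrow> J = [] \<or> (\<exists>I k. J = I @ [k] \<and> I \<in> set (inner_nodes t) \<and> k < length (children (subtree t I)))"
proof (induction t arbitrary: J rule: nodes.induct)
  case (2 p ts)
  then obtain k J' where J: "J = k # J'" "k < length ts" "J' \<in> set (leaf_nodes (ts ! k))"
    by (auto simp: set_subtree_nodes)
  have "J' = [] \<or> (\<exists>I j. J' = I @ [j] \<and> I \<in> set (inner_nodes (ts ! k)) \<and> j < length (children (subtree (ts ! k) I)))"
    by (rule "2.IH") (use J in auto)
  then show ?case
  proof (elim disjE exE conjE)
    assume "J' = []"
    then show ?thesis using J by (intro disjI2 exI[of _ "[]"] exI[of _ k]) simp
  next
    fix I j assume "J' = I @ [j]" "I \<in> set (inner_nodes (ts ! k))" "j < length (children (subtree (ts ! k) I))"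
    then show ?thesis using J by (intro disjI2 exI[of _ "k # I"] exI[of _ j]) (simp add: set_subtree_nodes)
  qed
qed simp

lemma step3_runs_to:
  "\<exists>v. runs_to (step3 t c u) v \<and> (\<forall>J\<in>set (leaf_nodes t). v J = c * path_prod u J)"
proof (intro exI conjI ballI)
  let ?f = "\<lambda>I v. fold (\<lambda>k v. v(I @ [k] := v I * u I k)) [0..<length (children (subtree t I))] v"
  show "runs_to (step3 t c u) (fold ?f (inner_nodes t) ((\<lambda>_. 0)([] := c)))"
    unfolding step3_def child_indices_def by (intro runs_to_foreach runs_to_compute)
  fix J assume "J \<in> set (leaf_nodes t)"
  from leaf_node_parent[OF this] show "fold ?f (inner_nodes t) ((\<lambda>_. 0)([] := c)) J = c * path_prod u J"
    by (intro fold_top_down[OF parents_ready_inner_nodes]) auto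
qed

section \<open>The law of the output\<close>

text \<open>Makes the law independent of the filler values that a parameter array holds beyond its
  length.\<close>

lemma dirichlet_dist_cong:
  assumes "\<And>i. i < k \<Longrightarrow> a i = b i" shows "dirichlet_dist k a = dirichlet_dist k b"
proof -
  have "(\<Sum>i<k. a i) = (\<Sum>i<k. b i)" "(\<Prod>i<k. Gamma (a i)) = (\<Prod>i<k. Gamma (b i))"
    using assms by (auto intro!: sum.cong prod.cong)
  moreover have "(\<Prod>i<k. s i powr (a i - 1)) = (\<Prod>i<k. s i powr (b i - 1))" for s
    using assms by (auto intro!: prod.cong)
  ultimately have "dirichlet_density k a s = dirichlet_density k b s" for s
    unfolding dirichlet_density_def by (simp only:)
  then show ?thesis by (simp add: dirichlet_dist_def)
qed

section \<open>The Dirichlet draws as iterated integrals\<close>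

abbreviation child_count :: "ltree \<Rightarrow> node \<Rightarrow> nat" where
  "child_count t I \<equiv> length (children (subtree t I))"

text \<open>The parameters are padded with 0 exactly as in the array filled by the second
  step.\<close>

definition node_dirichlet :: "ltree \<Rightarrow> node \<Rightarrow> (nat \<Rightarrow> real) measure" where
  "node_dirichlet t I = dirichlet_dist (child_count t I)
     (\<lambda>k. if k < child_count t I then real (leaf_count (children (subtree t I) ! k)) / node_exponent t I else 0)"

definition node_powr :: "ltree \<Rightarrow> node \<Rightarrow> (nat \<Rightarrow> real) \<Rightarrow> nat \<Rightarrow> real" where
  "node_powr t I s k = (if k < child_count t I then s k powr (1 / node_exponent t I) else 0)"

lemma node_powr_measurable [measurable]: "node_powr t I \<in> borel_vec (child_count t I) \<rightarrow>\<^sub>M seq_space"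
  unfolding node_powr_def[abs_def] by measurable

lemma sets_node_dirichlet [simp, measurable_cong]: "sets (node_dirichlet t I) = sets (borel_vec (child_count t I))"
  by (simp add: node_dirichlet_def)

lemma prob_space_node_dirichlet:
  assumes "lp_tree t" "I \<in> set (inner_nodes t)"
  shows "prob_space (node_dirichlet t I)"
proof -
  have "lp_tree (subtree t I)" "\<not> is_leaf (subtree t I)" using inner_nodes_subtree[OF assms] by auto
  then show ?thesis
  proof (rule lp_tree_cases)
    fix p ts m
    assume "subtree t I = Node p ts" "0 < p" "length ts = Suc m" "\<And>k. k < Suc m \<Longrightarrow> 0 < leaf_count (ts ! k)"
    then show ?thesis
      by (simp add: node_dirichlet_def node_exponent_def prob_space_dirichlet)
  qed
qed

lemma tree_laws_eq_distr:
  assumes "lp_tree t" "I \<in> set (inner_nodes t)"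
  shows "tree_laws t I = distr (node_dirichlet t I) seq_space (node_powr t I)"
proof -
  have D: "dirichlet_dist (child_count t I) (\<lambda>k. real (leaf_count (children (subtree t I) ! k)) / exponent (subtree t I))
    = node_dirichlet t I"
    unfolding node_dirichlet_def node_exponent_def by (rule dirichlet_dist_cong) simp
  have P: "(\<lambda>s i. if i < child_count t I then s i powr (1 / exponent (subtree t I)) else 0) = node_powr t I"
    by (simp add: fun_eq_iff node_powr_def node_exponent_def)
  show ?thesis
    using inner_nodes_subtree[OF assms] by (simp add: tree_laws_def node_law_def radial_law_def D P)
qed

text \<open>The second step with the rest of the program abstracted into a continuation
  \<open>K\<close>, which receives the final table of directions.\<close>

primrec dirichlet_chain ::
  "ltree \<Rightarrow> ((node \<Rightarrow> nat \<Rightarrow> real) \<Rightarrow> 'a measure) \<Rightarrow> node list \<Rightarrow> (node \<Rightarrow> nat \<Rightarrow> real) \<Rightarrow> 'a measure" where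
  "dirichlet_chain t K [] u = K u"
| "dirichlet_chain t K (I # L) u =
    Giry_Monad.bind (node_dirichlet t I) (\<lambda>s. dirichlet_chain t K L (u(I := node_powr t I s)))"

text \<open>Joint measurability in the state is needed at each node, since the continuation of a
  draw must be a measurable kernel. The extra parameter will be the beta variable of the first
  step.\<close>

lemma dirichlet_chain_measurable:
  assumes t: "lp_tree t" and K: "(\<lambda>p. K (fst p) (snd p)) \<in> A \<Otimes>\<^sub>M node_space \<rightarrow>\<^sub>M subprob_algebra N"
    and "set L \<subseteq> set (inner_nodes t)"
  shows "(\<lambda>p. dirichlet_chain t (K (fst p)) L (snd p)) \<in> A \<Otimes>\<^sub>M node_space \<rightarrow>\<^sub>M subprob_algebra N"
  using assms(3)
proof (induction L)
  case Nil
  then show ?case using K by simp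
next
  case (Cons I L)
  let ?B = "borel_vec (child_count t I)"
  have D: "node_dirichlet t I \<in> space (subprob_algebra ?B)"
    using prob_space_node_dirichlet[OF t, of I] Cons.prems
    by (simp add: space_subprob_algebra prob_space_imp_subprob_space)
  have "(\<lambda>q. (snd (fst q))(I := node_powr t I (snd q))) \<in> (A \<Otimes>\<^sub>M node_space) \<Otimes>\<^sub>M ?B \<rightarrow>\<^sub>M node_space"
    by (rule measurable_fun_upd[where J = UNIV]) auto
  then have "(\<lambda>q. (fst (fst q), (snd (fst q))(I := node_powr t I (snd q)))) \<in> (A \<Otimes>\<^sub>M node_space) \<Otimes>\<^sub>M ?B \<rightarrow>\<^sub>M A \<Otimes>\<^sub>M node_space"
    by (intro measurable_Pair measurable_compose[OF measurable_fst measurable_fst])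
  from measurable_compose[OF this Cons.IH] Cons.prems
  have "(\<lambda>q. dirichlet_chain t (K (fst (fst q))) L ((snd (fst q))(I := node_powr t I (snd q))))
      \<in> (A \<Otimes>\<^sub>M node_space) \<Otimes>\<^sub>M ?B \<rightarrow>\<^sub>M subprob_algebra N"
    by (simp del: fun_upd_apply)
  then show ?case
    unfolding dirichlet_chain.simps by (intro measurable_bind[OF measurable_const[OF D]])
qed

text \<open>Each bind unfolds to an integral over a Dirichlet draw, and its image under the
  component-wise root is the law of the node.\<close>

lemma nn_integral_dirichlet_chain:
  assumes t: "lp_tree t" and K: "K \<in> node_space \<rightarrow>\<^sub>M subprob_algebra N"
    and G: "G \<in> borel_measurable N" and "set L \<subseteq> set (inner_nodes t)"
  shows "(\<integral>\<^sup>+x. G x \<partial>dirichlet_chain t K L u) = iterated (tree_laws t) L (\<lambda>u. \<integral>\<^sup>+x. G x \<partial>K u) u"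
  using assms(4)
proof (induction L arbitrary: u)
  case (Cons I L)
  interpret T: iter_measures "tree_laws t" "\<lambda>_. seq_space" by (rule iter_measures_tree_laws)
  let ?F = "\<lambda>u. \<integral>\<^sup>+x. G x \<partial>K u"
  have I: "I \<in> set (inner_nodes t)" using Cons.prems by simp
  have F: "?F \<in> borel_measurable node_space"
    by (rule measurable_compose[OF K nn_integral_measurable_subprob_algebra[OF G]])
  have upd: "(\<lambda>w. u(I := w)) \<in> seq_space \<rightarrow>\<^sub>M node_space"
    by (rule measurable_fun_upd[where J = UNIV]) (auto simp: space_PiM)
  have "(\<lambda>s. dirichlet_chain t K L (u(I := node_powr t I s))) \<in> node_dirichlet t I \<rightarrow>\<^sub>M subprob_algebra N"
  proof -
    have chain: "(\<lambda>p. dirichlet_chain t K L (snd p)) \<in> seq_space \<Otimes>\<^sub>M node_space \<rightarrow>\<^sub>M subprob_algebra N"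
      by (rule dirichlet_chain_measurable[OF t, of "\<lambda>_. K"])
        (use Cons.prems measurable_compose[OF measurable_snd K] in auto)
    have "node_powr t I \<in> node_dirichlet t I \<rightarrow>\<^sub>M seq_space" by measurable
    then have "(\<lambda>s. (node_powr t I s, u(I := node_powr t I s))) \<in> node_dirichlet t I \<rightarrow>\<^sub>M seq_space \<Otimes>\<^sub>M node_space"
      by (intro measurable_Pair measurable_compose[OF _ upd])
    from measurable_compose[OF this chain] show ?thesis by (simp del: fun_upd_apply)
  qed
  then have "(\<integral>\<^sup>+x. G x \<partial>dirichlet_chain t K (I # L) u)
    = (\<integral>\<^sup>+s. (\<integral>\<^sup>+x. G x \<partial>dirichlet_chain t K L (u(I := node_powr t I s))) \<partial>node_dirichlet t I)"
    unfolding dirichlet_chain.simps by (rule nn_integral_bind[OF G])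
  also have "\<dots> = (\<integral>\<^sup>+s. iterated (tree_laws t) L ?F (u(I := node_powr t I s)) \<partial>node_dirichlet t I)"
    using Cons by simp
  also have "\<dots> = (\<integral>\<^sup>+w. iterated (tree_laws t) L ?F (u(I := w)) \<partial>tree_laws t I)"
    unfolding tree_laws_eq_distr[OF t I]
  proof (rule nn_integral_distr[symmetric])
    show "(\<lambda>w. iterated (tree_laws t) L ?F (u(I := w))) \<in> borel_measurable (distr (node_dirichlet t I) seq_space (node_powr t I))"
      using T.iter_measurable[OF measurable_compose[OF measurable_snd F] upd] by simp
  qed simp
  finally show ?case by simp
qed simp

lemma child_in_nodes:
  assumes "I \<in> set (nodes t)" "k < child_count t I" shows "I @ [k] \<in> set (nodes t)"
proof -
  have "children_later t L \<Longrightarrow> I \<in> set L \<Longrightarrow> I @ [k] \<in> set L" for L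
    using assms(2) by (induction L) auto
  then show ?thesis using children_later_nodes assms(1) by blast
qed

lemma output_dist_step2:
  assumes m: "\<And>I. I \<in> set (nodes t) \<Longrightarrow> m I = leaf_count (subtree t I)"
  shows "output_dist N (bind_prog (step2 t m) c) =
    dirichlet_chain t (\<lambda>u. output_dist N (c u)) (inner_nodes t) (\<lambda>_ _. 0)"
proof -
  let ?body = "\<lambda>I u. do {
       a \<leftarrow> foreach (child_indices t I) (\<lambda>_. 0)
              (\<lambda>k a. compute (a(k := real (m (I @ [k])) / node_exponent t I)));
       s \<leftarrow> draw_dirichlet (length (child_indices t I)) a;
       w \<leftarrow> foreach (child_indices t I) (\<lambda>_. 0)
              (\<lambda>k w. compute (w(k := s k powr (1 / node_exponent t I))));
       compute (u(I := w))
     }"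
  have "output_dist N (bind_prog (foreach L u ?body) c) = dirichlet_chain t (\<lambda>u. output_dist N (c u)) L u"
    if "set L \<subseteq> set (inner_nodes t)" for L u
    using that
  proof (induction L arbitrary: u)
    case (Cons I L)
    let ?l = "child_count t I"
    have I: "I \<in> set (nodes t)" using Cons.prems by (auto simp: inner_nodes_def)
    \<comment> \<open>The array of leaf counts is correct at the children, so the drawn law does not
      depend on the other contents of \<open>m\<close>.\<close>
    have a: "(\<lambda>k. if k < ?l then real (m (I @ [k])) / node_exponent t I else 0)
      = (\<lambda>k. if k < ?l then real (leaf_count (children (subtree t I) ! k)) / node_exponent t I else 0)"
      using m[OF child_in_nodes[OF I]] by (auto simp: subtree_append)
    have inner: "output_dist N (bind_prog (foreach [0..<?l] (\<lambda>_. 0) (\<lambda>k w. compute (w(k := s k powr (1 / node_exponent t I)))))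
        (\<lambda>w. bind_prog (compute (u(I := w))) C)) = output_dist N (C (u(I := node_powr t I s)))" for s C
      by (subst output_dist_runs_to[OF runs_to_tabulate]) (simp add: compute_def node_powr_def[abs_def] del: fun_upd_apply)
    have "output_dist N (bind_prog (foreach (I # L) u ?body) c)
      = output_dist N (bind_prog (?body I u) (\<lambda>u. bind_prog (foreach L u ?body) c))"
      by (simp add: bind_prog_assoc)
    also have "\<dots> = Giry_Monad.bind (node_dirichlet t I)
        (\<lambda>s. output_dist N (bind_prog (foreach L (u(I := node_powr t I s)) ?body) c))"
      unfolding bind_prog_assoc child_indices_def node_dirichlet_def a[symmetric]
      by (subst output_dist_runs_to[OF runs_to_tabulate]) (simp add: draw_dirichlet_def inner del: fun_upd_apply)
    also have "\<dots> = dirichlet_chain t (\<lambda>u. output_dist N (c u)) (I # L) u"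
      using Cons.prems by (simp only: dirichlet_chain.simps) (subst Cons.IH, auto)
    finally show ?case .
  qed simp
  then show ?thesis unfolding step2_def by simp
qed

section \<open>The random signs of the last step\<close>

primrec sign_chain :: "(nat \<Rightarrow> real) measure \<Rightarrow> (nat \<Rightarrow> real) \<Rightarrow> nat list \<Rightarrow> (nat \<Rightarrow> real) \<Rightarrow> (nat \<Rightarrow> real) measure" where
  "sign_chain N x [] y = return N y"
| "sign_chain N x (i # L) y = Giry_Monad.bind sign_dist (\<lambda>e. sign_chain N x L (y(i := e * x i)))"

lemma output_dist_step6: "output_dist N (step6 n x) = sign_chain N x [0..<n] x"
proof -
  have "output_dist N (foreach L y (\<lambda>i y. do { e \<leftarrow> draw sign_dist; compute (y(i := e * x i)) })) = sign_chain N x L y" for L y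
    by (induction L arbitrary: y) (simp_all add: draw_def compute_def)
  then show ?thesis by (simp add: step6_def)
qed

lemma sign_chain_measurable:
  assumes "set L \<subseteq> {..<n}"
  shows "(\<lambda>p. sign_chain (borel_vec n) (fst p) L (snd p)) \<in> borel_vec n \<Otimes>\<^sub>M borel_vec n \<rightarrow>\<^sub>M subprob_algebra (borel_vec n)"
  using assms
proof (induction L)
  case (Cons i L)
  let ?N = "borel_vec n"
  have D: "sign_dist \<in> space (subprob_algebra borel)"
    by (simp add: space_subprob_algebra prob_space_imp_subprob_space prob_space_sign_dist)
  have [measurable]: "(\<lambda>q. fst (fst q) i) \<in> borel_measurable ((?N \<Otimes>\<^sub>M ?N) \<Otimes>\<^sub>M borel)"
    by (rule measurable_compose[OF measurable_compose[OF measurable_fst measurable_fst] measurable_component_singleton])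
      (use Cons.prems in simp)
  have "(\<lambda>q. (snd (fst q))(i := snd q * fst (fst q) i)) \<in> (?N \<Otimes>\<^sub>M ?N) \<Otimes>\<^sub>M borel \<rightarrow>\<^sub>M ?N"
    by (rule measurable_fun_upd[where J = "{..<n}"]) (use Cons.prems in auto)
  then have "(\<lambda>q. (fst (fst q), (snd (fst q))(i := snd q * fst (fst q) i))) \<in> (?N \<Otimes>\<^sub>M ?N) \<Otimes>\<^sub>M borel \<rightarrow>\<^sub>M ?N \<Otimes>\<^sub>M ?N"
    by (intro measurable_Pair measurable_compose[OF measurable_fst measurable_fst])
  from measurable_compose[OF this Cons.IH] Cons.prems
  have "(\<lambda>q. sign_chain ?N (fst (fst q)) L ((snd (fst q))(i := snd q * fst (fst q) i)))
      \<in> (?N \<Otimes>\<^sub>M ?N) \<Otimes>\<^sub>M borel \<rightarrow>\<^sub>M subprob_algebra ?N"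
    by (simp del: fun_upd_apply)
  then show ?case
    unfolding sign_chain.simps by (intro measurable_bind[OF measurable_const[OF D]])
qed (simp add: measurable_compose[OF measurable_snd return_measurable])

text \<open>The set \<open>S\<close> holds the coordinates already multiplied by their sign.
  Recording the signs in \<open>e\<close> turns successive overwriting of the output into an
  integral over a sign vector.\<close>

lemma nn_integral_sign_chain:
  assumes G: "G \<in> borel_measurable (borel_vec n)" and L: "set L \<subseteq> {..<n}" and x: "x \<in> space (borel_vec n)"
    and "(\<lambda>j. if j \<in> S then e j * x j else y j) \<in> space (borel_vec n)"
  shows "(\<integral>\<^sup>+x. G x \<partial>sign_chain (borel_vec n) x L (\<lambda>j. if j \<in> S then e j * x j else y j)) =
    iterated (\<lambda>_. sign_dist) L (\<lambda>e. G (\<lambda>j. if j \<in> S \<union> set L then e j * x j else y j)) e"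
  using L assms(4)
proof (induction L arbitrary: S e)
  case Nil
  then show ?case using G by (simp add: nn_integral_return)
next
  case (Cons i L)
  let ?N = "borel_vec n"
  let ?y = "\<lambda>S e j. if j \<in> S then e j * x j else y j"
  have upd: "(?y S e)(i := d * x i) = ?y (insert i S) (e(i := d))" for d
    by auto
  have sp: "(?y S e)(i := d * x i) \<in> space ?N" for d
    using Cons.prems by (auto simp: space_PiM PiE_def extensional_def)
  have "(\<lambda>d. (x, (?y S e)(i := d * x i))) \<in> sign_dist \<rightarrow>\<^sub>M ?N \<Otimes>\<^sub>M ?N"
    by (intro measurable_Pair measurable_const[OF x] measurable_fun_upd[where J = "{..<n}"] measurable_const Cons.prems(2))
      (use Cons.prems(1) in auto)
  from measurable_compose[OF this sign_chain_measurable] Cons.prems(1)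
  have "(\<lambda>d. sign_chain ?N x L ((?y S e)(i := d * x i))) \<in> sign_dist \<rightarrow>\<^sub>M subprob_algebra ?N"
    by (simp del: fun_upd_apply)
  then have "(\<integral>\<^sup>+x. G x \<partial>sign_chain ?N x (i # L) (?y S e))
    = (\<integral>\<^sup>+d. (\<integral>\<^sup>+x. G x \<partial>sign_chain ?N x L ((?y S e)(i := d * x i))) \<partial>sign_dist)"
    unfolding sign_chain.simps by (rule nn_integral_bind[OF G])
  also have "\<dots> = (\<integral>\<^sup>+d. iterated (\<lambda>_. sign_dist) L (\<lambda>e. G (?y (insert i S \<union> set L) e)) (e(i := d)) \<partial>sign_dist)"
    unfolding upd by (intro nn_integral_cong Cons.IH) (use Cons.prems sp upd in auto)
  finally show ?case by (simp add: Un_insert_left[symmetric] Un_insert_right del: Un_insert_left)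
qed

section \<open>Steps 3 to 6 as a kernel and the law of the whole sampler\<close>

definition scaled_leaves :: "ltree \<Rightarrow> real \<Rightarrow> real \<Rightarrow> (node \<Rightarrow> nat \<Rightarrow> real) \<Rightarrow> nat \<Rightarrow> real" where
  "scaled_leaves t w c u = (\<lambda>i\<in>{..<leaf_count t}.
     w * (c * path_prod u (leaf_nodes t ! i) / lp_nested t (\<lambda>i. c * path_prod u (leaf_nodes t ! i))))"

lemma scaled_leaves_measurable:
  "(\<lambda>q. scaled_leaves t (snd q) (fst (fst q)) (snd (fst q))) \<in>
    (borel \<Otimes>\<^sub>M node_space) \<Otimes>\<^sub>M borel \<rightarrow>\<^sub>M borel_vec (leaf_count t)"
proof -
  have "(\<lambda>q i. fst (fst q) * path_prod (snd (fst q)) (leaf_nodes t ! i)) \<in>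
      (borel \<Otimes>\<^sub>M node_space) \<Otimes>\<^sub>M (borel :: real measure) \<rightarrow>\<^sub>M seq_space"
  proof (rule measurable_PiM_single')
    fix i show "(\<lambda>q. fst (fst q) * path_prod (snd (fst q)) (leaf_nodes t ! i))
      \<in> borel_measurable ((borel \<Otimes>\<^sub>M node_space) \<Otimes>\<^sub>M (borel :: real measure))"
      by measurable
  qed auto
  from measurable_compose[OF this lp_nested_measurable_seq[of t]]
  have [measurable]: "(\<lambda>q. lp_nested t (\<lambda>i. fst (fst q) * path_prod (snd (fst q)) (leaf_nodes t ! i))) \<in>
      borel_measurable ((borel \<Otimes>\<^sub>M node_space) \<Otimes>\<^sub>M (borel :: real measure))" .
  show ?thesis
    unfolding scaled_leaves_def by (rule measurable_restrict) measurable
qed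

definition output_kernel :: "ltree \<Rightarrow> (real \<Rightarrow> real) \<Rightarrow> real \<Rightarrow> (node \<Rightarrow> nat \<Rightarrow> real) \<Rightarrow> (nat \<Rightarrow> real) measure" where
  "output_kernel t r c u = Giry_Monad.bind (density_dist r) (\<lambda>w.
     sign_chain (borel_vec (leaf_count t)) (scaled_leaves t w c u) [0..<leaf_count t] (scaled_leaves t w c u))"

lemma output_dist_steps_3_to_6:
  "output_dist (borel_vec (leaf_count t)) (do {
     v \<leftarrow> step3 t c u;
     y \<leftarrow> step4 t v;
     x \<leftarrow> step5 r (leaf_count t) y;
     step6 (leaf_count t) x
   }) = output_kernel t r c u"
proof -
  let ?n = "leaf_count t" and ?N = "borel_vec (leaf_count t)"
  obtain v where v: "runs_to (step3 t c u) v" "\<And>J. J \<in> set (leaf_nodes t) \<Longrightarrow> v J = c * path_prod u J"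
    using step3_runs_to[of t c u] by blast
  let ?y = "\<lambda>i. if i < ?n then v (leaf_nodes t ! i) / lp_nested t (\<lambda>i. v (leaf_nodes t ! i)) else undefined"
  have f: "lp_nested t (\<lambda>i. v (leaf_nodes t ! i)) = lp_nested t (\<lambda>i. c * path_prod u (leaf_nodes t ! i))"
    by (rule lp_nested_cong_abs) (simp add: v(2))
  have x: "(\<lambda>i. if i < ?n then w * ?y i else ?y i) = scaled_leaves t w c u" for w
    by (auto simp: fun_eq_iff scaled_leaves_def f v(2))
  have "output_dist ?N (do { v \<leftarrow> step3 t c u; y \<leftarrow> step4 t v; x \<leftarrow> step5 r ?n y; step6 ?n x })
    = output_dist ?N (do { x \<leftarrow> step5 r ?n ?y; step6 ?n x })"
    by (simp only: output_dist_runs_to[OF v(1)] output_dist_runs_to[OF step4_runs_to])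
  also have "\<dots> = Giry_Monad.bind (density_dist r) (\<lambda>w. output_dist ?N (step6 ?n (\<lambda>i. if i < ?n then w * ?y i else ?y i)))"
    unfolding step5_def by (simp add: bind_prog_assoc draw_def output_dist_runs_to[OF runs_to_tabulate])
  also have "\<dots> = output_kernel t r c u"
    unfolding x output_dist_step6 output_kernel_def ..
  finally show ?thesis .
qed

lemma output_dist_sampler:
  "output_dist (borel_vec (leaf_count t)) (lp_nested_sampler t r) =
    Giry_Monad.bind (beta_dist (leaf_count t) 1) (\<lambda>c. dirichlet_chain t (output_kernel t r c) (inner_nodes t) (\<lambda>_ _. 0))"
proof -
  obtain m where m: "runs_to (leaf_counts_prog t) m" "\<And>I. I \<in> set (nodes t) \<Longrightarrow> m I = leaf_count (subtree t I)"
    using leaf_counts_prog_runs_to[of t] by blast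
  have root: "m [] = leaf_count t" using m(2)[OF root_in_nodes] by simp
  show ?thesis
    unfolding lp_nested_sampler_def output_dist_runs_to[OF m(1)] root
    by (simp add: draw_def output_dist_step2[OF m(2)] output_dist_steps_3_to_6)
qed

lemma sigma_finite_density_dist: "positive_density r \<Longrightarrow> sigma_finite_measure (density_dist r)"
  by (rule prob_space_imp_sigma_finite) (rule prob_space_density_dist)

lemma sets_density_dist [simp, measurable_cong]: "sets (density_dist r) = sets borel"
  by (simp add: density_dist_def)

lemma scaled_sign_kernel_measurable:
  "(\<lambda>q. sign_chain (borel_vec (leaf_count t)) (scaled_leaves t (snd q) (fst (fst q)) (snd (fst q))) [0..<leaf_count t]
      (scaled_leaves t (snd q) (fst (fst q)) (snd (fst q))))
    \<in> (borel \<Otimes>\<^sub>M node_space) \<Otimes>\<^sub>M borel \<rightarrow>\<^sub>M subprob_algebra (borel_vec (leaf_count t))"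
proof -
  have "set [0..<leaf_count t] \<subseteq> {..<leaf_count t}" by auto
  from measurable_compose[OF measurable_Pair[OF scaled_leaves_measurable scaled_leaves_measurable] sign_chain_measurable[OF this]]
  show ?thesis by simp
qed

lemma output_kernel_measurable:
  assumes "positive_density r"
  shows "(\<lambda>p. output_kernel t r (fst p) (snd p)) \<in> borel \<Otimes>\<^sub>M node_space \<rightarrow>\<^sub>M subprob_algebra (borel_vec (leaf_count t))"
proof -
  have D: "density_dist r \<in> space (subprob_algebra borel)"
    using prob_space_density_dist[OF assms] by (simp add: space_subprob_algebra prob_space_imp_subprob_space)
  show ?thesis
    unfolding output_kernel_def
    by (rule measurable_bind[OF measurable_const[OF D] scaled_sign_kernel_measurable])
qed

lemma nn_integral_output_kernel:
  assumes r: "positive_density r" and G: "G \<in> borel_measurable (borel_vec (leaf_count t))"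
  shows "(\<integral>\<^sup>+x. G x \<partial>output_kernel t r c u) = (\<integral>\<^sup>+w. iterated (\<lambda>_. sign_dist) [0..<leaf_count t]
    (\<lambda>e. G (\<lambda>j\<in>{..<leaf_count t}. e j * scaled_leaves t w c u j)) (\<lambda>_. 0) \<partial>density_dist r)"
proof -
  let ?n = "leaf_count t" and ?N = "borel_vec (leaf_count t)"
  have "(\<lambda>w. ((c, u), w)) \<in> density_dist r \<rightarrow>\<^sub>M (borel \<Otimes>\<^sub>M node_space) \<Otimes>\<^sub>M borel"
    by (intro measurable_Pair measurable_const) (auto simp: space_pair_measure space_PiM)
  from measurable_compose[OF this scaled_sign_kernel_measurable]
  have "(\<lambda>w. sign_chain ?N (scaled_leaves t w c u) [0..<?n] (scaled_leaves t w c u)) \<in> density_dist r \<rightarrow>\<^sub>M subprob_algebra ?N"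
    by simp
  then have "(\<integral>\<^sup>+x. G x \<partial>output_kernel t r c u) =
    (\<integral>\<^sup>+w. (\<integral>\<^sup>+x. G x \<partial>sign_chain ?N (scaled_leaves t w c u) [0..<?n] (scaled_leaves t w c u)) \<partial>density_dist r)"
    unfolding output_kernel_def by (rule nn_integral_bind[OF G])
  also have "\<dots> = (\<integral>\<^sup>+w. iterated (\<lambda>_. sign_dist) [0..<?n]
    (\<lambda>e. G (\<lambda>j\<in>{..<?n}. e j * scaled_leaves t w c u j)) (\<lambda>_. 0) \<partial>density_dist r)"
  proof (rule nn_integral_cong)
    fix w
    let ?x = "scaled_leaves t w c u"
    have x: "?x \<in> space ?N" by (simp add: scaled_leaves_def space_PiM)
    have "(\<integral>\<^sup>+x. G x \<partial>sign_chain ?N ?x [0..<?n] ?x) =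
      iterated (\<lambda>_. sign_dist) [0..<?n] (\<lambda>e. G (\<lambda>j. if j \<in> {..<?n} then e j * ?x j else ?x j)) (\<lambda>_. 0)"
      using nn_integral_sign_chain[OF G _ x, of "[0..<?n]" "{}" "\<lambda>_. 0" ?x] x by (simp add: atLeast0LessThan)
    moreover have "(\<lambda>j. if j \<in> {..<?n} then e j * ?x j else ?x j) = (\<lambda>j\<in>{..<?n}. e j * ?x j)" for e
      by (auto simp: fun_eq_iff scaled_leaves_def)
    ultimately show "(\<integral>\<^sup>+x. G x \<partial>sign_chain ?N ?x [0..<?n] ?x) =
      iterated (\<lambda>_. sign_dist) [0..<?n] (\<lambda>e. G (\<lambda>j\<in>{..<?n}. e j * ?x j)) (\<lambda>_. 0)"
      by (simp only:)
  qed
  finally show ?thesis .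
qed

text \<open>The beta law is treated as another density on the half-line, which yields both its total
  mass and the almost sure positivity of the first draw. The exponent 1 - 1 is left unevaluated to
  match \<open>beta_dist\<close>.\<close>

lemma positive_density_beta:
  assumes "0 < n"
  shows "positive_density (\<lambda>x. indicator {0<..<1} x * (x powr (real n - 1) * (1 - x) powr (1 - 1) / Beta (real n) 1))"
  unfolding positive_density_def
proof (intro conjI)
  let ?f = "\<lambda>x :: real. x powr (real n - 1) * (1 - x) powr (1 - 1)"
  let ?B = "Beta (real n) 1"
  have B: "0 < ?B" using assms by (simp add: Beta_def Gamma_real_pos)
  show "\<forall>x. 0 \<le> indicator {0<..<1} x * (?f x / ?B)"
    using B by (auto split: split_indicator)
  have "(?f has_integral ?B) {0<..<1}"
    using has_integral_Beta_real[of "real n" 1] assms by (simp add: has_integral_Icc_iff_Ioo)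
  then have "((\<lambda>x. ?f x / ?B) has_integral 1) {0<..<1}"
    using has_integral_divide[of ?f ?B "{0<..<1}" ?B] B by simp
  then have "(\<integral>\<^sup>+x. ennreal (indicator {0<..<1} x * (?f x / ?B)) \<partial>lborel) = ennreal 1"
    by (rule nn_integral_has_integral_lebesgue[rotated]) (use B in auto)
  then show "(\<integral>\<^sup>+x. ennreal (indicator {0<..<1} x * (?f x / ?B)) \<partial>lborel) = 1" by simp
qed (auto split: split_indicator)

text \<open>For every positive value of the first draw the output has the same law, so averaging
  over the beta law changes nothing. The program draws directions, radius and signs in this order;
  two applications of Fubini bring them into the order radius, signs, directions.\<close>

lemma nn_integral_sampler:
  assumes t: "lp_tree t" and r: "positive_density r"
    and G [measurable]: "G \<in> borel_measurable (borel_vec (leaf_count t))"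
  shows "(\<integral>\<^sup>+x. G x \<partial>output_dist (borel_vec (leaf_count t)) (lp_nested_sampler t r)) =
      (\<integral>\<^sup>+w. sphere_mean t (\<lambda>x. G (restrict x {..<leaf_count t})) w \<partial>density_dist r)"
    and "sets (output_dist (borel_vec (leaf_count t)) (lp_nested_sampler t r)) = sets (borel_vec (leaf_count t))"
proof -
  interpret S: iter_measures "\<lambda>_::nat. sign_dist" "\<lambda>_. borel" by (rule iter_measures_sign_dist)
  interpret T: iter_measures "tree_laws t" "\<lambda>_. seq_space" by (rule iter_measures_tree_laws)
  let ?n = "leaf_count t" and ?N = "borel_vec (leaf_count t)"
  let ?G = "\<lambda>x. G (restrict x {..<?n})"
  let ?I = "\<integral>\<^sup>+w. sphere_mean t ?G w \<partial>density_dist r"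
  let ?chain = "\<lambda>c. dirichlet_chain t (output_kernel t r c) (inner_nodes t) (\<lambda>_ _. 0)"
  have beta: "beta_dist ?n 1 = density_dist (\<lambda>x. indicator {0<..<1} x * (x powr (real ?n - 1) * (1 - x) powr (1 - 1) / Beta (real ?n) 1))"
    by (simp add: beta_dist_def)
  note pos = positive_density_beta[OF leaf_count_pos[OF t]]
  interpret beta: prob_space "beta_dist ?n 1"
    unfolding beta by (rule prob_space_density_dist[OF pos])
  have sets_beta [simp]: "sets (beta_dist ?n 1) = sets borel" by (simp add: beta_dist_def)
  have "(\<lambda>c. (c, \<lambda>_ _. 0)) \<in> beta_dist ?n 1 \<rightarrow>\<^sub>M borel \<Otimes>\<^sub>M node_space"
    by (intro measurable_Pair measurable_const measurable_ident_sets sets_beta) (simp add: space_PiM)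
  from measurable_compose[OF this dirichlet_chain_measurable[OF t output_kernel_measurable[OF r] subset_refl]]
  have chain: "?chain \<in> beta_dist ?n 1 \<rightarrow>\<^sub>M subprob_algebra ?N" by simp
  show "sets (output_dist ?N (lp_nested_sampler t r)) = sets ?N"
    unfolding output_dist_sampler by (rule sets_bind_measurable[OF chain beta.not_empty])
  have G' [measurable]: "?G \<in> borel_measurable seq_space" by measurable
  let ?F = "\<lambda>w u e. ?G (leaf_vec t e w u)"
  have "(\<integral>\<^sup>+x. G x \<partial>?chain c) = ?I" if "0 < c" for c
  proof -
    have "(\<lambda>u. (c, u)) \<in> node_space \<rightarrow>\<^sub>M borel \<Otimes>\<^sub>M node_space"
      by (intro measurable_Pair measurable_const measurable_ident_sets) auto
    from measurable_compose[OF this output_kernel_measurable[OF r]]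
    have "output_kernel t r c \<in> node_space \<rightarrow>\<^sub>M subprob_algebra ?N" by simp
    then have "(\<integral>\<^sup>+x. G x \<partial>?chain c)
      = iterated (tree_laws t) (inner_nodes t) (\<lambda>u. \<integral>\<^sup>+x. G x \<partial>output_kernel t r c u) (\<lambda>_ _. 0)"
      by (rule nn_integral_dirichlet_chain[OF t _ G subset_refl])
    also have "\<dots> = iterated (tree_laws t) (inner_nodes t)
        (\<lambda>u. \<integral>\<^sup>+w. iterated (\<lambda>_. sign_dist) [0..<?n] (?F w u) (\<lambda>_. 0) \<partial>density_dist r) (\<lambda>_ _. 0)"
    proof (rule iter_cong_AE[where P = "unit_entry t" and S = "{}", OF AE_tree_laws[OF t]])
      fix u :: "node \<Rightarrow> nat \<Rightarrow> real"
      assume "\<And>I. I \<in> {} \<union> set (inner_nodes t) \<Longrightarrow> unit_entry t I (u I)"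
      then have "lp_nested t (\<lambda>i. path_prod u (leaf_nodes t ! i)) = 1"
        by (intro lp_nested_path_prod[OF t]) auto
      \<comment> \<open>Almost surely the path products lie on the unit level set, so f of the
        scaled vector is c, and the division removes c.\<close>
      then have "lp_nested t (\<lambda>i. c * path_prod u (leaf_nodes t ! i)) = c"
        using that by (simp add: lp_nested_scale[OF t])
      then have "(\<lambda>j\<in>{..<?n}. e j * scaled_leaves t w c u j) = restrict (leaf_vec t e w u) {..<?n}" for e w
        using that by (auto simp: fun_eq_iff scaled_leaves_def leaf_vec_def)
      then show "(\<integral>\<^sup>+x. G x \<partial>output_kernel t r c u) =
          (\<integral>\<^sup>+w. iterated (\<lambda>_. sign_dist) [0..<?n] (?F w u) (\<lambda>_. 0) \<partial>density_dist r)"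
        by (simp add: nn_integral_output_kernel[OF r G])
    qed auto
    also have "\<dots> = (\<integral>\<^sup>+w. iterated (tree_laws t) (inner_nodes t) (\<lambda>u. iterated (\<lambda>_. sign_dist) [0..<?n] (?F w u) (\<lambda>_. 0)) (\<lambda>_ _. 0) \<partial>density_dist r)"
    proof (rule T.iter_swap[OF sigma_finite_density_dist[OF r]])
      show "(\<lambda>p. iterated (\<lambda>_. sign_dist) [0..<?n] (?F (fst p) (snd p)) (\<lambda>_. 0)) \<in> borel_measurable (density_dist r \<Otimes>\<^sub>M node_space)"
        by (rule S.iter_measurable) measurable
    qed (simp add: space_PiM)
    also have "\<dots> = ?I"
    proof (rule nn_integral_cong)
      fix w
      have "(\<lambda>p. ?F w (snd p) (fst p)) \<in> borel_measurable (seq_space \<Otimes>\<^sub>M node_space)" by measurable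
      note swap = iter_iter_swap[OF iter_measures_tree_laws iter_measures_sign_dist this]
      show "iterated (tree_laws t) (inner_nodes t) (\<lambda>u. iterated (\<lambda>_. sign_dist) [0..<?n] (?F w u) (\<lambda>_. 0)) (\<lambda>_ _. 0) = sphere_mean t ?G w"
        unfolding sphere_mean_def by (rule swap) (simp_all add: space_PiM)
    qed
    finally show ?thesis .
  qed
  \<comment> \<open>Excludes a zero vector, for which the normalization would fail.\<close>
  moreover have "AE c in beta_dist ?n 1. 0 < c"
    unfolding beta by (rule AE_density_dist[OF pos])
  ultimately have "(\<integral>\<^sup>+c. (\<integral>\<^sup>+x. G x \<partial>?chain c) \<partial>beta_dist ?n 1) = (\<integral>\<^sup>+c. ?I \<partial>beta_dist ?n 1)"
    by (intro nn_integral_cong_AE) auto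
  then show "(\<integral>\<^sup>+x. G x \<partial>output_dist ?N (lp_nested_sampler t r)) = ?I"
    unfolding output_dist_sampler nn_integral_bind[OF G chain] by (simp add: beta.emeasure_space_1)
qed

lemma sampler_eq_nested_dist:
  assumes t: "lp_tree t" and c: "polar_const t c" and r: "positive_density r"
  shows "output_dist (borel_vec (leaf_count t)) (lp_nested_sampler t r) = nested_dist t c r"
proof (rule measure_eqI)
  let ?Q = "output_dist (borel_vec (leaf_count t)) (lp_nested_sampler t r)"
  have sets: "sets ?Q = sets (borel_vec (leaf_count t))"
    by (rule nn_integral_sampler(2)[OF t r measurable_const[of 0]]) simp
  then show "sets ?Q = sets (nested_dist t c r)" by (simp add: nested_dist_def)
  fix A assume A: "A \<in> sets ?Q"
  then have I: "(indicator A :: _ \<Rightarrow> ennreal) \<in> borel_measurable (borel_vec (leaf_count t))"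
    using sets by simp
  have "(\<integral>\<^sup>+x. indicator A x \<partial>?Q) = (\<integral>\<^sup>+x. indicator A x \<partial>nested_dist t c r)"
    unfolding nn_integral_sampler(1)[OF t r I] nn_integral_nested_dist[OF t c r I] ..
  then show "emeasure ?Q A = emeasure (nested_dist t c r) A"
    using A sets by (simp add: nested_dist_def)
qed

section \<open>Cost\<close>

text \<open>The bound on the continuation must hold for every value, including values that the first
  program never returns.\<close>

lemma worst_cost_bind_le:
  assumes "\<And>a. worst_cost (c a) \<le> B"
  shows "worst_cost (bind_prog p c) \<le> worst_cost p + B"
proof (induction p)
  case (Step p)
  then show ?case by (simp add: add.assoc add_left_mono)
next
  case (Draw D q)
  have "(SUP y. worst_cost (bind_prog (q y) c)) \<le> (SUP y. worst_cost (q y)) + B"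
    by (rule SUP_least, rule order_trans[OF Draw]) (auto intro: add_right_mono SUP_upper)
  then show ?case by (simp add: add.assoc add_left_mono)
next
  case (Draw_Dirichlet k a q)
  have "(SUP s. worst_cost (bind_prog (q s) c)) \<le> (SUP s. worst_cost (q s)) + B"
    by (rule SUP_least, rule order_trans[OF Draw_Dirichlet]) (auto intro: add_right_mono SUP_upper)
  then show ?case by (simp add: add.assoc add_left_mono)
qed (simp add: assms)

lemma worst_cost_bind_le':
  assumes "worst_cost p \<le> enat A" "\<And>a. worst_cost (c a) \<le> enat B" "A + B \<le> C"
  shows "worst_cost (bind_prog p c) \<le> enat C"
proof -
  have "worst_cost (bind_prog p c) \<le> worst_cost p + enat B"
    by (rule worst_cost_bind_le) (rule assms(2))
  also have "\<dots> \<le> enat A + enat B" using assms(1) by (rule add_right_mono)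
  also have "\<dots> \<le> enat C" using assms(3) by simp
  finally show ?thesis .
qed

lemma worst_cost_compute [simp]: "worst_cost (compute a) = 1"
  by (simp add: compute_def)

lemma worst_cost_draw [simp]: "worst_cost (draw D) = 1"
  by (simp add: draw_def)

lemma worst_cost_draw_dirichlet [simp]: "worst_cost (draw_dirichlet k a) = enat k"
  by (simp add: draw_dirichlet_def)

lemma worst_cost_foreach_le:
  assumes "\<And>i s. i \<in> set xs \<Longrightarrow> worst_cost (b i s) \<le> enat (k i)"
  shows "worst_cost (foreach xs s b) \<le> enat (\<Sum>i\<leftarrow>xs. 1 + k i)"
  using assms
proof (induction xs arbitrary: s)
  case (Cons i xs)
  have "worst_cost (bind_prog (b i s) (\<lambda>s. foreach xs s b)) \<le> enat (k i + (\<Sum>i\<leftarrow>xs. 1 + k i))"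
    by (rule worst_cost_bind_le') (use Cons in auto)
  then have "1 + worst_cost (bind_prog (b i s) (\<lambda>s. foreach xs s b)) \<le> 1 + enat (k i + (\<Sum>i\<leftarrow>xs. 1 + k i))"
    by (rule add_left_mono)
  then show ?case by (simp add: one_enat_def)
qed (simp add: zero_enat_def)

lemma worst_cost_foreach_le_const:
  assumes "\<And>i s. i \<in> set xs \<Longrightarrow> worst_cost (b i s) \<le> enat c" "(1 + c) * length xs \<le> C"
  shows "worst_cost (foreach xs s b) \<le> enat C"
proof -
  have "worst_cost (foreach xs s b) \<le> enat (\<Sum>i\<leftarrow>xs. 1 + c)"
    by (rule worst_cost_foreach_le) (rule assms(1))
  also have "\<dots> \<le> enat C" using assms(2) by (simp add: sum_list_triv mult.commute)
  finally show ?thesis .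
qed

text \<open>Every node except the root is the child of exactly one node, so the numbers of children
  add up to the number of nodes minus one. Adding \<open>b\<close> on the left avoids
  subtraction.\<close>

lemma sum_list_nodes_linear: "(\<Sum>I\<leftarrow>nodes t. a + b * child_count t I) + b = (a + b) * length (nodes t)"
proof (induction t rule: nodes.induct)
  case (2 p ts)
  have block: "(\<Sum>I\<leftarrow>subtree_nodes nodes ts ks. a + b * child_count (Node p ts) I) + b * length ks
      = (a + b) * length (subtree_nodes nodes ts ks)" if "set ks \<subseteq> {..<length ts}" for ks
    using that
  proof (induction ks)
    case (Cons k ks)
    have "(\<Sum>I\<leftarrow>nodes (ts ! k). a + b * child_count (ts ! k) I) + b = (a + b) * length (nodes (ts ! k))"
      by (rule 2) (use Cons.prems in auto)
    then show ?case using Cons by (simp add: o_def algebra_simps)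
  qed simp
  from block[of "[0..<length ts]"] show ?case
    by (simp add: nodes_Node atLeast0LessThan algebra_simps del: nodes.simps)
qed simp

text \<open>With at least two children at each inner node there are fewer inner nodes than leaves,
  so there are at most 2n - 1 nodes.\<close>

lemma length_nodes_le: "lp_tree t \<Longrightarrow> length (nodes t) + 1 \<le> 2 * leaf_count t"
proof (induction t rule: nodes.induct)
  case (2 p ts)
  have "length (subtree_nodes nodes ts ks) + length ks \<le> 2 * (\<Sum>k\<leftarrow>ks. leaf_count (ts ! k))"
    if "set ks \<subseteq> {..<length ts}" for ks
    using that
  proof (induction ks)
    case (Cons k ks)
    have "length (nodes (ts ! k)) + 1 \<le> 2 * leaf_count (ts ! k)"
      by (rule "2.IH") (use Cons.prems lp_tree_nth[OF "2.prems"] in auto)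
    then show ?case using Cons by simp
  qed simp
  from this[of "[0..<length ts]"] "2.prems" show ?case
    by (simp add: nodes_Node leaf_count_Node sum_list_upt atLeast0LessThan del: nodes.simps leaf_count.simps)
qed simp

text \<open>A traversal whose body costs \<open>a\<close> plus \<open>b\<close> per child is linear
  in the number of leaves. The multiset condition covers reversed and filtered node lists
  alike.\<close>

lemma worst_cost_foreach_nodes:
  assumes "lp_tree t" "mset xs \<subseteq># mset (nodes t)"
    and "\<And>I s. I \<in> set xs \<Longrightarrow> worst_cost (body I s) \<le> enat (a + b * child_count t I)"
    and "2 * (1 + a + b) * leaf_count t \<le> C"
  shows "worst_cost (foreach xs s body) \<le> enat C"
proof -
  let ?g = "\<lambda>I. 1 + (a + b * child_count t I)"
  have "worst_cost (foreach xs s body) \<le> enat (\<Sum>I\<leftarrow>xs. ?g I)"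
    by (rule worst_cost_foreach_le) (rule assms(3))
  also have "(\<Sum>I\<leftarrow>xs. ?g I) \<le> (\<Sum>I\<leftarrow>nodes t. ?g I)"
  proof -
    obtain R where R: "mset (nodes t) = mset xs + R"
      using assms(2) by (auto simp: mset_subset_eq_exists_conv)
    have "(\<Sum>I\<leftarrow>nodes t. ?g I) = (\<Sum>I\<in>#mset (nodes t). ?g I)" "(\<Sum>I\<leftarrow>xs. ?g I) = (\<Sum>I\<in>#mset xs. ?g I)"
      by (simp_all only: mset_map[symmetric] sum_mset_sum_list)
    then show ?thesis unfolding R by simp
  qed
  also have "\<dots> \<le> (1 + a + b) * length (nodes t)"
    using sum_list_nodes_linear[of "1 + a" b t] by simp
  also have "\<dots> \<le> (1 + a + b) * (2 * leaf_count t)"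
    using length_nodes_le[OF assms(1)] by (intro mult_left_mono) auto
  also have "\<dots> \<le> C" using assms(4) by (simp add: algebra_simps)
  finally show ?thesis by simp
qed

lemma inner_nodes_submset: "mset (inner_nodes t) \<subseteq># mset (nodes t)"
  unfolding inner_nodes_def mset_filter by (rule multiset_filter_subset)

lemma worst_cost_child_loop:
  "worst_cost (foreach (child_indices t I) s (\<lambda>k s. compute (g k s))) \<le> enat (2 * child_count t I)"
  by (rule worst_cost_foreach_le_const[where c = 1]) (simp_all add: child_indices_def one_enat_def)

lemma worst_cost_compute_enat: "worst_cost (compute a) \<le> enat 1"
  by (simp add: one_enat_def)

section \<open>Cost of the individual steps\<close>

lemma worst_cost_leaf_counts_prog:
  "lp_tree t \<Longrightarrow> worst_cost (leaf_counts_prog t) \<le> enat (8 * leaf_count t)"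
  unfolding leaf_counts_prog_def
proof (rule worst_cost_foreach_nodes[where a = 1 and b = 2])
  fix I and m :: "node \<Rightarrow> nat"
  have "worst_cost (do {
         c \<leftarrow> foreach (child_indices t I) 0 (\<lambda>k c. compute (c + m (I @ [k])));
         compute (m(I := c))
       }) \<le> enat (1 + 2 * child_count t I)"
    by (rule worst_cost_bind_le'[OF worst_cost_child_loop worst_cost_compute_enat]) simp
  then show "worst_cost (if is_leaf (subtree t I) then compute (m(I := 1))
       else do {
         c \<leftarrow> foreach (child_indices t I) 0 (\<lambda>k c. compute (c + m (I @ [k])));
         compute (m(I := c))
       }) \<le> enat (1 + 2 * child_count t I)"
    by (simp add: one_enat_def)
qed simp_all

text \<open>Per child, the two loops cost 2 each and the Dirichlet draw costs 1; one more operation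
  stores the result. Hence a = 1, b = 5, and 2 * (1 + 1 + 5) = 14.\<close>

lemma worst_cost_step2:
  "lp_tree t \<Longrightarrow> worst_cost (step2 t m) \<le> enat (14 * leaf_count t)"
  unfolding step2_def
proof (rule worst_cost_foreach_nodes[where a = 1 and b = 5, OF _ inner_nodes_submset])
  fix I u
  let ?d = "child_count t I"
  have len: "length (child_indices t I) = ?d" by (simp add: child_indices_def)
  have 1: "worst_cost (do {
       w \<leftarrow> foreach (child_indices t I) (\<lambda>_. 0)
              (\<lambda>k w. compute (w(k := s k powr (1 / node_exponent t I))));
       compute (u(I := w))
     }) \<le> enat (2 * ?d + 1)" for s :: "nat \<Rightarrow> real"
    by (rule worst_cost_bind_le'[OF worst_cost_child_loop worst_cost_compute_enat order_refl])
  have 2: "worst_cost (do {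
       s \<leftarrow> draw_dirichlet (length (child_indices t I)) a;
       w \<leftarrow> foreach (child_indices t I) (\<lambda>_. 0)
              (\<lambda>k w. compute (w(k := s k powr (1 / node_exponent t I))));
       compute (u(I := w))
     }) \<le> enat (3 * ?d + 1)" for a
    by (rule worst_cost_bind_le'[where A = ?d, OF _ 1]) (simp_all add: len)
  show "worst_cost (do {
       a \<leftarrow> foreach (child_indices t I) (\<lambda>_. 0)
              (\<lambda>k a. compute (a(k := real (m (I @ [k])) / node_exponent t I)));
       s \<leftarrow> draw_dirichlet (length (child_indices t I)) a;
       w \<leftarrow> foreach (child_indices t I) (\<lambda>_. 0)
              (\<lambda>k w. compute (w(k := s k powr (1 / node_exponent t I))));
       compute (u(I := w))
     }) \<le> enat (1 + 5 * ?d)"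
    by (rule worst_cost_bind_le'[OF worst_cost_child_loop 2]) simp
qed simp_all

lemma worst_cost_step3:
  "lp_tree t \<Longrightarrow> worst_cost (step3 t c u) \<le> enat (6 * leaf_count t)"
  unfolding step3_def
  by (rule worst_cost_foreach_nodes[where a = 0 and b = 2, OF _ inner_nodes_submset])
    (simp_all add: worst_cost_child_loop)

text \<open>With a = 1 and b = 2 the traversal costs at most 2 * (1 + 1 + 2) = 8 per leaf; the final
  access to the root adds 1.\<close>

lemma worst_cost_eval_nested:
  "lp_tree t \<Longrightarrow> worst_cost (eval_nested t v) \<le> enat (8 * leaf_count t + 1)"
  unfolding eval_nested_def
proof (rule worst_cost_bind_le'[OF _ worst_cost_compute_enat order_refl], rule worst_cost_foreach_nodes[where a = 1 and b = 2])
  fix I and F :: "node \<Rightarrow> real"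
  have "worst_cost (do {
         c \<leftarrow> foreach (child_indices t I) 0 (\<lambda>k c. compute (c + F (I @ [k]) powr node_exponent t I));
         compute (F(I := c powr (1 / node_exponent t I)))
       }) \<le> enat (1 + 2 * child_count t I)"
    by (rule worst_cost_bind_le'[OF worst_cost_child_loop worst_cost_compute_enat]) simp
  then show "worst_cost (if is_leaf (subtree t I) then compute (F(I := \<bar>v I\<bar>))
       else do {
         c \<leftarrow> foreach (child_indices t I) 0 (\<lambda>k c. compute (c + F (I @ [k]) powr node_exponent t I));
         compute (F(I := c powr (1 / node_exponent t I)))
       }) \<le> enat (1 + 2 * child_count t I)"
    by (simp add: one_enat_def)
qed simp_all

lemma worst_cost_step4:
  "lp_tree t \<Longrightarrow> worst_cost (step4 t v) \<le> enat (10 * leaf_count t + 1)"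
  unfolding step4_def
  by (rule worst_cost_bind_le'[OF worst_cost_eval_nested], assumption,
      rule worst_cost_foreach_le_const[where c = 1, OF _ order_refl])
    (auto simp: one_enat_def)

lemma worst_cost_step5: "worst_cost (step5 r n u) \<le> enat (2 * n + 1)"
  unfolding step5_def
  by (rule worst_cost_bind_le'[where A = 1, OF _ worst_cost_foreach_le_const[where c = 1, OF _ order_refl]])
    (simp_all add: one_enat_def)

lemma worst_cost_step6: "worst_cost (step6 n x) \<le> enat (3 * n)"
  unfolding step6_def
  by (rule worst_cost_foreach_le_const[where c = 2],
      rule worst_cost_bind_le'[where A = 1, OF _ worst_cost_compute_enat])
    (simp_all add: one_enat_def)

lemma worst_cost_sampler:
  assumes t: "lp_tree t"
  shows "worst_cost (lp_nested_sampler t r) \<le> enat (46 * leaf_count t)"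
proof -
  let ?n = "leaf_count t"
  \<comment> \<open>The cost of the last steps grows with \<open>m []\<close>, so no bound is
    uniform in an arbitrary array. The counting stage is deterministic, and its actual result
    replaces \<open>m []\<close> by n.\<close>
  obtain m where m: "runs_to (leaf_counts_prog t) m" "\<And>I. I \<in> set (nodes t) \<Longrightarrow> m I = leaf_count (subtree t I)"
    using leaf_counts_prog_runs_to[of t] by blast
  have root: "m [] = ?n" using m(2)[OF root_in_nodes] by simp
  have A: "worst_cost (do { x \<leftarrow> step5 r ?n y; step6 ?n x }) \<le> enat (5 * ?n + 1)" for y
    by (rule worst_cost_bind_le'[OF worst_cost_step5 worst_cost_step6]) simp
  have B: "worst_cost (do { y \<leftarrow> step4 t v; x \<leftarrow> step5 r ?n y; step6 ?n x }) \<le> enat (15 * ?n + 2)" for v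
    by (rule worst_cost_bind_le'[OF worst_cost_step4[OF t] A]) simp
  have C: "worst_cost (do { v \<leftarrow> step3 t v0 u; y \<leftarrow> step4 t v; x \<leftarrow> step5 r ?n y; step6 ?n x }) \<le> enat (21 * ?n + 2)" for v0 u
    by (rule worst_cost_bind_le'[OF worst_cost_step3[OF t] B]) simp
  have D: "worst_cost (do { u \<leftarrow> step2 t m; v \<leftarrow> step3 t v0 u; y \<leftarrow> step4 t v; x \<leftarrow> step5 r ?n y; step6 ?n x })
      \<le> enat (35 * ?n + 2)" for v0
    by (rule worst_cost_bind_le'[OF worst_cost_step2[OF t] C]) simp
  have E: "worst_cost (do { v0 \<leftarrow> draw (beta_dist (real ?n) 1); u \<leftarrow> step2 t m; v \<leftarrow> step3 t v0 u;
      y \<leftarrow> step4 t v; x \<leftarrow> step5 r ?n y; step6 ?n x }) \<le> enat (35 * ?n + 3)"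
    by (rule worst_cost_bind_le'[where A = 1, OF _ D]) (simp_all add: one_enat_def)
  have "worst_cost (lp_nested_sampler t r) \<le> enat (8 * ?n) + enat (35 * ?n + 3)"
    unfolding lp_nested_sampler_def worst_cost_runs_to[OF m(1)] root
    by (rule add_mono[OF worst_cost_leaf_counts_prog[OF t] E])
  \<comment> \<open>The additive constant 3 is absorbed by 3n, since a tree has at least one leaf: 8
    + 35 + 3 = 46.\<close>
  also have "\<dots> \<le> enat (46 * ?n)"
    using leaf_count_pos[OF t] by simp
  finally show ?thesis .
qed

theorem mainTheorem8:
  shows "(\<forall>t r. lp_tree t \<and> 2 \<le> leaf_count t \<and> positive_density r \<longrightarrow>
            (\<forall>M. lp_nested_symmetric t M \<and> radial_density t M r \<longleftrightarrow>
                 M = output_dist (borel_vec (leaf_count t)) (lp_nested_sampler t r))) \<and>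
         (\<exists>C::nat. \<forall>t r. lp_tree t \<and> 2 \<le> leaf_count t \<and> positive_density r \<longrightarrow>
            worst_cost (lp_nested_sampler t r) \<le> enat (C * leaf_count t))"
proof (intro conjI allI impI)
  fix t r M
  assume "lp_tree t \<and> 2 \<le> leaf_count t \<and> positive_density r"
  then have t: "lp_tree t" and r: "positive_density r" by auto
  \<comment> \<open>The constant depends on the tree only. With it both sides of the equivalence are
    compared to the same explicit law, which gives existence and uniqueness at once.\<close>
  obtain c where c: "polar_const t c" using polar_const_exists[OF t] .
  show "lp_nested_symmetric t M \<and> radial_density t M r \<longleftrightarrow>
      M = output_dist (borel_vec (leaf_count t)) (lp_nested_sampler t r)"
    unfolding sampler_eq_nested_dist[OF t c r]
    using nested_dist_unique[OF t c r] lp_nested_symmetric_nested_dist[OF t c r] by blast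
next
  show "\<exists>C::nat. \<forall>t r. lp_tree t \<and> 2 \<le> leaf_count t \<and> positive_density r \<longrightarrow>
      worst_cost (lp_nested_sampler t r) \<le> enat (C * leaf_count t)"
    using worst_cost_sampler by blast
qed

end
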